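(* A graph $G$ belongs to $\mathcal{U}_3$ if and only if either $G\in\mathcal{W}_3$, or $G$ is isomorphic to an extended prism with extension pattern $$(\underbrace{3,\dots,3}_{h-1},\,2,\,\underbrace{1,\dots,1}_{k-h})$$ for some integers $k\ge 3$ and $1\le h\le k$.
   Context: In a bridgeless cubic graph, an edge is lonely if it belongs to exactly one perfect matching; $l(G)$ is the number of lonely edges. $\mathcal{U}$ is the class of 3-connected cubic graphs having at least one lonely edge, and $\mathcal{U}_k=\{G\in\mathcal{U}: l(G)=k\}$. Replacing a vertex $x$ of a cubic graph by a triangle means deleting $x$, adding three new mutually adjacent vertices, and joining each of them to a distinct neighbour of $x$; a descendant of $G$ is any graph obtained from $G$ by a nonempty sequence of such replacements. The tricorn is the 10-vertex graph obtained from $K_4$ by replacing three of its vertices by triangles. The prism $Pr$ is the 6-vertex cubic graph consisting of two vertex-disjoint triangles $T_u$ and $T_v$ together with a perfect matching of three edges between them. Label the vertices of $T_v$ as $x_1,x_2,x_3$. For $s\in\{1,2,3\}$, a $T_v$-extension of index $s$ replaces $x_s$ by a new triangle $y_1y_2y_3$ in which, for each $j\ne s$, $y_j$ is joined to $x_j$, and $y_s$ is joined to the neighbour of $x_s$ outside $T_v$; afterwards the new triangle becomes $T_v$ and its vertices are renamed $x_i:=y_i$. An extended prism with extension pattern $(s_1,\dots,s_m)$ is the graph obtained from $Pr$ by applying successively $T_v$-extensions of indices $s_1,\dots,s_m$. $\mathcal{W}_3$ is the set consisting of the tricorn, all descendants of the tricorn that belong to $\mathcal{U}_3$, and the extended prism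 with extension pattern $(3,1,3)$. *)

theory Defs
  imports Main
begin

text \<open>Finite simple graphs: a vertex set and a set of 2-element edges.\<close>

record 'a graph =
  verts :: "'a set"
  edges :: "'a set set"

definition graph :: "'a graph \<Rightarrow> bool" where
  "graph G \<longleftrightarrow> finite (verts G) \<and>
     (\<forall>e\<in>edges G. \<exists>u v. e = {u, v} \<and> u \<noteq> v \<and> u \<in> verts G \<and> v \<in> verts G)"

definition degree :: "'a graph \<Rightarrow> 'a \<Rightarrow> nat" where
  "degree G v = card {e \<in> edges G. v \<in> e}"

definition cubic :: "'a graph \<Rightarrow> bool" where
  "cubic G \<longleftrightarrow> graph G \<and> (\<forall>v\<in>verts G. degree G v = 3)"

definition perfect_matching :: "'a graph \<Rightarrow> 'a set set \<Rightarrow> bool" where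
  "perfect_matching G M \<longleftrightarrow> M \<subseteq> edges G \<and> (\<forall>v\<in>verts G. \<exists>!e. e \<in> M \<and> v \<in> e)"

definition lonely :: "'a graph \<Rightarrow> 'a set \<Rightarrow> bool" where
  "lonely G e \<longleftrightarrow> e \<in> edges G \<and> card {M. perfect_matching G M \<and> e \<in> M} = 1"

definition num_lonely :: "'a graph \<Rightarrow> nat" where
  "num_lonely G = card {e \<in> edges G. lonely G e}"

text \<open>Connectivity of the graph G - S (vertices of S deleted).\<close>

definition adj_avoiding :: "'a graph \<Rightarrow> 'a set \<Rightarrow> ('a \<times> 'a) set" where
  "adj_avoiding G S = {(u, v). {u, v} \<in> edges G \<and> u \<notin> S \<and> v \<notin> S}"

definition connected_minus :: "'a graph \<Rightarrow> 'a set \<Rightarrow> bool" where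
  "connected_minus G S \<longleftrightarrow>
     (\<forall>u\<in>verts G - S. \<forall>v\<in>verts G - S. (u, v) \<in> (adj_avoiding G S)\<^sup>*)"

text \<open>3-connected: more than 3 vertices and no vertex cut of size at most 2.\<close>

definition three_connected :: "'a graph \<Rightarrow> bool" where
  "three_connected G \<longleftrightarrow> graph G \<and> card (verts G) \<ge> 4 \<and>
     (\<forall>S. S \<subseteq> verts G \<and> card S \<le> 2 \<longrightarrow> connected_minus G S)"

definition classU :: "'a graph \<Rightarrow> bool" where
  "classU G \<longleftrightarrow> cubic G \<and> three_connected G \<and> (\<exists>e. lonely G e)"

definition classU_k :: "nat \<Rightarrow> 'a graph \<Rightarrow> bool" where
  "classU_k k G \<longleftrightarrow> classU G \<and> num_lonely G = k"

text \<open>Graph isomorphism (possibly between different vertex types).\<close>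

definition iso :: "'a graph \<Rightarrow> 'b graph \<Rightarrow> bool" where
  "iso G H \<longleftrightarrow> graph G \<and> graph H \<and>
     (\<exists>f. bij_betw f (verts G) (verts H) \<and> edges H = (\<lambda>e. f ` e) ` edges G)"

text \<open>Replacing a vertex x (with neighbours a1,a2,a3) by a triangle y1 y2 y3 of fresh vertices.\<close>

definition tri_repl :: "'a graph \<Rightarrow> 'a graph \<Rightarrow> bool" where
  "tri_repl G G' \<longleftrightarrow> (\<exists>x a1 a2 a3 y1 y2 y3.
     x \<in> verts G \<and> {e \<in> edges G. x \<in> e} = {{x, a1}, {x, a2}, {x, a3}} \<and>
     distinct [a1, a2, a3] \<and> distinct [y1, y2, y3] \<and>
     y1 \<notin> verts G \<and> y2 \<notin> verts G \<and> y3 \<notin> verts G \<and>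
     G' = \<lparr>verts = (verts G - {x}) \<union> {y1, y2, y3},
           edges = (edges G - {e. x \<in> e}) \<union>
                   {{y1, y2}, {y2, y3}, {y1, y3}, {y1, a1}, {y2, a2}, {y3, a3}}\<rparr>)"

definition descendant :: "'a graph \<Rightarrow> 'a graph \<Rightarrow> bool" where
  "descendant G H \<longleftrightarrow> tri_repl\<^sup>+\<^sup>+ G H"

text \<open>The tricorn: K4 on {0,1,2,3} with vertices 1,2,3 replaced by triangles.
  Vertex 10*i+j (j \<noteq> i) of triangle i is the one joined towards old vertex j.\<close>

definition tricorn :: "nat graph" where
  "tricorn = \<lparr>verts = {0, 10, 12, 13, 20, 21, 23, 30, 31, 32},
     edges = {{0, 10}, {0, 20}, {0, 30},
              {10, 12}, {12, 13}, {10, 13},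
              {20, 21}, {21, 23}, {20, 23},
              {30, 31}, {31, 32}, {30, 32},
              {12, 21}, {13, 31}, {23, 32}}\<rparr>"

text \<open>The prism: T_u = {0,1,2}, T_v = {3,4,5}; x_i = i+2, and the outside neighbour
  of x_i is i-1. State: (graph, x, outside neighbours, offset for fresh vertices).\<close>

definition prism_init :: "nat graph \<times> (nat \<Rightarrow> nat) \<times> (nat \<Rightarrow> nat) \<times> nat" where
  "prism_init = (\<lparr>verts = {0, 1, 2, 3, 4, 5},
      edges = {{0, 1}, {1, 2}, {0, 2}, {3, 4}, {4, 5}, {3, 5}, {0, 3}, {1, 4}, {2, 5}}\<rparr>,
      (\<lambda>i. i + 2), (\<lambda>i. i - 1), 5)"

definition ext_step :: "nat \<Rightarrow> nat graph \<times> (nat \<Rightarrow> nat) \<times> (nat \<Rightarrow> nat) \<times> nat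
                         \<Rightarrow> nat graph \<times> (nat \<Rightarrow> nat) \<times> (nat \<Rightarrow> nat) \<times> nat" where
  "ext_step s st = (case st of (G, x, ou, n) \<Rightarrow>
     (let y = (\<lambda>i. n + i) in
      (\<lparr>verts = (verts G - {x s}) \<union> {y 1, y 2, y 3},
        edges = (edges G - {e. x s \<in> e}) \<union> {{y 1, y 2}, {y 2, y 3}, {y 1, y 3}}
                \<union> {{y j, x j} | j. j \<in> {1, 2, 3} \<and> j \<noteq> s} \<union> {{y s, ou s}}\<rparr>,
       y, (\<lambda>i. if i = s then ou s else x i), n + 3)))"

definition ext_prism :: "nat list \<Rightarrow> nat graph" where
  "ext_prism ss = fst (foldl (\<lambda>st s. ext_step s st) prism_init ss)"

definition classW3 :: "'a graph \<Rightarrow> bool" where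
  "classW3 G \<longleftrightarrow> iso G tricorn \<or>
     (classU_k 3 G \<and> (\<exists>H. descendant tricorn H \<and> iso G H)) \<or>
     iso G (ext_prism [3, 1, 3])"

end

theory Submission
  imports Defs
begin

text \<open>Let \<open>e = ab\<close> be a lonely edge of a 3-connected cubic graph \<open>G\<close> with more than four vertices, and
  let \<open>M\<close> be the perfect matching through \<open>e\<close>. Since \<open>G - a - b\<close> has a unique perfect matching,
  Kotzig's theorem gives a bridge of \<open>G - a - b\<close> in \<open>M\<close>. A side of this bridge is a single vertex or is
  separated from the rest of \<open>G\<close> by a cut of three edges; contracting the rest and recursing ends in a
  triangle that avoids \<open>a\<close> and \<open>b\<close> and contains an edge of \<open>M\<close>. Contracting that triangle keeps \<open>e\<close>
  lonely and the graph 3-connected. Hence \<open>G\<close> arises from \<open>K\<^sub>4\<close> by expanding vertices into triangles, with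
  a lonely edge at every stage. Expanding a vertex of an end triangle of an extended prism yields an
  extended prism, read from one end or the other, and expanding any other vertex yields the tricorn
  or one of its descendants, which are closed under expansion.

  For an extended prism, let \<open>n\<^sub>i\<close> and \<open>n\<^sub>0\<close> be the numbers of matchings below the triangle \<open>T\<^sub>v\<close> that miss
  exactly the outer neighbour of \<open>x\<^sub>i\<close>, respectively the outer neighbours of all three \<open>x\<^sub>i\<close>. An extension
  of index \<open>s\<close> changes \<open>(n\<^sub>s, n\<^sub>j, n\<^sub>k, n\<^sub>0)\<close> to \<open>(n\<^sub>s + n\<^sub>0, n\<^sub>k, n\<^sub>j, n\<^sub>s)\<close>, and the same holds for the matchings
  through a fixed edge. So the number of lonely edges is computed from the pattern by a finite
  automaton, and it is \<open>3\<close> exactly for the stated patterns up to a permutation of the indices.\<close>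

text \<open>Kotzig's theorem applies because a perfect matching of \<open>G - a - b\<close> is a
  perfect matching of \<open>G\<close> through \<open>ab\<close> without that edge. By
  3-connectivity \<open>a\<close> and \<open>b\<close> each have exactly one neighbour on either
  side of the bridge, so a side with more than one vertex leaves by three disjoint edges, and
  contracting its complement turns the bridge into a lonely edge of a smaller graph. The triangle
  has to contain an edge of \<open>M\<close>: then \<open>M\<close> leaves it by a single edge and
  survives the contraction, and every perfect matching of the contraction lifts back.

  The descendants of the tricorn need no count of lonely edges, since membership in
  \<open>U_3\<close> is part of the definition of \<open>W_3\<close>.

  The automaton is finite because only two things matter: which \<open>n_i\<close> equal 1 (the set
  \<open>A\<close>), and which strands carry an edge lying in one matching only (the set
  \<open>B\<close>). The number of lonely edges is \<open>card A + card B\<close>. An extension of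
  index \<open>s\<close> lowers it by one if \<open>s\<close> is in \<open>B\<close> and keeps it
  otherwise. It starts at 6 for the prism, so the patterns that stay above 2 can be listed.\<close>

definition nbrs :: "'a graph \<Rightarrow> 'a \<Rightarrow> 'a set" where
  "nbrs G v = {w. {v, w} \<in> edges G}"

definition cubic3 :: "'a graph \<Rightarrow> bool" where
  "cubic3 G \<longleftrightarrow> cubic G \<and> three_connected G"

section \<open>Neighbourhoods, and 3-connectivity through closed vertex sets\<close>

lemma edge_verts:
  assumes "graph G" "{u, v} \<in> edges G"
  shows "u \<noteq> v" "u \<in> verts G" "v \<in> verts G"
proof -
  obtain x y where "{u, v} = {x, y}" "x \<noteq> y" "x \<in> verts G" "y \<in> verts G"
    using assms unfolding graph_def by blast
  then show "u \<noteq> v" "u \<in> verts G" "v \<in> verts G" by (auto simp: doubleton_eq_iff)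
qed

lemma graph_edgeE:
  assumes "graph G" "e \<in> edges G"
  obtains u v where "e = {u, v}" "u \<noteq> v" "u \<in> verts G" "v \<in> verts G"
  using assms unfolding graph_def by blast

lemma edge_subset: "graph G \<Longrightarrow> e \<in> edges G \<Longrightarrow> e \<subseteq> verts G"
  by (erule (1) graph_edgeE) auto

lemma finite_verts: "graph G \<Longrightarrow> finite (verts G)"
  by (simp add: graph_def)

lemma finite_edges: "graph G \<Longrightarrow> finite (edges G)"
  by (rule finite_subset[of _ "Pow (verts G)"]) (auto dest: edge_subset simp: finite_verts)

lemma edge_in_iff: "graph G \<Longrightarrow> e \<in> edges G \<Longrightarrow> v \<in> e \<Longrightarrow> \<exists>w. e = {v, w}"
  by (erule (1) graph_edgeE) auto

lemma nbrs_sub: "graph G \<Longrightarrow> nbrs G v \<subseteq> verts G - {v}"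
  using edge_verts[of G v] by (auto simp: nbrs_def)

lemma finite_nbrs: "graph G \<Longrightarrow> finite (nbrs G v)"
  using nbrs_sub[of G v] finite_verts[of G] finite_subset by blast

lemma nbrs_sym: "w \<in> nbrs G v \<longleftrightarrow> v \<in> nbrs G w"
  by (simp add: nbrs_def insert_commute)

lemma degree_nbrs:
  assumes "graph G"
  shows "degree G v = card (nbrs G v)"
proof -
  have "bij_betw (\<lambda>w. {v, w}) (nbrs G v) {e \<in> edges G. v \<in> e}"
    unfolding bij_betw_def
  proof
    show "inj_on (\<lambda>w. {v, w}) (nbrs G v)"
      by (auto simp: inj_on_def doubleton_eq_iff)
    show "(\<lambda>w. {v, w}) ` nbrs G v = {e \<in> edges G. v \<in> e}"
      using edge_in_iff[OF assms, of _ v] by (auto simp: nbrs_def image_iff)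
  qed
  then show ?thesis by (simp add: degree_def bij_betw_same_card)
qed

lemma cubic_iff: "cubic G \<longleftrightarrow> graph G \<and> (\<forall>v\<in>verts G. card (nbrs G v) = 3)"
  by (auto simp: cubic_def degree_nbrs)

text \<open>The vertices reachable from a given one form the smallest set closed under neighbours
  outside \<open>X\<close>. With this form every connectivity argument below exhibits a closed set
  \<open>P\<close> and never handles a path.\<close>

lemma connected_minus_iff:
  assumes "graph G"
  shows "connected_minus G X \<longleftrightarrow>
    (\<forall>P. P \<subseteq> verts G - X \<and> P \<noteq> {} \<and> (\<forall>u\<in>P. nbrs G u \<subseteq> X \<union> P) \<longrightarrow> P = verts G - X)"
proof
  assume c: "connected_minus G X"
  show "\<forall>P. P \<subseteq> verts G - X \<and> P \<noteq> {} \<and> (\<forall>u\<in>P. nbrs G u \<subseteq> X \<union> P) \<longrightarrow> P = verts G - X"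
  proof (intro allI impI)
    fix P assume P: "P \<subseteq> verts G - X \<and> P \<noteq> {} \<and> (\<forall>u\<in>P. nbrs G u \<subseteq> X \<union> P)"
    then obtain u where u: "u \<in> P" by auto
    have "v \<in> P" if v: "v \<in> verts G - X" for v
    proof -
      have "(u, v) \<in> (adj_avoiding G X)\<^sup>*"
        using c u v P unfolding connected_minus_def by blast
      then show ?thesis
      proof (induction rule: rtrancl_induct)
        case base show ?case by (rule u)
      next
        case (step y z)
        then show ?case using P unfolding adj_avoiding_def nbrs_def by blast
      qed
    qed
    then show "P = verts G - X" using P by blast
  qed
next
  assume c: "\<forall>P. P \<subseteq> verts G - X \<and> P \<noteq> {} \<and> (\<forall>u\<in>P. nbrs G u \<subseteq> X \<union> P) \<longrightarrow> P = verts G - X"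
  show "connected_minus G X" unfolding connected_minus_def
  proof (intro ballI)
    fix u v assume u: "u \<in> verts G - X" and v: "v \<in> verts G - X"
    let ?P = "{w \<in> verts G - X. (u, w) \<in> (adj_avoiding G X)\<^sup>*}"
    have "nbrs G w \<subseteq> X \<union> ?P" if "w \<in> ?P" for w
    proof
      fix z assume z: "z \<in> nbrs G w"
      then have zv: "z \<in> verts G" using nbrs_sub[OF assms] by blast
      show "z \<in> X \<union> ?P"
      proof (cases "z \<in> X")
        case False
        then have "(w, z) \<in> adj_avoiding G X"
          using that z by (auto simp: adj_avoiding_def nbrs_def)
        then show ?thesis using that zv False by (auto intro: rtrancl_into_rtrancl)
      qed auto
    qed
    then have "?P = verts G - X" using c[rule_format, of ?P] u by blast
    then show "(u, v) \<in> (adj_avoiding G X)\<^sup>*" using v by blast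
  qed
qed

lemma cubic3I:
  assumes "graph G" "\<And>v. v \<in> verts G \<Longrightarrow> card (nbrs G v) = 3" "card (verts G) \<ge> 4"
    "\<And>X P. X \<subseteq> verts G \<Longrightarrow> card X \<le> 2 \<Longrightarrow> P \<subseteq> verts G - X \<Longrightarrow> P \<noteq> {} \<Longrightarrow>
       (\<And>u. u \<in> P \<Longrightarrow> nbrs G u \<subseteq> X \<union> P) \<Longrightarrow> P = verts G - X"
  shows "cubic3 G"
  unfolding cubic3_def cubic_iff three_connected_def
  using assms by (auto simp: connected_minus_iff[OF assms(1)])

lemma cubic3D:
  assumes "cubic3 G"
  shows "graph G" "\<And>v. v \<in> verts G \<Longrightarrow> card (nbrs G v) = 3" "card (verts G) \<ge> 4"
  using assms by (auto simp: cubic3_def cubic_iff three_connected_def)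

text \<open>The form in which 3-connectivity is used: a closed set behind a cut of at most two
  vertices must be everything, which is then contradicted by a vertex known to lie
  elsewhere.\<close>

lemma cubic3_conn:
  assumes "cubic3 G" "X \<subseteq> verts G" "card X \<le> 2" "P \<subseteq> verts G - X" "P \<noteq> {}"
    "\<And>u. u \<in> P \<Longrightarrow> nbrs G u \<subseteq> X \<union> P"
  shows "P = verts G - X"
proof -
  have "connected_minus G X" using assms by (simp add: cubic3_def three_connected_def)
  then show ?thesis
    using assms(4-6) unfolding connected_minus_iff[OF cubic3D(1)[OF assms(1)]] by blast
qed

subsection \<open>Contraction of a vertex set\<close>

text \<open>The name \<open>c\<close> of the new vertex may be taken from \<open>S\<close> itself.
  This matters for an arbitrary vertex type, where fresh names need not exist.\<close>

definition contract :: "'a graph \<Rightarrow> 'a set \<Rightarrow> 'a \<Rightarrow> 'a graph" where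
  "contract G S c = \<lparr>verts = (verts G - S) \<union> {c},
     edges = {(\<lambda>v. if v \<in> S then c else v) ` e | e. e \<in> edges G \<and> \<not> e \<subseteq> S}\<rparr>"

lemma verts_contract [simp]: "verts (contract G S c) = (verts G - S) \<union> {c}"
  by (simp add: contract_def)

lemma edge_contract_iff:
  assumes "graph G"
  shows "{u, w} \<in> edges (contract G S c) \<longleftrightarrow>
    (\<exists>u' w'. {u', w'} \<in> edges G \<and> \<not> (u' \<in> S \<and> w' \<in> S) \<and>
       u = (if u' \<in> S then c else u') \<and> w = (if w' \<in> S then c else w'))"
  (is "_ \<longleftrightarrow> ?R")
proof
  assume "{u, w} \<in> edges (contract G S c)"
  then obtain e where e: "{u, w} = (\<lambda>v. if v \<in> S then c else v) ` e" "e \<in> edges G" "\<not> e \<subseteq> S"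
    unfolding contract_def by auto
  obtain x y where xy: "e = {x, y}" using e(2) assms by (auto elim: graph_edgeE)
  have "{u, w} = {if x \<in> S then c else x, if y \<in> S then c else y}"
    using e(1) unfolding xy by simp
  then consider "u = (if x \<in> S then c else x)" "w = (if y \<in> S then c else y)"
    | "u = (if y \<in> S then c else y)" "w = (if x \<in> S then c else x)"
    unfolding doubleton_eq_iff by blast
  then show ?R
  proof cases
    case 1 then show ?thesis using e xy by blast
  next
    case 2
    have "{y, x} \<in> edges G" using e xy by (simp add: insert_commute)
    then show ?thesis using 2 e xy by blast
  qed
next
  assume ?R
  then obtain u' w' where h: "{u', w'} \<in> edges G" "\<not> (u' \<in> S \<and> w' \<in> S)"
       "u = (if u' \<in> S then c else u')" "w = (if w' \<in> S then c else w')" by blast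
  then have "{u, w} = (\<lambda>v. if v \<in> S then c else v) ` {u', w'}" by (simp add: insert_commute)
  then show "{u, w} \<in> edges (contract G S c)" using h unfolding contract_def by auto
qed

lemma graph_contract:
  assumes "graph G" "c \<notin> verts G - S"
  shows "graph (contract G S c)"
  unfolding graph_def
proof (intro conjI ballI)
  show "finite (verts (contract G S c))" using assms by (simp add: finite_verts)
next
  fix e assume "e \<in> edges (contract G S c)"
  then obtain e' where e: "e = (\<lambda>v. if v \<in> S then c else v) ` e'" "e' \<in> edges G" "\<not> e' \<subseteq> S"
    unfolding contract_def by auto
  obtain x y where xy: "e' = {x, y}" "x \<noteq> y" "x \<in> verts G" "y \<in> verts G"
    using e(2) assms by (auto elim: graph_edgeE)
  show "\<exists>u v. e = {u, v} \<and> u \<noteq> v \<and> u \<in> verts (contract G S c) \<and> v \<in> verts (contract G S c)"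
    by (rule exI[of _ "if x \<in> S then c else x"], rule exI[of _ "if y \<in> S then c else y"])
      (use e xy assms in auto)
qed

lemma nbrs_contract_outside:
  assumes "graph G" "c \<notin> verts G - S" "u \<in> verts G - S"
  shows "nbrs (contract G S c) u = (nbrs G u - S) \<union> (if nbrs G u \<inter> S = {} then {} else {c})"
proof -
  have uc: "u \<noteq> c" "u \<notin> S" using assms by auto
  have "w \<in> nbrs (contract G S c) u \<longleftrightarrow>
     w \<in> (nbrs G u - S) \<union> (if nbrs G u \<inter> S = {} then {} else {c})" for w
    unfolding nbrs_def mem_Collect_eq edge_contract_iff[OF assms(1)] using uc by auto
  then show ?thesis by blast
qed

lemma nbrs_contract_new:
  assumes "graph G" "c \<notin> verts G - S"
  shows "nbrs (contract G S c) c = {w \<in> verts G - S. nbrs G w \<inter> S \<noteq> {}}"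
proof -
  have "w \<in> nbrs (contract G S c) c \<longleftrightarrow> w \<in> {w \<in> verts G - S. nbrs G w \<inter> S \<noteq> {}}" for w
    unfolding nbrs_def mem_Collect_eq edge_contract_iff[OF assms(1)]
    using assms edge_verts[OF assms(1)] by (auto simp: insert_commute)
  then show ?thesis by blast
qed

text \<open>A separating pair containing the contracted vertex is turned into one of \<open>G\<close> by
  replacing that vertex with the end in \<open>S\<close> of a single exit edge, since one of the two sides
  meets at most one of the three exit edges.\<close>

lemma cubic3_contract:
  assumes G: "cubic3 G" and S: "S \<subseteq> verts G" and c: "c \<notin> verts G - S"
    and dist: "distinct [o1, o2, o3]" and o: "{o1, o2, o3} \<subseteq> verts G - S"
    and exits: "\<And>u w. u \<in> verts G - S \<Longrightarrow> w \<in> S \<Longrightarrow>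
      {u, w} \<in> edges G \<longleftrightarrow> (u, w) \<in> {(o1, c1), (o2, c2), (o3, c3)}"
    and cS: "{c1, c2, c3} \<subseteq> S"
  shows "cubic3 (contract G S c)" (is "cubic3 ?C")
proof -
  note g = cubic3D(1)[OF G]
  have gC: "graph ?C" by (rule graph_contract[OF g c])
  have nS: "nbrs G u \<inter> S = {w. (u, w) \<in> {(o1, c1), (o2, c2), (o3, c3)}}" if "u \<in> verts G - S" for u
    using exits[OF that] cS by (auto simp: nbrs_def)
  have nC: "nbrs ?C c = {o1, o2, o3}"
    unfolding nbrs_contract_new[OF g c] using nS o by auto
  show ?thesis
  proof (rule cubic3I[OF gC])
    fix v assume v: "v \<in> verts ?C"
    show "card (nbrs ?C v) = 3"
    proof (cases "v = c")
      case True then show ?thesis using nC dist by simp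
    next
      case False
      then have v': "v \<in> verts G - S" using v by auto
      have c3: "card (nbrs G v) = 3" using cubic3D(2)[OF G] v' by blast
      have cn: "c \<notin> nbrs G v - S" using c nbrs_sub[OF g, of v] by auto
      have eq: "card (nbrs G v) = card (nbrs G v - S) + card (nbrs G v \<inter> S)"
        using card_Un_disjoint[of "nbrs G v - S" "nbrs G v \<inter> S"] finite_nbrs[OF g, of v]
        by (simp add: Un_Diff_Int Diff_Int_distrib2)
      show ?thesis
      proof (cases "v \<in> {o1, o2, o3}")
        case True
        then have "\<exists>x. nbrs G v \<inter> S = {x}" using nS[OF v'] dist by auto
        then obtain x where x: "nbrs G v \<inter> S = {x}" by blast
        then show ?thesis using eq c3 cn finite_nbrs[OF g, of v]
          by (simp add: nbrs_contract_outside[OF g c v'])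
      next
        case False
        then have "nbrs G v \<inter> S = {}" using nS[OF v'] by auto
        then show ?thesis using eq c3 by (simp add: nbrs_contract_outside[OF g c v'])
      qed
    qed
  next
    have "distinct [o1, o2, o3, c]" using dist o c by auto
    then have "card (set [o1, o2, o3, c]) = 4" by (simp only: distinct_card) simp
    then have "card {o1, o2, o3, c} = 4" by simp
    moreover have "{o1, o2, o3, c} \<subseteq> verts ?C" using o by auto
    ultimately show "4 \<le> card (verts ?C)"
      using card_mono[OF finite_verts[OF gC]] by metis
  next
    fix X P assume X: "X \<subseteq> verts ?C" "card X \<le> 2" and P: "P \<subseteq> verts ?C - X" "P \<noteq> {}"
      and cl: "\<And>u. u \<in> P \<Longrightarrow> nbrs ?C u \<subseteq> X \<union> P"
    have finX: "finite X" using X finite_subset finite_verts[OF gC] by blast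
    show "P = verts ?C - X"
    proof (cases "c \<in> X")
      case False
      \<comment> \<open>If \<open>c\<close> survives the deletion of \<open>X\<close>, the preimage
        of \<open>P\<close> under the contraction map is closed in \<open>G\<close>.\<close>
      define Q where "Q = (P - {c}) \<union> (if c \<in> P then S else {})"
      have Sne: "S \<noteq> {}" using cS by auto
      have "Q = verts G - X"
      proof (rule cubic3_conn[OF G])
        show "X \<subseteq> verts G" using X False by auto
        show "card X \<le> 2" by fact
        show "Q \<subseteq> verts G - X" unfolding Q_def using P X S False c by (auto split: if_splits)
        show "Q \<noteq> {}" unfolding Q_def using P(2) Sne by auto
      next
        fix u assume u: "u \<in> Q"
        show "nbrs G u \<subseteq> X \<union> Q"
        proof
          fix w assume w: "w \<in> nbrs G u"
          then have e: "{u, w} \<in> edges G" by (simp add: nbrs_def)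
          note uw = edge_verts[OF g e]
          define pu where "pu = (if u \<in> S then c else u)"
          define pw where "pw = (if w \<in> S then c else w)"
          have pu: "pu \<in> P" using u unfolding Q_def pu_def using P by (auto split: if_splits)
          show "w \<in> X \<union> Q"
          proof (cases "u \<in> S \<and> w \<in> S")
            case True
            then show ?thesis using pu by (auto simp: Q_def pu_def)
          next
            case F: False
            then have "{pu, pw} \<in> edges ?C"
              unfolding edge_contract_iff[OF g] using e pu_def pw_def by blast
            then have "pw \<in> X \<union> P" using cl[OF pu] by (auto simp: nbrs_def)
            then show ?thesis using False uw c by (auto simp: Q_def pw_def split: if_splits)
          qed
        qed
      qed
      then show ?thesis using P Sne S X False c unfolding Q_def
        by (auto split: if_splits)
    next
      case True
      define Z where "Z = X - {c}"
      have Z: "Z \<subseteq> verts G - S" using X by (auto simp: Z_def)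
      have cZ: "card Z \<le> 1" using X(2) True finX by (simp add: Z_def)
      \<comment> \<open>\<open>R\<close> is a side of the separation that touches at most the exit
        \<open>oo\<close>. The end \<open>co\<close> of that exit edge replaces \<open>c\<close> in
        the cut, and \<open>x\<close> on the other side contradicts 3-connectivity of
        \<open>G\<close>.\<close>
      have key: False if R: "R \<subseteq> verts G - S - Z" "R \<noteq> {}" "\<And>u. u \<in> R \<Longrightarrow> nbrs G u - S \<subseteq> Z \<union> R"
          and co: "(oo, co) \<in> {(o1, c1), (o2, c2), (o3, c3)}" "R \<inter> {o1, o2, o3} \<subseteq> {oo}"
          and other: "x \<in> verts G - S - Z - R" for R oo co x
      proof -
        have "R = verts G - insert co Z"
        proof (rule cubic3_conn[OF G])
          have coS: "co \<in> S" using co cS by auto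
          show "insert co Z \<subseteq> verts G" using Z coS S by blast
          show "card (insert co Z) \<le> 2"
            using cZ card_insert_le_m1[of 2 Z co] by simp
          show "R \<subseteq> verts G - insert co Z" using R(1) coS by blast
          show "R \<noteq> {}" by fact
          fix u assume u: "u \<in> R"
          have "w \<in> insert co Z \<union> R" if w: "w \<in> nbrs G u" for w
          proof (cases "w \<in> S")
            case True
            then have "(u, w) \<in> {(o1, c1), (o2, c2), (o3, c3)}" using nS[of u] u R(1) w by blast
            then show ?thesis using co u dist by auto
          next
            case False then show ?thesis using R(3)[OF u] w by blast
          qed
          then show "nbrs G u \<subseteq> insert co Z \<union> R" by blast
        qed
        moreover have "co \<in> S" using co cS by auto
        ultimately show False using other by blast
      qed
      show ?thesis
      proof (rule ccontr)
        assume ne: "P \<noteq> verts ?C - X"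
        define Q where "Q = verts ?C - X - P"
        have Pv: "P \<subseteq> verts G - S - Z" using P True by (auto simp: Z_def)
        have Qv: "Q \<subseteq> verts G - S - Z" using True by (auto simp: Q_def Z_def)
        have XZ: "X = insert c Z" using True by (auto simp: Z_def)
        have clP: "nbrs G u - S \<subseteq> Z \<union> P" if "u \<in> P" for u
          using cl[OF that] Pv that c nbrs_sub[OF g, of u]
          unfolding XZ by (subst (asm) nbrs_contract_outside[OF g c]) (auto split: if_splits)
        have clQ: "nbrs G u - S \<subseteq> Z \<union> Q" if u: "u \<in> Q" for u
        proof
          fix w assume w: "w \<in> nbrs G u - S"
          then have wv: "w \<in> verts G - S" using nbrs_sub[OF g, of u] by auto
          have "u \<in> nbrs G w" using w nbrs_sym[of w G u] by blast
          then have "w \<notin> P" using clP[of w] u Qv by (auto simp: Q_def)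
          then show "w \<in> Z \<union> Q" using wv c by (auto simp: Q_def XZ)
        qed
        have PQ: "P \<inter> Q = {}" by (auto simp: Q_def)
        have Pne: "P \<noteq> {}" "Q \<noteq> {}" using P ne by (auto simp: Q_def)
        \<comment> \<open>Pigeonhole: three exits are spread over two disjoint sides, so one side
          holds at most one of them.\<close>
        have "\<exists>oo co. (oo, co) \<in> {(o1, c1), (o2, c2), (o3, c3)} \<and>
            (P \<inter> {o1, o2, o3} \<subseteq> {oo} \<or> Q \<inter> {o1, o2, o3} \<subseteq> {oo})"
          using PQ dist by auto
        then obtain oo co where oc: "(oo, co) \<in> {(o1, c1), (o2, c2), (o3, c3)}"
            "P \<inter> {o1, o2, o3} \<subseteq> {oo} \<or> Q \<inter> {o1, o2, o3} \<subseteq> {oo}" by blast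
        obtain p q where "p \<in> P" "q \<in> Q" using Pne by blast
        then have "q \<in> verts G - S - Z - P" "p \<in> verts G - S - Z - Q" using Pv Qv PQ by auto
        then show False using key[OF Pv Pne(1) clP oc(1)] key[OF Qv Pne(2) clQ oc(1)] oc(2) by blast
      qed
    qed
  qed
qed

subsection \<open>Triangles\<close>

text \<open>Distinct outer neighbours belong to the notion: if two coincided, contracting the
  triangle would merge parallel edges and destroy cubicity. The argument order pairs each
  \<open>y\<close> with its own \<open>o\<close>.\<close>

definition tri :: "'a graph \<Rightarrow> 'a \<Rightarrow> 'a \<Rightarrow> 'a \<Rightarrow> 'a \<Rightarrow> 'a \<Rightarrow> 'a \<Rightarrow> bool" where
  "tri G y1 y2 y3 o1 o2 o3 \<longleftrightarrow> graph G \<and> distinct [y1, y2, y3, o1, o2, o3] \<and>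
     nbrs G y1 = {y2, y3, o1} \<and> nbrs G y2 = {y1, y3, o2} \<and> nbrs G y3 = {y1, y2, o3}"

lemma tri_perm:
  assumes "tri G y1 y2 y3 o1 o2 o3"
  shows "tri G y2 y1 y3 o2 o1 o3" "tri G y2 y3 y1 o2 o3 o1" "tri G y1 y3 y2 o1 o3 o2"
    "tri G y3 y1 y2 o3 o1 o2" "tri G y3 y2 y1 o3 o2 o1"
  using assms unfolding tri_def by (simp_all add: insert_commute) blast+

lemma triD:
  assumes "tri G y1 y2 y3 o1 o2 o3"
  shows "graph G" "distinct [y1, y2, y3, o1, o2, o3]"
    "nbrs G y1 = {y2, y3, o1}" "nbrs G y2 = {y1, y3, o2}" "nbrs G y3 = {y1, y2, o3}"
    "{y1, y2, y3} \<subseteq> verts G" "{o1, o2, o3} \<subseteq> verts G - {y1, y2, y3}"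
    "{y1, y2} \<in> edges G" "{y2, y3} \<in> edges G" "{y1, y3} \<in> edges G"
    "{y1, o1} \<in> edges G" "{y2, o2} \<in> edges G" "{y3, o3} \<in> edges G"
proof -
  show g: "graph G" and d: "distinct [y1, y2, y3, o1, o2, o3]"
    and n: "nbrs G y1 = {y2, y3, o1}" "nbrs G y2 = {y1, y3, o2}" "nbrs G y3 = {y1, y2, o3}"
    using assms by (auto simp: tri_def)
  show e: "{y1, y2} \<in> edges G" "{y2, y3} \<in> edges G" "{y1, y3} \<in> edges G"
    "{y1, o1} \<in> edges G" "{y2, o2} \<in> edges G" "{y3, o3} \<in> edges G"
    using n unfolding nbrs_def by blast+
  have "y1 \<in> verts G" "y2 \<in> verts G" "y3 \<in> verts G" "o1 \<in> verts G" "o2 \<in> verts G" "o3 \<in> verts G"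
    using edge_verts(2,3)[OF g e(4)] edge_verts(2,3)[OF g e(5)] edge_verts(2,3)[OF g e(6)]
    by simp_all
  then show "{y1, y2, y3} \<subseteq> verts G" "{o1, o2, o3} \<subseteq> verts G - {y1, y2, y3}"
    using d by (simp_all add: eq_commute)
qed

lemma tri_neq:
  assumes "tri G y1 y2 y3 o1 o2 o3"
  shows "y1 \<noteq> y2" "y1 \<noteq> y3" "y1 \<noteq> o1" "y1 \<noteq> o2" "y1 \<noteq> o3" "y2 \<noteq> y1" "y2 \<noteq> y3" "y2 \<noteq> o1" "y2 \<noteq> o2" "y2 \<noteq> o3" "y3 \<noteq> y1" "y3 \<noteq> y2" "y3 \<noteq> o1" "y3 \<noteq> o2" "y3 \<noteq> o3" "o1 \<noteq> y1" "o1 \<noteq> y2" "o1 \<noteq> y3" "o1 \<noteq> o2" "o1 \<noteq> o3" "o2 \<noteq> y1" "o2 \<noteq> y2" "o2 \<noteq> y3" "o2 \<noteq> o1" "o2 \<noteq> o3" "o3 \<noteq> y1" "o3 \<noteq> y2" "o3 \<noteq> y3" "o3 \<noteq> o1" "o3 \<noteq> o2"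
  using assms by (simp_all add: tri_def eq_commute)

lemma tri_nbrs_outside:
  assumes t: "tri G y1 y2 y3 o1 o2 o3" and u: "u \<in> verts G - {y1, y2, y3}"
  shows "nbrs G u \<inter> {y1, y2, y3} =
    (if u = o1 then {y1} else if u = o2 then {y2} else if u = o3 then {y3} else {})"
proof -
  have "y \<in> nbrs G u \<inter> {y1, y2, y3} \<longleftrightarrow> (y = y1 \<and> u = o1) \<or> (y = y2 \<and> u = o2) \<or> (y = y3 \<and> u = o3)"
    for y
  proof -
    have "y \<in> nbrs G u \<longleftrightarrow> u \<in> nbrs G y" by (rule nbrs_sym)
    then show ?thesis using u triD(3-5)[OF t] by (cases "y \<in> {y1, y2, y3}") auto
  qed
  then have "nbrs G u \<inter> {y1, y2, y3} = {y. (y = y1 \<and> u = o1) \<or> (y = y2 \<and> u = o2) \<or> (y = y3 \<and> u = o3)}"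
    by (intro set_eqI) simp
  then show ?thesis using triD(2)[OF t] by (cases "u = o1"; cases "u = o2"; cases "u = o3"; simp)
qed

lemma nbrs_contract_tri_new:
  assumes t: "tri G y1 y2 y3 o1 o2 o3" and c: "c \<notin> verts G - {y1, y2, y3}"
  shows "nbrs (contract G {y1, y2, y3} c) c = {o1, o2, o3}"
proof -
  have "nbrs G w \<inter> {y1, y2, y3} \<noteq> {} \<longleftrightarrow> w \<in> {o1, o2, o3}" if "w \<in> verts G - {y1, y2, y3}" for w
    by (subst tri_nbrs_outside[OF t that]) simp
  then show ?thesis
    unfolding nbrs_contract_new[OF triD(1)[OF t] c] using triD(7)[OF t] by blast
qed

lemma nbrs_contract_tri:
  assumes t: "tri G y1 y2 y3 o1 o2 o3" and c: "c \<notin> verts G - {y1, y2, y3}"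
    and u: "u \<in> verts G - {y1, y2, y3}"
  shows "nbrs (contract G {y1, y2, y3} c) u =
    (nbrs G u - {y1, y2, y3}) \<union> (if u \<in> {o1, o2, o3} then {c} else {})"
  unfolding nbrs_contract_outside[OF triD(1)[OF t] c u] tri_nbrs_outside[OF t u] by simp

lemma edge_contract_outside:
  assumes "graph G" "c \<notin> verts G - S" "u \<notin> S" "w \<notin> S" "u \<noteq> c" "w \<noteq> c"
  shows "{u, w} \<in> edges (contract G S c) \<longleftrightarrow> {u, w} \<in> edges G"
  unfolding edge_contract_iff[OF assms(1)] using assms by auto

lemma cubic3_contract_tri:
  assumes G: "cubic3 G" and t: "tri G y1 y2 y3 o1 o2 o3" and c: "c \<notin> verts G - {y1, y2, y3}"
  shows "cubic3 (contract G {y1, y2, y3} c)"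
proof (rule cubic3_contract[OF G triD(6)[OF t] c, of o1 o2 o3 y1 y2 y3])
  show "distinct [o1, o2, o3]" using triD(2)[OF t] by simp
  show "{o1, o2, o3} \<subseteq> verts G - {y1, y2, y3}" by (rule triD(7)[OF t])
  show "{y1, y2, y3} \<subseteq> {y1, y2, y3}" by (rule subset_refl)
  fix u w assume u: "u \<in> verts G - {y1, y2, y3}" and w: "w \<in> {y1, y2, y3}"
  have *: "{u, v} \<in> edges G \<longleftrightarrow> u \<in> nbrs G v" for v
    using nbrs_sym[of u G v] by (simp add: nbrs_def)
  consider "w = y1" | "w = y2" | "w = y3" using w by blast
  then show "({u, w} \<in> edges G) = ((u, w) \<in> {(o1, y1), (o2, y2), (o3, y3)})"
  proof cases
    case 1 show ?thesis unfolding 1 *[of y1] triD(3)[OF t] using u by (simp add: tri_neq[OF t])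
  next
    case 2 show ?thesis unfolding 2 *[of y2] triD(4)[OF t] using u by (simp add: tri_neq[OF t])
  next
    case 3 show ?thesis unfolding 3 *[of y3] triD(5)[OF t] using u by (simp add: tri_neq[OF t])
  qed
qed

text \<open>A cut of \<open>G\<close> that avoids the triangle is also a cut of the contraction. A
  cut that meets the triangle is traded for one through \<open>c\<close>; what remains is to attach
  the undeleted triangle vertices to the right side.\<close>

lemma cubic3_expand:
  assumes t: "tri G y1 y2 y3 o1 o2 o3" and c: "c \<notin> verts G - {y1, y2, y3}"
    and C: "cubic3 (contract G {y1, y2, y3} c)" (is "cubic3 ?C")
  shows "cubic3 G"
proof -
  let ?Y = "{y1, y2, y3}"
  note g = triD(1)[OF t] and d = triD(2)[OF t] and n = triD(3-5)[OF t] and YV = triD(6)[OF t]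
    and oV = triD(7)[OF t]
  note nC = nbrs_contract_tri[OF t c]
  show ?thesis
  proof (rule cubic3I[OF g])
    fix v assume v: "v \<in> verts G"
    show "card (nbrs G v) = 3"
    proof (cases "v \<in> ?Y")
      case True then show ?thesis using d by (auto simp: n)
    next
      case False
      then have v': "v \<in> verts G - ?Y" using v by auto
      have "card (nbrs ?C v) = 3" using cubic3D(2)[OF C] v' by simp
      moreover have "c \<notin> nbrs G v - ?Y" using c nbrs_sub[OF g, of v] by auto
      moreover have "card (nbrs G v) = card (nbrs G v - ?Y) + card (nbrs G v \<inter> ?Y)"
        using card_Un_disjoint[of "nbrs G v - ?Y" "nbrs G v \<inter> ?Y"] finite_nbrs[OF g, of v]
        by (simp add: Un_Diff_Int Diff_Int_distrib2)
      ultimately show ?thesis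
        using finite_nbrs[OF g, of v] unfolding nC[OF v'] tri_nbrs_outside[OF t v']
        by (auto split: if_splits)
    qed
  next
    have "card (verts ?C) \<le> card (verts G)"
    proof -
      have "verts ?C = insert c (verts G - ?Y)" by auto
      then have "card (verts ?C) \<le> Suc (card (verts G - ?Y))"
        by (simp add: card_insert_if finite_verts[OF g])
      also have "card (verts G - ?Y) = card (verts G) - 3"
        using YV d by (subst card_Diff_subset) auto
      also have "card (verts G) \<ge> 3" using card_mono[OF finite_verts[OF g] YV] d by simp
      ultimately show ?thesis by linarith
    qed
    then show "4 \<le> card (verts G)" using cubic3D(3)[OF C] by linarith
  next
    fix X P assume X: "X \<subseteq> verts G" "card X \<le> 2" and P: "P \<subseteq> verts G - X" "P \<noteq> {}"
      and cl: "\<And>u. u \<in> P \<Longrightarrow> nbrs G u \<subseteq> X \<union> P"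
    have finX: "finite X" using X finite_subset finite_verts[OF g] by blast
    show "P = verts G - X"
    proof (cases "X \<inter> ?Y = {}")
      case True
      \<comment> \<open>The triangle is connected and avoids \<open>X\<close>, so \<open>P\<close>
        contains it entirely or misses it.\<close>
      have PY: "?Y \<subseteq> P" if "P \<inter> ?Y \<noteq> {}"
        using that cl[of y1] cl[of y2] cl[of y3] True unfolding n by blast
      define Q where "Q = (P - ?Y) \<union> (if P \<inter> ?Y = {} then {} else {c})"
      have "Q = verts ?C - X"
      proof (rule cubic3_conn[OF C])
        have cX: "c \<notin> X" using X True c by auto
        show "X \<subseteq> verts ?C" using X True by auto
        show "card X \<le> 2" by fact
        show "Q \<subseteq> verts ?C - X" using P cX by (auto simp: Q_def)
        show "Q \<noteq> {}" using P by (auto simp: Q_def)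
        fix u assume u: "u \<in> Q"
        show "nbrs ?C u \<subseteq> X \<union> Q"
        proof (cases "u = c")
          case uc: True
          then have "P \<inter> ?Y \<noteq> {}" using u c P by (auto simp: Q_def split: if_splits)
          then have "?Y \<subseteq> P" by (rule PY)
          then have "{o1, o2, o3} \<subseteq> X \<union> P" using cl[of y1] cl[of y2] cl[of y3] unfolding n by blast
          then show ?thesis using oV unfolding uc nbrs_contract_tri_new[OF t c] by (auto simp: Q_def)
        next
          case False
          then have uP: "u \<in> P - ?Y" using u by (auto simp: Q_def split: if_splits)
          then have uV: "u \<in> verts G - ?Y" using P by auto
          have "c \<in> Q" if "u \<in> {o1, o2, o3}"
            using that cl[of u] uP True tri_nbrs_outside[OF t uV] by (auto simp: Q_def split: if_splits)
          then show ?thesis using cl[of u] uP unfolding nC[OF uV] by (auto simp: Q_def)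
        qed
      qed
      then have QV: "Q = verts ?C - X" .
      have cX: "c \<notin> X" using X True c by auto
      have "c \<in> Q" using cX by (simp add: QV)
      then have ne: "P \<inter> ?Y \<noteq> {}" using c P(1) by (auto simp: Q_def split: if_splits)
      have "v \<in> P" if v: "v \<in> verts G - X" for v
      proof (cases "v \<in> ?Y")
        case True then show ?thesis using PY[OF ne] by blast
      next
        case False
        then have "v \<in> Q" unfolding QV using v by simp
        moreover have "v \<noteq> c" using v c False by blast
        ultimately
        show ?thesis unfolding Q_def by (simp split: if_splits)
      qed
      then show ?thesis using P(1) by blast
    next
      case False
      \<comment> \<open>At least one vertex of \<open>X\<close> lies in the triangle, so adding
        \<open>c\<close> does not make the cut larger than \<open>X\<close>.\<close>
      define X' where "X' = insert c (X - ?Y)"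
      have cX': "card X' \<le> 2"
      proof -
        have "X - ?Y \<subset> X" using False by auto
        then have "card (X - ?Y) < card X" using finX by (simp add: psubset_card_mono)
        then show ?thesis using X(2) finX by (simp add: X'_def card_insert_if)
      qed
      define R where "R = {(y1, o1), (y2, o2), (y3, o3)}"
      have Rn: "nbrs G y = insert oy (?Y - {y})" "oy \<in> verts G - ?Y" "y \<in> ?Y"
        if "(y, oy) \<in> R" for y oy
      proof -
        have "y = y1 \<and> oy = o1 \<or> y = y2 \<and> oy = o2 \<or> y = y3 \<and> oy = o3"
          using that unfolding R_def by simp
        then show "nbrs G y = insert oy (?Y - {y})" "oy \<in> verts G - ?Y" "y \<in> ?Y"
          by (elim disjE; use oV in \<open>simp add: n insert_Diff_if tri_neq[OF t] insert_commute\<close>)+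
      qed
      have Rinj: "oy \<noteq> oz" if "(y, oy) \<in> R" "(z, oz) \<in> R" "y \<noteq> z" for y oy z oz
        using that d unfolding R_def by auto
      have Rex: "\<exists>oy. (y, oy) \<in> R" if "y \<in> ?Y" for y using that unfolding R_def by auto
      have Rthird: "\<exists>w ow. (w, ow) \<in> R \<and> w \<noteq> y \<and> w \<noteq> z" for y z
        using d unfolding R_def by auto
      have XY: "card (X \<inter> ?Y) \<ge> 1" using False finX by (simp add: Suc_le_eq card_gt_0_iff)
      have sumX: "card (X - ?Y) + card (X \<inter> ?Y) = card X"
        using card_Un_disjoint[of "X - ?Y" "X \<inter> ?Y"] finX
        by (simp add: Un_Diff_Int Diff_Int_distrib2)
      have one: "z = z'" if "z \<in> X - ?Y" "z' \<in> X - ?Y" for z z'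
      proof -
        have "card (X - ?Y) \<le> Suc 0" using sumX XY X(2) by linarith
        then show ?thesis using that finX card_le_Suc0_iff_eq[of "X - ?Y"] by blast
      qed
      have single: "\<exists>z. X \<inter> ?Y = {z}" if "w \<in> X - ?Y" for w
      proof -
        have "card (X - ?Y) \<ge> 1" using that finX by (auto simp: Suc_le_eq card_gt_0_iff)
        then have "card (X \<inter> ?Y) = 1" using sumX XY X(2) by linarith
        then show ?thesis by (auto simp: card_1_singleton_iff)
      qed
      \<comment> \<open>If \<open>P\<close> lay inside the triangle, the outer neighbours of its
        vertices would lie in \<open>X\<close>. Then \<open>X\<close> has one vertex outside the
        triangle and one inside, so two triangle vertices belong to \<open>P\<close> and share their
        outer neighbour, which is impossible.\<close>
      have Pne: "P - ?Y \<noteq> {}"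
      proof
        assume "P - ?Y = {}"
        then have PY: "P \<subseteq> ?Y" by auto
        have oX: "oy \<in> X - ?Y" if "(y, oy) \<in> R" "y \<in> P" for y oy
          using cl[OF that(2)] Rn[OF that(1)] PY by blast
        obtain y oy where y: "(y, oy) \<in> R" "y \<in> P" using P(2) PY Rex by blast
        obtain z where z: "X \<inter> ?Y = {z}" using single[OF oX[OF y]] by blast
        obtain w ow where w: "(w, ow) \<in> R" "w \<noteq> y" "w \<noteq> z" using Rthird by blast
        have "w \<in> P" using cl[OF y(2)] Rn[OF y(1)] Rn(3)[OF w(1)] w z by blast
        then have "ow = oy" using one[OF oX[OF w(1)] oX[OF y]] by simp
        then show False using Rinj[OF w(1) y(1) w(2)] by simp
      qed
      have "P - ?Y = verts ?C - X'"
      proof (rule cubic3_conn[OF C _ cX' _ Pne])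
        show "X' \<subseteq> verts ?C" using X by (auto simp: X'_def)
        show "P - ?Y \<subseteq> verts ?C - X'" using P c by (auto simp: X'_def)
        fix u assume u: "u \<in> P - ?Y"
        then have uV: "u \<in> verts G - ?Y" using P by auto
        show "nbrs ?C u \<subseteq> X' \<union> (P - ?Y)"
          using cl[of u] u unfolding nC[OF uV] by (auto simp: X'_def)
      qed
      then have out: "verts G - ?Y - X \<subseteq> P" using c by (auto simp: X'_def)
      have nb: "y \<in> P" if "w \<in> P" "y \<in> nbrs G w" "y \<notin> X" for w y using cl that by blast
      have step: "y \<in> P" if "z \<in> nbrs G y" "z \<in> verts G - ?Y - X" "y \<notin> X" for y z
        using nb[of z y] that out nbrs_sym[of z G y] by blast
      \<comment> \<open>A free triangle vertex reaches \<open>P\<close> through its own outer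
        neighbour or, if that one is deleted, through the other free triangle vertex.\<close>
      have "?Y - X \<subseteq> P"
      proof
        fix y assume y: "y \<in> ?Y - X"
        obtain oy where oy: "(y, oy) \<in> R" using y Rex by blast
        show "y \<in> P"
        proof (cases "oy \<in> X")
          case False
          then show ?thesis using step[of oy y] Rn[OF oy] y by blast
        next
          case True
          then have oX: "oy \<in> X - ?Y" using Rn[OF oy] by blast
          obtain z where z: "X \<inter> ?Y = {z}" using single[OF oX] by blast
          obtain w ow where w: "(w, ow) \<in> R" "w \<noteq> y" "w \<noteq> z" using Rthird by blast
          have wX: "w \<notin> X" using z w Rn(3)[OF w(1)] by blast
          have "ow \<notin> X" using one[OF oX, of ow] Rinj[OF w(1) oy w(2)] Rn[OF w(1)] by blast
          then have "w \<in> P" using step[of ow w] Rn[OF w(1)] wX by blast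
          then show ?thesis using nb[of w y] Rn[OF w(1)] w y by blast
        qed
      qed
      then show ?thesis using out P(1) by blast
    qed
  qed
qed

text \<open>If two triangle vertices had the same outer neighbour \<open>z\<close>, then
  \<open>z\<close> and the third triangle vertex would cut them off. Only \<open>K4\<close> escapes,
  hence the bound 5.\<close>

lemma tri_of_cubic3:
  assumes G: "cubic3 G" and e: "{y1, y2} \<in> edges G" "{y2, y3} \<in> edges G" "{y1, y3} \<in> edges G"
    and card: "card (verts G) \<ge> 5"
  obtains o1 o2 o3 where "tri G y1 y2 y3 o1 o2 o3"
proof -
  note g = cubic3D(1)[OF G]
  have third: "\<exists>z. nbrs G a = {b, b', z} \<and> z \<noteq> b \<and> z \<noteq> b' \<and> z \<noteq> a"
    if "{a, b} \<in> edges G" "{a, b'} \<in> edges G" "b \<noteq> b'" for a b b'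
  proof -
    have "card (nbrs G a) = 3" using cubic3D(2)[OF G] edge_verts[OF g that(1)] by blast
    then have "card (nbrs G a - {b, b'}) = 1"
      using that by (subst card_Diff_subset) (auto simp: nbrs_def)
    then obtain z where z: "nbrs G a - {b, b'} = {z}" by (auto simp: card_1_singleton_iff)
    moreover have "b \<in> nbrs G a" "b' \<in> nbrs G a" using that by (auto simp: nbrs_def)
    ultimately have "nbrs G a = {b, b', z}" by blast
    moreover have "z \<noteq> a" using z nbrs_sub[OF g, of a] by auto
    ultimately show ?thesis using z by blast
  qed
  have dy: "y1 \<noteq> y2" "y2 \<noteq> y3" "y1 \<noteq> y3" using e edge_verts[OF g] by blast+
  obtain o1 where o1: "nbrs G y1 = {y2, y3, o1}" "o1 \<noteq> y1" "o1 \<noteq> y2" "o1 \<noteq> y3"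
    using third[of y1 y2 y3] e dy by auto
  obtain o2 where o2: "nbrs G y2 = {y1, y3, o2}" "o2 \<noteq> y1" "o2 \<noteq> y2" "o2 \<noteq> y3"
    using third[of y2 y1 y3] e dy by (auto simp: insert_commute)
  obtain o3 where o3: "nbrs G y3 = {y1, y2, o3}" "o3 \<noteq> y1" "o3 \<noteq> y2" "o3 \<noteq> y3"
    using third[of y3 y1 y2] e dy by (auto simp: insert_commute)
  have dif: "z \<noteq> z'" if "nbrs G a = {b, b', z}" "nbrs G b = {a, b', z'}" "b' \<noteq> a" "b' \<noteq> b"
    "z \<noteq> a" "z \<noteq> b" for a b b' z z'
  proof
    assume zz: "z = z'"
    have v: "a \<in> verts G" "b \<in> verts G" "b' \<in> verts G" "z \<in> verts G" "b \<noteq> a"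
      using that nbrs_sub[OF g, of a] nbrs_sub[OF g, of b] by auto
    have "{a, b} = verts G - {b', z}"
    proof (rule cubic3_conn[OF G])
      show "card {b', z} \<le> 2" by (simp add: card_insert_if)
    qed (use v that zz in auto)
    then have "verts G = {a, b, b', z}" using v by blast
    then show False using card by (auto simp: card_insert_if split: if_splits)
  qed
  have "o1 \<noteq> o2" using dif[of y1 y2 y3 o1 o2] o1 o2 dy by blast
  moreover have "o2 \<noteq> o3" using dif[of y2 y3 y1 o2 o3] o2 o3 dy by (auto simp: insert_commute)
  moreover have "o1 \<noteq> o3" using dif[of y1 y3 y2 o1 o3] o1 o3 dy by (auto simp: insert_commute)
  ultimately have "tri G y1 y2 y3 o1 o2 o3"
    unfolding tri_def using g o1 o2 o3 dy by auto
  then show ?thesis by (rule that)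
qed

subsection \<open>Isomorphisms\<close>

text \<open>A pointwise variant of \<open>iso\<close> with the map exposed: maps are composed,
  updated at the contracted vertex, and evaluated at chosen vertices.\<close>

definition isom :: "('a \<Rightarrow> 'b) \<Rightarrow> 'a graph \<Rightarrow> 'b graph \<Rightarrow> bool" where
  "isom f G H \<longleftrightarrow> graph G \<and> graph H \<and> bij_betw f (verts G) (verts H) \<and>
     (\<forall>u\<in>verts G. \<forall>v\<in>verts G. {u, v} \<in> edges G \<longleftrightarrow> {f u, f v} \<in> edges H)"

lemma isomI:
  assumes "graph G" "graph H" "bij_betw f (verts G) (verts H)"
    "\<And>u v. u \<in> verts G \<Longrightarrow> v \<in> verts G \<Longrightarrow> {u, v} \<in> edges G \<longleftrightarrow> {f u, f v} \<in> edges H"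
  shows "isom f G H"
  using assms by (simp add: isom_def)

lemma isomD:
  assumes "isom f G H"
  shows "graph G" "graph H" "bij_betw f (verts G) (verts H)" "inj_on f (verts G)"
    "f ` verts G = verts H"
    "\<And>u v. u \<in> verts G \<Longrightarrow> v \<in> verts G \<Longrightarrow> {u, v} \<in> edges G \<longleftrightarrow> {f u, f v} \<in> edges H"
  using assms by (auto simp: isom_def bij_betw_def)

lemma isom_edges: "isom f G H \<Longrightarrow> edges H = (\<lambda>e. f ` e) ` edges G"
proof
  assume i: "isom f G H"
  note d = isomD[OF i]
  show "edges H \<subseteq> (\<lambda>e. f ` e) ` edges G"
  proof
    fix e assume e: "e \<in> edges H"
    obtain x y where xy: "e = {x, y}" "x \<in> verts H" "y \<in> verts H"
      using e d(2) by (auto elim: graph_edgeE)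
    obtain u v where uv: "u \<in> verts G" "v \<in> verts G" "x = f u" "y = f v"
      using xy d(5) by blast
    have "{u, v} \<in> edges G" using d(6)[OF uv(1,2)] e xy uv by simp
    moreover have "e = f ` {u, v}" using xy uv by simp
    ultimately show "e \<in> (\<lambda>e. f ` e) ` edges G" by blast
  qed
  show "(\<lambda>e. f ` e) ` edges G \<subseteq> edges H"
  proof
    fix e assume "e \<in> (\<lambda>e. f ` e) ` edges G"
    then obtain e' where e': "e' \<in> edges G" "e = f ` e'" by blast
    obtain u v where "e' = {u, v}" "u \<in> verts G" "v \<in> verts G"
      using e' d(1) by (auto elim: graph_edgeE)
    then show "e \<in> edges H" using d(6)[of u v] e' by simp
  qed
qed

lemma iso_iff: "iso G H \<longleftrightarrow> (\<exists>f. isom f G H)"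
proof
  assume "iso G H"
  then obtain f where f: "graph G" "graph H" "bij_betw f (verts G) (verts H)"
    "edges H = (\<lambda>e. f ` e) ` edges G" by (auto simp: iso_def)
  have inj: "inj_on f (verts G)" using f(3) by (simp add: bij_betw_def)
  have "isom f G H"
  proof (rule isomI[OF f(1-3)])
    fix u v assume uv: "u \<in> verts G" "v \<in> verts G"
    show "({u, v} \<in> edges G) = ({f u, f v} \<in> edges H)"
    proof
      assume "{u, v} \<in> edges G"
      then have "f ` {u, v} \<in> edges H" unfolding f(4) by (rule imageI)
      then show "{f u, f v} \<in> edges H" by simp
    next
      assume "{f u, f v} \<in> edges H"
      then obtain e where e: "e \<in> edges G" "f ` {u, v} = f ` e" unfolding f(4) by auto
      have "{u, v} = e"
        using inj_on_image_eq_iff[OF inj, of "{u, v}" e] e edge_subset[OF f(1) e(1)] uv by simp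
      then show "{u, v} \<in> edges G" using e by simp
    qed
  qed
  then show "\<exists>f. isom f G H" by blast
next
  assume "\<exists>f. isom f G H"
  then obtain f where "isom f G H" by blast
  then show "iso G H" unfolding iso_def using isomD[of f G H] isom_edges[of f G H] by blast
qed

lemma isom_trans:
  assumes "isom f G H" "isom g H K"
  shows "isom (\<lambda>x. g (f x)) G K"
proof (rule isomI)
  note a = isomD[OF assms(1)] and b = isomD[OF assms(2)]
  show "graph G" "graph K" by fact+
  show "bij_betw (\<lambda>x. g (f x)) (verts G) (verts K)"
    using bij_betw_trans[OF a(3) b(3)] by (simp add: comp_def)
  fix u v assume uv: "u \<in> verts G" "v \<in> verts G"
  then have "f u \<in> verts H" "f v \<in> verts H" using a(5) by auto
  then show "({u, v} \<in> edges G) = ({g (f u), g (f v)} \<in> edges K)" using a(6)[OF uv] b(6) by simp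
qed

lemma isom_inv:
  assumes "isom f G H"
  shows "isom (inv_into (verts G) f) H G"
proof (rule isomI)
  note a = isomD[OF assms]
  show "graph H" "graph G" by fact+
  show "bij_betw (inv_into (verts G) f) (verts H) (verts G)" by (rule bij_betw_inv_into[OF a(3)])
  fix u v assume "u \<in> verts H" "v \<in> verts H"
  then show "({u, v} \<in> edges H) = ({inv_into (verts G) f u, inv_into (verts G) f v} \<in> edges G)"
    using a(6)[of "inv_into (verts G) f u" "inv_into (verts G) f v"]
    by (simp add: f_inv_into_f inv_into_into a(5))
qed

lemma isom_nbrs:
  assumes i: "isom f G H" and v: "v \<in> verts G"
  shows "nbrs H (f v) = f ` nbrs G v"
proof
  note a = isomD[OF i]
  show "nbrs H (f v) \<subseteq> f ` nbrs G v"
  proof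
    fix w assume w: "w \<in> nbrs H (f v)"
    then have "w \<in> verts H" using nbrs_sub[OF a(2)] by blast
    then obtain x where x: "x \<in> verts G" "w = f x" using a(5) by blast
    then show "w \<in> f ` nbrs G v" using a(6)[OF v x(1)] w by (simp add: nbrs_def)
  qed
  show "f ` nbrs G v \<subseteq> nbrs H (f v)"
  proof
    fix w assume "w \<in> f ` nbrs G v"
    then obtain x where x: "x \<in> nbrs G v" "w = f x" by blast
    then have "x \<in> verts G" using nbrs_sub[OF a(1)] by blast
    then show "w \<in> nbrs H (f v)" using a(6)[OF v] x by (simp add: nbrs_def)
  qed
qed

lemma isom_cubic3:
  assumes i: "isom f G H" and G: "cubic3 G"
  shows "cubic3 H"
proof (rule cubic3I)
  note a = isomD[OF i]
  show "graph H" by fact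
  show "4 \<le> card (verts H)" using cubic3D(3)[OF G] bij_betw_same_card[OF a(3)] by simp
  {
    fix v assume "v \<in> verts H"
    then obtain x where x: "x \<in> verts G" "v = f x" using a(5) by blast
    have "card (f ` nbrs G x) = card (nbrs G x)"
      by (rule card_image) (rule inj_on_subset[OF a(4)], use nbrs_sub[OF a(1), of x] in auto)
    then show "card (nbrs H v) = 3"
      using cubic3D(2)[OF G x(1)] isom_nbrs[OF i x(1)] x by simp
  next
    fix X P assume X: "X \<subseteq> verts H" "card X \<le> 2" and P: "P \<subseteq> verts H - X" "P \<noteq> {}"
      and cl: "\<And>u. u \<in> P \<Longrightarrow> nbrs H u \<subseteq> X \<union> P"
    define X' where "X' = {x \<in> verts G. f x \<in> X}"
    define P' where "P' = {x \<in> verts G. f x \<in> P}"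
    have "f ` {x \<in> verts G. f x \<in> Z} = f ` verts G \<inter> Z" for Z by blast
    then have "f ` {x \<in> verts G. f x \<in> Z} = Z" if "Z \<subseteq> verts H" for Z
      unfolding a(5) using that by (simp add: Int_absorb1)
    then have fX: "f ` X' = X" and fP: "f ` P' = P"
      unfolding X'_def P'_def using X(1) P(1) by (simp, blast)
    have "P' = verts G - X'"
    proof (rule cubic3_conn[OF G])
      show "X' \<subseteq> verts G" by (auto simp: X'_def)
      have "card (f ` X') = card X'"
        by (rule card_image) (rule inj_on_subset[OF a(4)], auto simp: X'_def)
      then show "card X' \<le> 2" using X fX by simp
      show "P' \<subseteq> verts G - X'" using P by (auto simp: X'_def P'_def)
      show "P' \<noteq> {}" using fP P by auto
      fix u assume u: "u \<in> P'"
      then have "f ` nbrs G u \<subseteq> X \<union> P"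
        using cl[of "f u"] isom_nbrs[OF i, of u] by (auto simp: P'_def)
      then show "nbrs G u \<subseteq> X' \<union> P'"
        using nbrs_sub[OF a(1), of u] by (auto simp: X'_def P'_def)
    qed
    then have "f x \<in> P \<longleftrightarrow> f x \<notin> X" if "x \<in> verts G" for x
      using that unfolding X'_def P'_def set_eq_iff by blast
    then have "f x \<in> P" if "f x \<notin> X" "x \<in> verts G" for x using that by simp
    then have "v \<in> P" if "v \<in> f ` verts G - X" for v using that by blast
    then show "P = verts H - X" using P(1) unfolding a(5) by blast
  }
qed

lemma isom_perfect_matching:
  assumes i: "isom f G H" and M: "perfect_matching G M"
  shows "perfect_matching H ((\<lambda>e. f ` e) ` M)"
  unfolding perfect_matching_def
proof (intro conjI ballI)
  note a = isomD[OF i]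
  have Me: "M \<subseteq> edges G" and Mu: "\<And>v. v \<in> verts G \<Longrightarrow> \<exists>!e. e \<in> M \<and> v \<in> e"
    using M by (auto simp: perfect_matching_def)
  show "(\<lambda>e. f ` e) ` M \<subseteq> edges H" using Me isom_edges[OF i] by auto
  fix v assume "v \<in> verts H"
  then obtain x where x: "x \<in> verts G" "v = f x" using a(5) by blast
  obtain e where e: "e \<in> M" "x \<in> e" "\<And>e'. e' \<in> M \<Longrightarrow> x \<in> e' \<Longrightarrow> e' = e" using Mu[OF x(1)] by blast
  show "\<exists>!e. e \<in> (\<lambda>e. f ` e) ` M \<and> v \<in> e"
  proof (rule ex1I[of _ "f ` e"])
    show "f ` e \<in> (\<lambda>e. f ` e) ` M \<and> v \<in> f ` e" using e(1,2) x(2) by blast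
    fix d assume d: "d \<in> (\<lambda>e. f ` e) ` M \<and> v \<in> d"
    then obtain e' where e': "e' \<in> M" "d = f ` e'" by blast
    have "e' \<subseteq> verts G" using e' Me edge_subset[OF a(1)] by blast
    then have "x \<in> e'" using d e' x a(4) by (auto simp: inj_on_def)
    then show "d = f ` e" using e(3) e' by blast
  qed
qed

lemma isom_inv_image:
  assumes i: "isom f G H" and M: "M \<subseteq> edges G"
  shows "(\<lambda>e. inv_into (verts G) f ` e) ` (\<lambda>e. f ` e) ` M = M"
proof -
  note a = isomD[OF i]
  have "inv_into (verts G) f ` f ` e = e" if "e \<in> M" for e
    using M that edge_subset[OF a(1), of e] inv_into_image_cancel[OF a(4)] by blast
  then have "(\<lambda>e. inv_into (verts G) f ` f ` e) ` M = (\<lambda>e. e) ` M" by (rule image_cong[OF refl])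
  then show ?thesis by (simp add: image_image)
qed

lemma isom_pm_card:
  assumes i: "isom f G H" and e: "e \<in> edges G"
  shows "card {M. perfect_matching G M \<and> e \<in> M} = card {M. perfect_matching H M \<and> f ` e \<in> M}"
proof (rule bij_betw_same_card[of "\<lambda>M. (\<lambda>e. f ` e) ` M"],
    rule bij_betw_byWitness[where f' = "\<lambda>M. (\<lambda>e. inv_into (verts G) f ` e) ` M"])
  note a = isomD[OF i] and j = isom_inv[OF i]
  let ?g = "inv_into (verts G) f"
  have ge: "?g ` f ` e = e" using inv_into_image_cancel[OF a(4)] edge_subset[OF a(1) e] by blast
  show "\<forall>M\<in>{M. perfect_matching G M \<and> e \<in> M}. (\<lambda>e. ?g ` e) ` (\<lambda>e. f ` e) ` M = M"
    using isom_inv_image[OF i] by (auto simp: perfect_matching_def)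
  show "\<forall>M\<in>{M. perfect_matching H M \<and> f ` e \<in> M}. (\<lambda>e. f ` e) ` (\<lambda>e. ?g ` e) ` M = M"
  proof
    fix M assume "M \<in> {M. perfect_matching H M \<and> f ` e \<in> M}"
    then have M: "M \<subseteq> edges H" by (auto simp: perfect_matching_def)
    have "f ` ?g ` d = d" if "d \<in> M" for d
      using edge_subset[OF a(2), of d] M that image_inv_into_cancel[OF a(5), of d] by blast
    then have "(\<lambda>e. f ` ?g ` e) ` M = (\<lambda>e. e) ` M" by (rule image_cong[OF refl])
    then show "(\<lambda>e. f ` e) ` (\<lambda>e. ?g ` e) ` M = M" by (simp add: image_image)
  qed
  show "(\<lambda>M. (\<lambda>e. f ` e) ` M) ` {M. perfect_matching G M \<and> e \<in> M}
    \<subseteq> {M. perfect_matching H M \<and> f ` e \<in> M}"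
    using isom_perfect_matching[OF i] by auto
  show "(\<lambda>M. (\<lambda>e. ?g ` e) ` M) ` {M. perfect_matching H M \<and> f ` e \<in> M}
    \<subseteq> {M. perfect_matching G M \<and> e \<in> M}"
    using isom_perfect_matching[OF j] ge by (auto simp: image_iff) metis
qed

lemma isom_num_lonely:
  assumes i: "isom f G H"
  shows "num_lonely H = num_lonely G"
proof -
  note a = isomD[OF i]
  have "{e \<in> edges H. lonely H e} = (\<lambda>e. f ` e) ` {e \<in> edges G. lonely G e}"
    unfolding lonely_def isom_edges[OF i] using isom_pm_card[OF i] by auto
  moreover have "inj_on (\<lambda>e. f ` e) {e \<in> edges G. lonely G e}"
    using edge_subset[OF a(1)] inj_on_image_eq_iff[OF a(4)] by (auto simp: inj_on_def)
  ultimately show ?thesis unfolding num_lonely_def by (simp add: card_image)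
qed

text \<open>A positive count already provides the lonely edge demanded by
  \<open>classU\<close>.\<close>

lemma classU_k_iff:
  assumes "k > 0"
  shows "classU_k k G \<longleftrightarrow> cubic3 G \<and> num_lonely G = k"
proof -
  have "\<exists>e. lonely G e" if "num_lonely G = k"
  proof -
    have "{e \<in> edges G. lonely G e} \<noteq> {}"
      using that assms unfolding num_lonely_def by (metis card.empty less_not_refl)
    then show ?thesis by blast
  qed
  then show ?thesis by (auto simp: classU_k_def classU_def cubic3_def)
qed

lemma isom_contract:
  assumes i: "isom f G H" and S: "S \<subseteq> verts G" and c: "c \<notin> verts G - S" and d: "d \<notin> verts H - f ` S"
  shows "isom (f(c := d)) (contract G S c) (contract H (f ` S) d)"
proof (rule isomI)
  note a = isomD[OF i]
  have img: "f ` (verts G - S) = verts H - f ` S"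
    using S a(4,5) by (metis inj_on_image_set_diff order_refl Diff_subset)
  have fS: "f x \<in> f ` S \<longleftrightarrow> x \<in> S" if "x \<in> verts G" for x
    using that S a(4) by (auto simp: inj_on_def)
  have fc: "(f(c := d)) u = f u" if "u \<in> verts G - S" for u using that c by auto
  show "graph (contract G S c)" by (rule graph_contract[OF a(1) c])
  show "graph (contract H (f ` S) d)" by (rule graph_contract[OF a(2) d])
  have "bij_betw f (verts G - S) (verts H - f ` S)"
    unfolding bij_betw_def using img inj_on_subset[OF a(4)] by blast
  then have "bij_betw (f(c := d)) (verts G - S) (verts H - f ` S)"
    using bij_betw_cong[of "verts G - S" "f(c := d)" f] fc by blast
  then show "bij_betw (f(c := d)) (verts (contract G S c)) (verts (contract H (f ` S) d))"
    using bij_betw_combine[of "f(c := d)" "verts G - S" "verts H - f ` S" "{c}" "{d}"] d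
    by (simp add: bij_betw_def)
  have E1: "{f u', f w'} \<in> edges H \<and> \<not> (f u' \<in> f ` S \<and> f w' \<in> f ` S) \<longleftrightarrow>
      {u', w'} \<in> edges G \<and> \<not> (u' \<in> S \<and> w' \<in> S)" if "u' \<in> verts G" "w' \<in> verts G" for u' w'
    using a(6) fS that by blast
  let ?p = "\<lambda>u. if u \<in> S then c else u" and ?q = "\<lambda>u. if u \<in> f ` S then d else u"
  have pq: "?q (f u') = (f(c := d)) (?p u')" if "u' \<in> verts G" for u'
    using fS[OF that] fc that c by auto
  have inj: "inj_on (f(c := d)) (insert c (verts G - S))"
    using \<open>bij_betw (f(c := d)) (verts (contract G S c)) (verts (contract H (f ` S) d))\<close>
    by (simp add: bij_betw_def)
  fix u w assume uw: "u \<in> verts (contract G S c)" "w \<in> verts (contract G S c)"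
  show "({u, w} \<in> edges (contract G S c)) = ({(f(c := d)) u, (f(c := d)) w} \<in> edges (contract H (f ` S) d))"
  proof
    assume "{u, w} \<in> edges (contract G S c)"
    then obtain u' w' where h: "{u', w'} \<in> edges G" "\<not> (u' \<in> S \<and> w' \<in> S)" "u = ?p u'" "w = ?p w'"
      unfolding edge_contract_iff[OF a(1)] by blast
    have v: "u' \<in> verts G" "w' \<in> verts G" using edge_verts[OF a(1) h(1)] by auto
    show "{(f(c := d)) u, (f(c := d)) w} \<in> edges (contract H (f ` S) d)"
      unfolding edge_contract_iff[OF a(2)]
      by (rule exI[of _ "f u'"], rule exI[of _ "f w'"]) (use E1[OF v] pq[OF v(1)] pq[OF v(2)] h in simp)
  next
    assume "{(f(c := d)) u, (f(c := d)) w} \<in> edges (contract H (f ` S) d)"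
    then obtain x y where h: "{x, y} \<in> edges H" "\<not> (x \<in> f ` S \<and> y \<in> f ` S)"
        "(f(c := d)) u = ?q x" "(f(c := d)) w = ?q y"
      unfolding edge_contract_iff[OF a(2)] by blast
    have "x \<in> verts H" "y \<in> verts H" using edge_verts[OF a(2) h(1)] by auto
    then obtain u' w' where v: "x = f u'" "y = f w'" "u' \<in> verts G" "w' \<in> verts G"
      using a(5) by blast
    have "(f(c := d)) u = (f(c := d)) (?p u')" "(f(c := d)) w = (f(c := d)) (?p w')"
      by (rule trans[OF h(3)[unfolded v(1)] pq[OF v(3)]], rule trans[OF h(4)[unfolded v(2)] pq[OF v(4)]])
    moreover have "?p u' \<in> insert c (verts G - S)" "?p w' \<in> insert c (verts G - S)" using v by auto
    moreover have "u \<in> insert c (verts G - S)" "w \<in> insert c (verts G - S)" using uw by auto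
    ultimately have "u = ?p u'" "w = ?p w'" using inj_onD[OF inj] by blast+
    then show "{u, w} \<in> edges (contract G S c)"
      unfolding edge_contract_iff[OF a(1)] using E1[OF v(3,4)] h v by blast
  qed
qed

text \<open>Outside the triangles \<open>f\<close> is kept; all edges at a triangle are fixed by the
  pairing of its vertices with their outer neighbours, which \<open>f\<close> respects.\<close>

lemma isom_expand:
  assumes t: "tri G y1 y2 y3 o1 o2 o3" and t': "tri G' y1' y2' y3' o1' o2' o3'"
    and c: "c \<notin> verts G - {y1, y2, y3}" and c': "c' \<notin> verts G' - {y1', y2', y3'}"
    and i: "isom f (contract G {y1, y2, y3} c) (contract G' {y1', y2', y3'} c')"
    and fc: "f c = c'" and fo: "f o1 = o1'" "f o2 = o2'" "f o3 = o3'"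
  shows "isom (f(y1 := y1', y2 := y2', y3 := y3')) G G'"
proof (rule isomI)
  let ?Y = "{y1, y2, y3}" and ?Y' = "{y1', y2', y3'}" and ?g = "f(y1 := y1', y2 := y2', y3 := y3')"
  note g = triD(1)[OF t] and g' = triD(1)[OF t'] and a = isomD[OF i]
  note ne = tri_neq[OF t] and ne' = tri_neq[OF t']
  show "graph G" "graph G'" by (fact g g')+
  have gf: "?g u = f u" if "u \<notin> ?Y" for u using that by auto
  have gy: "?g y1 = y1'" "?g y2 = y2'" "?g y3 = y3'" using ne by auto
  have go: "?g o1 = o1'" "?g o2 = o2'" "?g o3 = o3'" using gf fo ne by auto
  have inj: "inj_on f (insert c (verts G - ?Y))" using a(4) by simp
  have img: "f ` insert c (verts G - ?Y) = insert c' (verts G' - ?Y')" using a(5) by simp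
  have fV: "f u \<in> verts G' - ?Y'" if "u \<in> verts G - ?Y" for u
  proof -
    have "f u \<noteq> f c" using inj that c by (metis inj_on_def insertCI)
    then show ?thesis using img that fc by blast
  qed
  have "f ` (verts G - ?Y) = verts G' - ?Y'"
  proof
    show "f ` (verts G - ?Y) \<subseteq> verts G' - ?Y'" using fV by blast
    show "verts G' - ?Y' \<subseteq> f ` (verts G - ?Y)"
    proof
      fix x assume x: "x \<in> verts G' - ?Y'"
      then have "x \<in> f ` insert c (verts G - ?Y)" unfolding img by (rule insertI2)
      moreover have "x \<noteq> f c"
      proof
        assume "x = f c"
        then have "x = c'" using fc by simp
        then show False using x c' by simp
      qed
      ultimately show "x \<in> f ` (verts G - ?Y)" by (simp only: image_insert insert_iff simp_thms)
    qed
  qed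
  then have b1: "bij_betw ?g (verts G - ?Y) (verts G' - ?Y')"
    using bij_betw_cong[of "verts G - ?Y" ?g f] gf inj by (auto simp: bij_betw_def)
  have b2: "bij_betw ?g ?Y ?Y'" unfolding bij_betw_def
  proof
    show "inj_on ?g ?Y" unfolding inj_on_def using gy ne' by (simp del: fun_upd_apply)
    show "?g ` ?Y = ?Y'" using gy by (simp del: fun_upd_apply)
  qed
  have "(verts G - ?Y) \<union> ?Y = verts G" "(verts G' - ?Y') \<union> ?Y' = verts G'"
    using triD(6)[OF t] triD(6)[OF t'] by blast+
  moreover have "(verts G' - ?Y') \<inter> ?Y' = {}" by blast
  ultimately show bij: "bij_betw ?g (verts G) (verts G')"
    using bij_betw_combine[OF b1 b2] by simp
  have ginj: "?g u = ?g w \<longleftrightarrow> u = w" if "u \<in> verts G" "w \<in> verts G" for u w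
    using bij that by (auto simp: bij_betw_def inj_on_def simp del: fun_upd_apply)
  have Y: "y1 \<in> verts G" "y2 \<in> verts G" "y3 \<in> verts G" "o1 \<in> verts G" "o2 \<in> verts G" "o3 \<in> verts G"
    using triD(6,7)[OF t] by auto
  have yn: "?g ` nbrs G y = nbrs G' (?g y)" if "y \<in> ?Y" for y
    using that gy go triD(3-5)[OF t] triD(3-5)[OF t'] by (auto simp del: fun_upd_apply)
  have yE: "({u, v} \<in> edges G) = ({?g u, ?g v} \<in> edges G')"
    if u: "u \<in> ?Y" and v: "v \<in> verts G" for u v
  proof -
    have "nbrs G u \<subseteq> verts G" using nbrs_sub[OF g] by blast
    then have "v \<in> nbrs G u \<longleftrightarrow> ?g v \<in> ?g ` nbrs G u" using ginj v by blast
    then show ?thesis unfolding yn[OF u] by (simp add: nbrs_def)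
  qed
  fix u v assume uv: "u \<in> verts G" "v \<in> verts G"
  show "({u, v} \<in> edges G) = ({?g u, ?g v} \<in> edges G')"
  proof (cases "u \<in> ?Y \<or> v \<in> ?Y")
    case True
    then show ?thesis using yE[of u v] yE[of v u] uv by (auto simp: insert_commute simp del: fun_upd_apply)
  next
    case False
    then have o: "u \<in> verts G - ?Y" "v \<in> verts G - ?Y" using uv by auto
    have "({u, v} \<in> edges G) = ({u, v} \<in> edges (contract G ?Y c))"
      using edge_contract_outside[OF g c, of u v] o c by blast
    also have "\<dots> = ({f u, f v} \<in> edges (contract G' ?Y' c'))" using a(6)[of u v] o by simp
    also have "\<dots> = ({f u, f v} \<in> edges G')"
      using edge_contract_outside[OF g' c', of "f u" "f v"] fV[OF o(1)] fV[OF o(2)] c' by blast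
    finally show ?thesis using gf False by simp
  qed
qed

text \<open>The expansion of a vertex into a triangle is unique up to isomorphism: any bijection between
  the neighbours can be followed by the corresponding bijection between the triangles.\<close>

lemma isom_expand_ex:
  assumes t: "tri G y1 y2 y3 o1 o2 o3" and t': "tri G' y1' y2' y3' o1' o2' o3'"
    and c: "c \<notin> verts G - {y1, y2, y3}" and c': "c' \<notin> verts G' - {y1', y2', y3'}"
    and i: "isom f (contract G {y1, y2, y3} c) (contract G' {y1', y2', y3'} c')"
    and fc: "f c = c'"
  obtains g where "isom g G G'" "\<And>v. v \<in> verts G - {y1, y2, y3} \<Longrightarrow> g v = f v"
    "g ` {y1, y2, y3} = {y1', y2', y3'}"
proof -
  have "f ` {o1, o2, o3} = {o1', o2', o3'}"
    using isom_nbrs[OF i, of c] fc nbrs_contract_tri_new[OF t c] nbrs_contract_tri_new[OF t' c'] by simp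
  then have "f o1 \<in> {o1', o2', o3'}" "f o2 \<in> {o1', o2', o3'}" "f o3 \<in> {o1', o2', o3'}" by blast+
  then have "f o1 = o1' \<or> f o1 = o2' \<or> f o1 = o3'" "f o2 = o1' \<or> f o2 = o2' \<or> f o2 = o3'"
    "f o3 = o1' \<or> f o3 = o2' \<or> f o3 = o3'" by simp_all
  moreover have "f o1 \<noteq> f o2" "f o2 \<noteq> f o3" "f o1 \<noteq> f o3"
    using triD(7)[OF t] by (simp_all add: inj_on_eq_iff[OF isomD(4)[OF i]] tri_neq[OF t])
  ultimately consider
      "f o1 = o1' \<and> f o2 = o2' \<and> f o3 = o3'" | "f o1 = o1' \<and> f o2 = o3' \<and> f o3 = o2'"
    | "f o1 = o2' \<and> f o2 = o1' \<and> f o3 = o3'" | "f o1 = o2' \<and> f o2 = o3' \<and> f o3 = o1'"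
    | "f o1 = o3' \<and> f o2 = o1' \<and> f o3 = o2'" | "f o1 = o3' \<and> f o2 = o2' \<and> f o3 = o1'"
    by metis
  \<comment> \<open>The triangle of \<open>G'\<close> is reordered so that its outer neighbours
    appear as \<open>f o1\<close>, \<open>f o2\<close>, \<open>f o3\<close>.\<close>
  then obtain z1 z2 z3 where z: "tri G' z1 z2 z3 (f o1) (f o2) (f o3)" "{z1, z2, z3} = {y1', y2', y3'}"
  proof cases
    case 1 then show ?thesis using t' that by simp
  next
    case 2 then show ?thesis using tri_perm(3)[OF t'] that[of y1' y3' y2'] by (simp add: insert_commute)
  next
    case 3 then show ?thesis using tri_perm(1)[OF t'] that[of y2' y1' y3'] by (simp add: insert_commute)
  next
    case 4 then show ?thesis using tri_perm(2)[OF t'] that[of y2' y3' y1'] by (simp add: insert_commute)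
  next
    case 5 then show ?thesis using tri_perm(4)[OF t'] that[of y3' y1' y2'] by (simp add: insert_commute)
  next
    case 6 then show ?thesis using tri_perm(5)[OF t'] that[of y3' y2' y1'] by (simp add: insert_commute)
  qed
  have "isom (f(y1 := z1, y2 := z2, y3 := z3)) G G'"
    using c' i z(2) by (intro isom_expand[OF t z(1) c, of c'] fc) simp_all
  moreover have "(f(y1 := z1, y2 := z2, y3 := z3)) ` {y1, y2, y3} = {y1', y2', y3'}"
    using tri_neq[OF t] z(2) by auto
  ultimately show ?thesis using that[of "f(y1 := z1, y2 := z2, y3 := z3)"] by auto
qed

subsection \<open>Matchings and Kotzig's theorem\<close>

text \<open>Perfect matchings of the subgraph induced on \<open>X\<close>, as subsets of one ambient
  edge set, so that matchings of disjoint vertex sets can be united and restricted freely.\<close>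

definition pm_on :: "'a set set \<Rightarrow> 'a set \<Rightarrow> 'a set set \<Rightarrow> bool" where
  "pm_on E X N \<longleftrightarrow> N \<subseteq> E \<and> (\<forall>e\<in>N. e \<subseteq> X) \<and> (\<forall>v\<in>X. \<exists>!e. e \<in> N \<and> v \<in> e)"

definition matchable :: "'a set set \<Rightarrow> 'a set \<Rightarrow> bool" where
  "matchable E X \<longleftrightarrow> (\<exists>N. pm_on E X N)"

definition factor_critical :: "'a set set \<Rightarrow> 'a set \<Rightarrow> bool" where
  "factor_critical E K \<longleftrightarrow> (\<forall>v\<in>K. matchable E (K - {v}))"

lemma pm_onI:
  assumes "N \<subseteq> E" "\<And>e. e \<in> N \<Longrightarrow> e \<subseteq> X" "\<And>v. v \<in> X \<Longrightarrow> \<exists>!e. e \<in> N \<and> v \<in> e"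
  shows "pm_on E X N"
  using assms by (auto simp: pm_on_def)

lemma pm_onD:
  assumes "pm_on E X N"
  shows "N \<subseteq> E" "\<And>e. e \<in> N \<Longrightarrow> e \<subseteq> X" "\<And>v. v \<in> X \<Longrightarrow> \<exists>!e. e \<in> N \<and> v \<in> e"
  using assms by (auto simp: pm_on_def)

lemma perfect_matching_pm_on:
  "graph G \<Longrightarrow> perfect_matching G M \<longleftrightarrow> pm_on (edges G) (verts G) M"
  using edge_subset[of G] by (auto simp: perfect_matching_def pm_on_def)

lemma pm_on_Un:
  assumes "pm_on E X N" "pm_on E Y N'" "X \<inter> Y = {}"
  shows "pm_on E (X \<union> Y) (N \<union> N')"
proof (rule pm_onI)
  note a = pm_onD[OF assms(1)] and b = pm_onD[OF assms(2)]
  show "N \<union> N' \<subseteq> E" using a b by blast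
  show "e \<subseteq> X \<union> Y" if "e \<in> N \<union> N'" for e using that a(2) b(2) by blast
  fix v assume "v \<in> X \<union> Y"
  then consider "v \<in> X" "v \<notin> Y" | "v \<in> Y" "v \<notin> X" using assms(3) by blast
  then show "\<exists>!e. e \<in> N \<union> N' \<and> v \<in> e"
  proof cases
    case 1
    then have "e \<in> N \<union> N' \<and> v \<in> e \<longleftrightarrow> e \<in> N \<and> v \<in> e" for e using b(2) by blast
    then show ?thesis using a(3)[OF 1(1)] by simp
  next
    case 2
    then have "e \<in> N \<union> N' \<and> v \<in> e \<longleftrightarrow> e \<in> N' \<and> v \<in> e" for e using a(2) by blast
    then show ?thesis using b(3)[OF 2(1)] by simp
  qed
qed

lemma pm_on_edge: "{u, v} \<in> E \<Longrightarrow> pm_on E {u, v} {{u, v}}"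
  by (rule pm_onI) auto

text \<open>A vertex set that no edge of \<open>N\<close> crosses splits \<open>N\<close>, so one
  half can be exchanged for another matching.\<close>

lemma pm_on_part:
  assumes N: "pm_on E X N" and Y: "Y \<subseteq> X" and cl: "\<And>e. e \<in> N \<Longrightarrow> e \<subseteq> Y \<or> e \<inter> Y = {}"
  shows "pm_on E Y {e \<in> N. e \<subseteq> Y}" "pm_on E (X - Y) {e \<in> N. e \<inter> Y = {}}"
proof -
  note a = pm_onD[OF N]
  show "pm_on E Y {e \<in> N. e \<subseteq> Y}"
  proof (rule pm_onI)
    fix v assume v: "v \<in> Y"
    then have "e \<in> {e \<in> N. e \<subseteq> Y} \<and> v \<in> e \<longleftrightarrow> e \<in> N \<and> v \<in> e" for e using cl by blast
    then show "\<exists>!e. e \<in> {e \<in> N. e \<subseteq> Y} \<and> v \<in> e" using a(3)[of v] v Y by auto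
  qed (use a(1) in auto)
  show "pm_on E (X - Y) {e \<in> N. e \<inter> Y = {}}"
  proof (rule pm_onI)
    fix v assume v: "v \<in> X - Y"
    then have "e \<in> {e \<in> N. e \<inter> Y = {}} \<and> v \<in> e \<longleftrightarrow> e \<in> N \<and> v \<in> e" for e using cl by blast
    then show "\<exists>!e. e \<in> {e \<in> N. e \<inter> Y = {}} \<and> v \<in> e" using a(3)[of v] v by auto
  qed (use a(1,2) in auto)
qed

lemma matchable_empty: "matchable E {}"
  unfolding matchable_def by (rule exI[of _ "{}"]) (simp add: pm_on_def)

lemma matchable_edge: "{u, v} \<in> E \<Longrightarrow> matchable E {u, v}"
  unfolding matchable_def by (intro exI) (rule pm_on_edge)

lemma matchable_Un: "matchable E X \<Longrightarrow> matchable E Y \<Longrightarrow> X \<inter> Y = {} \<Longrightarrow> matchable E (X \<union> Y)"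
  unfolding matchable_def using pm_on_Un by blast

lemma matchable_link:
  assumes "matchable E (A - {a})" "matchable E (B - {b})" "{a, b} \<in> E" "a \<in> A" "b \<in> B" "A \<inter> B = {}"
  shows "matchable E (A \<union> B)"
proof -
  have "matchable E ((A - {a} \<union> (B - {b})) \<union> {a, b})"
    by (intro matchable_Un matchable_edge) (use assms in auto)
  moreover have "(A - {a} \<union> (B - {b})) \<union> {a, b} = A \<union> B" using assms(4,5) by blast
  ultimately show ?thesis by simp
qed

definition linked :: "'a set set \<Rightarrow> 'a set \<Rightarrow> 'a set \<Rightarrow> bool" where
  "linked E A B \<longleftrightarrow> (\<exists>a\<in>A. \<exists>b\<in>B. {a, b} \<in> E)"

definition span :: "('a set \<Rightarrow> 'a set) \<Rightarrow> 'a set list \<Rightarrow> 'a set" where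
  "span \<mu> ns = (\<Union>N\<in>set ns. N \<union> \<mu> N)"

text \<open>An alternating path \<open>N\<^sub>0, \<mu> N\<^sub>0, \<dots>, N\<^sub>r, \<mu> N\<^sub>r\<close> of blobs: removing one vertex at each end
  leaves a matchable set, and every vertex can be removed together with an arbitrary vertex of
  one of the two end blobs.\<close>

lemma alternating_path:
  assumes "ns \<noteq> []" "distinct ns"
    and "\<And>N. N \<in> set ns \<Longrightarrow> factor_critical E N \<and> factor_critical E (\<mu> N) \<and> linked E N (\<mu> N) \<and> N \<inter> \<mu> N = {}"
    and "\<And>N N'. N \<in> set ns \<Longrightarrow> N' \<in> set ns \<Longrightarrow> N \<noteq> N' \<Longrightarrow> (N \<union> \<mu> N) \<inter> (N' \<union> \<mu> N') = {}"
    and "successively (\<lambda>N N'. linked E (\<mu> N) N') ns"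
  shows "matchable E (span \<mu> ns) \<and>
    (\<forall>u\<in>hd ns. \<forall>v\<in>\<mu> (last ns). matchable E (span \<mu> ns - {u, v})) \<and>
    (\<forall>v\<in>span \<mu> ns. (v \<notin> hd ns \<and> (\<forall>u\<in>hd ns. matchable E (span \<mu> ns - {u, v}))) \<or>
       (v \<notin> \<mu> (last ns) \<and> (\<forall>u\<in>\<mu> (last ns). matchable E (span \<mu> ns - {u, v}))))"
  using assms
proof (induction ns)
  case Nil then show ?case by simp
next
  case (Cons N ns)
  let ?N' = "\<mu> N"
  have fc: "factor_critical E N" "factor_critical E ?N'" and lk: "linked E N ?N'" and dj: "N \<inter> ?N' = {}"
    using Cons.prems(3)[of N] by auto
  have mN: "matchable E (N \<union> ?N')"
  proof -
    obtain a b where "a \<in> N" "b \<in> ?N'" "{a, b} \<in> E" using lk by (auto simp: linked_def)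
    then show ?thesis using matchable_link[of E N a ?N' b] fc dj by (auto simp: factor_critical_def)
  qed
  have mNN: "matchable E (N \<union> ?N' - {u, v})" if "u \<in> N" "v \<in> ?N'" for u v
  proof -
    have "matchable E ((N - {u}) \<union> (?N' - {v}))"
      by (intro matchable_Un) (use fc that dj in \<open>auto simp: factor_critical_def\<close>)
    moreover have "(N - {u}) \<union> (?N' - {v}) = N \<union> ?N' - {u, v}" using that dj by auto
    ultimately show ?thesis by simp
  qed
  show ?case
  proof (cases "ns = []")
    case True
    have "matchable E (N \<union> ?N' - {u, v})" if "u \<in> ?N'" "v \<in> N" for u v
      using mNN[OF that(2,1)] by (simp add: insert_commute)
    then show ?thesis using mN mNN dj by (auto simp: True span_def)
  next
    case False
    define W where "W = span \<mu> ns"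
    have IH: "matchable E W"
      "\<And>u v. u \<in> hd ns \<Longrightarrow> v \<in> \<mu> (last ns) \<Longrightarrow> matchable E (W - {u, v})"
      "\<And>v. v \<in> W \<Longrightarrow> (v \<notin> hd ns \<and> (\<forall>u\<in>hd ns. matchable E (W - {u, v}))) \<or>
         (v \<notin> \<mu> (last ns) \<and> (\<forall>u\<in>\<mu> (last ns). matchable E (W - {u, v})))"
      using Cons.IH[OF False] Cons.prems False unfolding W_def by (auto simp: successively_Cons)
    have W: "(N \<union> ?N') \<inter> W = {}"
    proof -
      have "(N \<union> ?N') \<inter> (K \<union> \<mu> K) = {}" if "K \<in> set ns" for K
        using Cons.prems(4)[of N K] Cons.prems(2) that by auto
      then show ?thesis unfolding W_def span_def by blast
    qed
    have hW: "hd ns \<subseteq> W" "\<mu> (last ns) \<subseteq> W" unfolding W_def span_def using hd_in_set[OF False] last_in_set[OF False] by blast+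
    have sp: "span \<mu> (N # ns) = (N \<union> ?N') \<union> W" by (simp add: W_def span_def)
    obtain a b where ab: "a \<in> ?N'" "b \<in> hd ns" "{a, b} \<in> E"
      using Cons.prems(5) False by (auto simp: successively_Cons linked_def)
    \<comment> \<open>With \<open>u\<close> removed from the first blob and \<open>v\<close> from
      the tail, the link \<open>ab\<close> joins the two parts: it covers the vertex
      \<open>a\<close> next to the tail and the entry \<open>b\<close> of the tail.\<close>
    have ext: "matchable E ((N \<union> ?N') \<union> W - {u, v})" if u: "u \<in> N" and v: "v \<in> W" "v \<noteq> b"
      and m: "matchable E (W - {b, v})" for u v
    proof -
      have "matchable E ((N \<union> ?N' - {u}) \<union> (W - {v}))"
      proof (rule matchable_link[of E _ a _ b])
        have diff2: "A - {x} - {z} = A - {x, z}" for A :: "'a set" and x z by blast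
        show "matchable E (N \<union> ?N' - {u} - {a})" unfolding diff2 by (rule mNN[OF u ab(1)])
        show "matchable E (W - {v} - {b})" unfolding diff2 using m by (simp only: insert_commute)
        show "a \<in> N \<union> ?N' - {u}" using ab dj u by auto
        show "b \<in> W - {v}" using ab hW v by auto
        show "(N \<union> ?N' - {u}) \<inter> (W - {v}) = {}" using W by auto
      qed (fact ab(3))
      moreover have "(N \<union> ?N' - {u}) \<union> (W - {v}) = (N \<union> ?N') \<union> W - {u, v}" using W u v by auto
      ultimately show ?thesis by simp
    qed
    have bL: "b \<in> hd ns" by (fact ab(2))
    have hL: "hd ns \<inter> \<mu> (last ns) = {}"
    proof (cases "hd ns = last ns")
      case True then show ?thesis using Cons.prems(3)[of "last ns"] False by auto
    next
      case F: False
      then show ?thesis using Cons.prems(4)[of "hd ns" "last ns"] False by auto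
    qed
    show ?thesis unfolding sp
    proof (intro conjI ballI)
      show "matchable E (N \<union> ?N' \<union> W)" by (rule matchable_Un[OF mN IH(1) W])
    next
      fix u v assume uv: "u \<in> hd (N # ns)" "v \<in> \<mu> (last (N # ns))"
      then have v: "v \<in> \<mu> (last ns)" using False by simp
      then show "matchable E (N \<union> ?N' \<union> W - {u, v})"
        using ext[of u v] IH(2)[OF bL v] hL hW bL uv by auto
    next
      fix v assume v: "v \<in> N \<union> ?N' \<union> W"
      have m1: "matchable E (N \<union> ?N' \<union> W - {u, v})" if "v \<in> ?N'" "u \<in> N" for u
      proof -
        have "matchable E ((N \<union> ?N' - {u, v}) \<union> W)"
          using matchable_Un[OF mNN[OF that(2,1)] IH(1)] W by auto
        moreover have "(N \<union> ?N' - {u, v}) \<union> W = N \<union> ?N' \<union> W - {u, v}" using W that by auto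
        ultimately show ?thesis by simp
      qed
      have m2: "matchable E (N \<union> ?N' \<union> W - {u, v})" if "v \<in> N" "u \<in> \<mu> (last ns)" for u
        using ext[of v u] IH(2)[OF bL that(2)] that hL hW bL by (auto simp: insert_commute)
      have m3: "matchable E (N \<union> ?N' \<union> W - {u, v})"
        if "v \<in> W" "v \<notin> \<mu> (last ns)" "matchable E (W - {u, v})" "u \<in> \<mu> (last ns)" for u
      proof -
        have "matchable E ((N \<union> ?N') \<union> (W - {u, v}))" using matchable_Un[OF mN that(3)] W by auto
        moreover have "(N \<union> ?N') \<union> (W - {u, v}) = N \<union> ?N' \<union> W - {u, v}"
          using W that hW by auto
        ultimately show ?thesis by simp
      qed
      have m4: "matchable E (N \<union> ?N' \<union> W - {u, v})"
        if "v \<in> W" "v \<notin> hd ns" "\<forall>u\<in>hd ns. matchable E (W - {u, v})" "u \<in> N" for u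
        using ext[of u v] that bL by auto
      have last: "last (N # ns) = last ns" using False by simp
      \<comment> \<open>A vertex of the first blob is removed together with one of the last, a
        vertex of its mate together with one of the first; for a vertex of the tail the induction
        hypothesis decides which end works.\<close>
      consider "v \<in> N" | "v \<in> ?N'" | "v \<in> W" using v by blast
      then show "v \<notin> hd (N # ns) \<and> (\<forall>u\<in>hd (N # ns). matchable E (N \<union> ?N' \<union> W - {u, v})) \<or>
         v \<notin> \<mu> (last (N # ns)) \<and> (\<forall>u\<in>\<mu> (last (N # ns)). matchable E (N \<union> ?N' \<union> W - {u, v}))"
      proof cases
        case 1 then show ?thesis unfolding last using m2 W hW by auto
      next
        case 2 then show ?thesis using m1 dj by auto
      next
        case 3
        then have "v \<notin> N" using W by auto
        then show ?thesis unfolding last using IH(3)[OF 3] m3[OF 3] m4[OF 3] by auto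
      qed
    qed
  qed
qed

text \<open>A blob behaves like a single vertex: \<open>M\<close> leaves it by exactly one edge, and
  factor-criticality allows any other of its vertices to become the one matched outwards.\<close>

definition blob :: "'a set set \<Rightarrow> 'a set \<Rightarrow> 'a set set \<Rightarrow> 'a set \<Rightarrow> bool" where
  "blob E V M K \<longleftrightarrow> K \<subseteq> V \<and> factor_critical E K \<and>
     (\<exists>k\<in>K. \<exists>l\<in>V - K. {k, l} \<in> M \<and> (\<forall>e\<in>M. e \<inter> K \<noteq> {} \<longrightarrow> e \<subseteq> K \<or> e = {k, l}))"

definition blob_partition :: "'a set set \<Rightarrow> 'a set \<Rightarrow> 'a set set \<Rightarrow> 'a set set \<Rightarrow> bool" where
  "blob_partition E V M P \<longleftrightarrow> \<Union>P = V \<and> (\<forall>K\<in>P. blob E V M K) \<and> (\<forall>K\<in>P. \<forall>L\<in>P. K \<noteq> L \<longrightarrow> K \<inter> L = {})"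

lemma singleton_blobs:
  assumes M: "pm_on E V M" and E: "\<And>e. e \<in> E \<Longrightarrow> \<exists>u v. e = {u, v} \<and> u \<noteq> v"
  shows "blob_partition E V M ((\<lambda>v. {v}) ` V)"
  unfolding blob_partition_def
proof (intro conjI ballI)
  fix K assume "K \<in> (\<lambda>v. {v}) ` V"
  then obtain k where k: "k \<in> V" "K = {k}" by blast
  obtain e where e: "e \<in> M" "k \<in> e" "\<And>e'. e' \<in> M \<Longrightarrow> k \<in> e' \<Longrightarrow> e' = e"
    using pm_onD(3)[OF M k(1)] by blast
  obtain u v where uv: "e = {u, v}" "u \<noteq> v" using E[of e] e pm_onD(1)[OF M] by blast
  obtain l where l: "e = {k, l}" "l \<noteq> k" using uv e(2) by (metis doubleton_eq_iff insertE singletonD)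
  have "l \<in> V" using pm_onD(2)[OF M e(1)] l by blast
  have "factor_critical E K" unfolding k factor_critical_def by (simp add: matchable_empty)
  moreover have "\<forall>d\<in>M. d \<inter> K \<noteq> {} \<longrightarrow> d \<subseteq> K \<or> d = {k, l}" using e(3) l(1) k(2) by blast
  moreover have "K \<subseteq> V" "k \<in> K" "l \<in> V - K" "{k, l} \<in> M" using k l e(1) \<open>l \<in> V\<close> by simp_all
  ultimately show "blob E V M K" unfolding blob_def by blast
qed auto

text \<open>In a partition of \<open>V\<close> into as few blobs as possible, the last blob \<open>L\<close> of a longest alternating path
  has no exit edge but its matching edge: any other exit edge would prolong the path, give a second
  perfect matching, or allow a segment of the path to be merged into one blob.\<close>

theorem Kotzig_unique_matching:
  assumes V: "finite V" "V \<noteq> {}" and M: "pm_on E V M"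
    and uniq: "\<And>N. pm_on E V N \<Longrightarrow> N = M"
    and E: "\<And>e. e \<in> E \<Longrightarrow> \<exists>u v. e = {u, v} \<and> u \<noteq> v \<and> u \<in> V \<and> v \<in> V"
  obtains L k l where "L \<subseteq> V" "k \<in> L" "l \<in> V - L" "{k, l} \<in> M"
    "\<And>e. e \<in> E \<Longrightarrow> e \<inter> L \<noteq> {} \<Longrightarrow> e \<subseteq> L \<or> e = {k, l}"
proof -
  have ex: "blob_partition E V M ((\<lambda>v. {v}) ` V)" by (rule singleton_blobs[OF M]) (use E in blast)
  \<comment> \<open>Fewest blobs: any merge of several blobs into one is a contradiction from here
    on.\<close>
  define P where "P = (ARG_MIN card P. blob_partition E V M P)"
  have P: "blob_partition E V M P" unfolding P_def using ex by (rule arg_min_natI)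
  have Pmin: "card P \<le> card Q" if "blob_partition E V M Q" for Q
    unfolding P_def using that by (rule arg_min_nat_le)
  have PV: "\<Union>P = V" and Pb: "\<And>K. K \<in> P \<Longrightarrow> blob E V M K"
    and Pd: "\<And>K L. K \<in> P \<Longrightarrow> L \<in> P \<Longrightarrow> K \<noteq> L \<Longrightarrow> K \<inter> L = {}"
    using P unfolding blob_partition_def by blast+
  have finP: "finite P" using PV V(1) by (metis finite_UnionD)
  have Pu: "K = L" if "K \<in> P" "L \<in> P" "x \<in> K" "x \<in> L" for K L x using Pd that by blast
  have Pfc: "factor_critical E K" if "K \<in> P" for K using Pb[OF that] by (simp add: blob_def)

  \<comment> \<open>The blob at the other end of the unique matching edge leaving \<open>K\<close>.
    This is a fixed-point-free involution on \<open>P\<close>, named \<open>\<mu>\<close>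
    below.\<close>
  define mate where "mate K L \<longleftrightarrow> K \<in> P \<and> L \<in> P \<and> K \<noteq> L \<and>
    (\<exists>k\<in>K. \<exists>l\<in>L. {k, l} \<in> M \<and> (\<forall>e\<in>M. e \<inter> K \<noteq> {} \<longrightarrow> e \<subseteq> K \<or> e = {k, l}))" for K L
  have mate_ex: "\<exists>L. mate K L" if K: "K \<in> P" for K
  proof -
    obtain k l where kl: "k \<in> K" "l \<in> V - K" "{k, l} \<in> M" "\<forall>e\<in>M. e \<inter> K \<noteq> {} \<longrightarrow> e \<subseteq> K \<or> e = {k, l}"
      using Pb[OF K] unfolding blob_def by blast
    obtain L where "L \<in> P" "l \<in> L" using kl PV by blast
    then show ?thesis unfolding mate_def using K kl by blast
  qed
  have mate_sym: "mate L K" if KL: "mate K L" for K L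
  proof -
    obtain k l where kl: "k \<in> K" "l \<in> L" "{k, l} \<in> M" and P: "K \<in> P" "L \<in> P" "K \<noteq> L"
      using KL unfolding mate_def by blast
    obtain l' k' where l': "l' \<in> L" "k' \<in> V - L" "{l', k'} \<in> M"
        "\<forall>e\<in>M. e \<inter> L \<noteq> {} \<longrightarrow> e \<subseteq> L \<or> e = {l', k'}"
      using Pb[OF P(2)] unfolding blob_def by blast
    have "k \<notin> L" using Pu[OF P(1,2) kl(1)] P by blast
    then have "{k, l} = {l', k'}" using bspec[OF l'(4) kl(3)] kl(2) by auto
    then have "k = k'" "l = l'" using \<open>k \<notin> L\<close> l'(1) by (auto simp: doubleton_eq_iff)
    then show ?thesis unfolding mate_def using kl P l' by blast
  qed
  have mate_uniq: "L = L'" if m: "mate K L" "mate K L'" for K L L'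
  proof -
    obtain k l where kl: "k \<in> K" "l \<in> L" "{k, l} \<in> M" "\<forall>e\<in>M. e \<inter> K \<noteq> {} \<longrightarrow> e \<subseteq> K \<or> e = {k, l}"
      and P: "K \<in> P" "L \<in> P" "K \<noteq> L" using m(1) unfolding mate_def by blast
    obtain k' l' where kl': "k' \<in> K" "l' \<in> L'" "{k', l'} \<in> M" and P': "L' \<in> P" "K \<noteq> L'"
      using m(2) unfolding mate_def by blast
    have "l' \<notin> K" using Pu[OF P(1) P'(1) _ kl'(2)] P' by blast
    then have "{k', l'} = {k, l}" using bspec[OF kl(4) kl'(3)] kl'(1) by auto
    then have "l = l'" using \<open>l' \<notin> K\<close> kl(1) by (auto simp: doubleton_eq_iff)
    then show ?thesis using Pu[OF P(2) P'(1) kl(2)] kl'(2) by blast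
  qed
  define \<mu> where "\<mu> K = (THE L. mate K L)" for K
  have mate_mu: "mate K L \<longleftrightarrow> L = \<mu> K" if "K \<in> P" for K L
    using theI'[of "mate K"] mate_ex[OF that] mate_uniq unfolding \<mu>_def by blast
  have mu: "\<mu> K \<in> P" "\<mu> K \<noteq> K" "\<mu> (\<mu> K) = K" if K: "K \<in> P" for K
  proof -
    have m: "mate K (\<mu> K)" using mate_mu[OF K] by blast
    then show "\<mu> K \<in> P" "\<mu> K \<noteq> K" unfolding mate_def by blast+
    then show "\<mu> (\<mu> K) = K" using mate_mu[of "\<mu> K" K] mate_sym[OF m] by blast
  qed
  have exitM: "\<exists>k\<in>K. \<exists>l\<in>\<mu> K. {k, l} \<in> M \<and> (\<forall>e\<in>M. e \<inter> K \<noteq> {} \<longrightarrow> e \<subseteq> K \<or> e = {k, l})"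
    if "K \<in> P" for K
    using mate_mu[OF that, of "\<mu> K"] unfolding mate_def by blast
  have ME: "M \<subseteq> E" by (rule pm_onD(1)[OF M])
  have pair_fact: "factor_critical E N \<and> factor_critical E (\<mu> N) \<and> linked E N (\<mu> N) \<and> N \<inter> \<mu> N = {}"
    if "N \<in> P" for N
    using Pfc[OF that] Pfc[OF mu(1)[OF that]] exitM[OF that] ME Pd[OF that mu(1)[OF that]] mu(2)[OF that]
    unfolding linked_def by blast

  \<comment> \<open>The list holds every other blob of the alternating path, the mates being
    understood. Keeping mates out of the list makes all blobs of the path disjoint; the length is at
    most \<open>card P\<close>, so a longest path exists.\<close>
  define path where "path ns \<longleftrightarrow> ns \<noteq> [] \<and> set ns \<subseteq> P \<and> distinct ns \<and> (\<forall>N\<in>set ns. \<mu> N \<notin> set ns) \<and>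
    successively (\<lambda>N N'. linked E (\<mu> N) N') ns" for ns
  obtain K0 where K0: "K0 \<in> P" using PV V(2) by blast
  have "path [K0]" unfolding path_def using K0 mu by simp
  moreover have "\<forall>ns. path ns \<longrightarrow> length ns < Suc (card P)"
  proof (intro allI impI)
    fix ns assume "path ns"
    then have "length ns = card (set ns)" "set ns \<subseteq> P"
      unfolding path_def by (simp_all add: distinct_card)
    then show "length ns < Suc (card P)" using card_mono[OF finP, of "set ns"] by simp
  qed
  ultimately obtain ns where ns: "path ns" and nsmax: "\<And>ns'. path ns' \<Longrightarrow> length ns' \<le> length ns"
    using ex_has_greatest_nat[of path "[K0]" length "Suc (card P)"] by blast
  have path_facts: "matchable E (span \<mu> xs)"
      "\<And>u v. u \<in> hd xs \<Longrightarrow> v \<in> \<mu> (last xs) \<Longrightarrow> matchable E (span \<mu> xs - {u, v})"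
      "\<And>v. v \<in> span \<mu> xs \<Longrightarrow> (v \<notin> hd xs \<and> (\<forall>u\<in>hd xs. matchable E (span \<mu> xs - {u, v}))) \<or>
         (v \<notin> \<mu> (last xs) \<and> (\<forall>u\<in>\<mu> (last xs). matchable E (span \<mu> xs - {u, v})))"
    if xs: "path xs" for xs
  proof -
    have disj: "(N \<union> \<mu> N) \<inter> (N' \<union> \<mu> N') = {}" if h: "N \<in> set xs" "N' \<in> set xs" "N \<noteq> N'" for N N'
    proof -
      have p: "N \<in> P" "N' \<in> P" "\<mu> N \<notin> set xs" "\<mu> N' \<notin> set xs" using h xs unfolding path_def by auto
      have ne: "N \<noteq> N'" "N \<noteq> \<mu> N'" "\<mu> N \<noteq> N'" using h p by auto
      have "\<mu> N \<noteq> \<mu> N'" using mu(3)[OF p(1)] mu(3)[OF p(2)] h(3) by metis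
      then show ?thesis
        using ne Pd[of N N'] Pd[of N "\<mu> N'"] Pd[of "\<mu> N" N'] Pd[of "\<mu> N" "\<mu> N'"]
          p(1,2) mu(1)[OF p(1)] mu(1)[OF p(2)] by (simp add: Int_Un_distrib Int_Un_distrib2)
    qed
    have "matchable E (span \<mu> xs) \<and>
    (\<forall>u\<in>hd xs. \<forall>v\<in>\<mu> (last xs). matchable E (span \<mu> xs - {u, v})) \<and>
    (\<forall>v\<in>span \<mu> xs. (v \<notin> hd xs \<and> (\<forall>u\<in>hd xs. matchable E (span \<mu> xs - {u, v}))) \<or>
       (v \<notin> \<mu> (last xs) \<and> (\<forall>u\<in>\<mu> (last xs). matchable E (span \<mu> xs - {u, v}))))"
    proof (rule alternating_path)
      show "factor_critical E N \<and> factor_critical E (\<mu> N) \<and> linked E N (\<mu> N) \<and> N \<inter> \<mu> N = {}"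
        if N: "N \<in> set xs" for N
        using pair_fact[of N] N xs unfolding path_def by blast
      show "(N \<union> \<mu> N) \<inter> (N' \<union> \<mu> N') = {}" if "N \<in> set xs" "N' \<in> set xs" "N \<noteq> N'" for N N'
        using disj that by blast
    qed (use xs path_def in blast)+
    then show "matchable E (span \<mu> xs)"
      "\<And>u v. u \<in> hd xs \<Longrightarrow> v \<in> \<mu> (last xs) \<Longrightarrow> matchable E (span \<mu> xs - {u, v})"
      "\<And>v. v \<in> span \<mu> xs \<Longrightarrow> (v \<notin> hd xs \<and> (\<forall>u\<in>hd xs. matchable E (span \<mu> xs - {u, v}))) \<or>
         (v \<notin> \<mu> (last xs) \<and> (\<forall>u\<in>\<mu> (last xs). matchable E (span \<mu> xs - {u, v})))"
      by blast+
  qed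
  have span_sub: "span \<mu> xs \<subseteq> V" if "set xs \<subseteq> P" for xs
    unfolding span_def using that mu(1) PV by blast
  \<comment> \<open>The only edge of \<open>M\<close> leaving a blob leads to its mate, which the
    span contains as well. Hence \<open>M\<close> can be exchanged inside the span alone.\<close>
  have span_closed: "e \<subseteq> span \<mu> xs \<or> e \<inter> span \<mu> xs = {}" if xs: "set xs \<subseteq> P" and e: "e \<in> M" for xs e
  proof (rule disjCI)
    assume "e \<inter> span \<mu> xs \<noteq> {}"
    then obtain x N where x: "x \<in> e" "N \<in> set xs" "x \<in> N \<union> \<mu> N" unfolding span_def by blast
    then have N: "N \<in> P" "N \<union> \<mu> N \<subseteq> span \<mu> xs" unfolding span_def using xs by blast+
    have "\<exists>K. K \<in> P \<and> e \<inter> K \<noteq> {} \<and> K \<union> \<mu> K \<subseteq> span \<mu> xs"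
    proof (cases "x \<in> N")
      case True then show ?thesis using N x(1) by blast
    next
      case False
      then have "x \<in> \<mu> N" using x(3) by blast
      then show ?thesis using N(2) mu(1)[OF N(1)] mu(3)[OF N(1)] x(1)
        by (intro exI[of _ "\<mu> N"]) auto
    qed
    then obtain K where K: "K \<in> P" "e \<inter> K \<noteq> {}" "K \<union> \<mu> K \<subseteq> span \<mu> xs" by blast
    then show "e \<subseteq> span \<mu> xs" using exitM[OF K(1)] e by blast
  qed
  have drop_path: "path (drop i ns)" if "i < length ns" for i
  proof -
    have "successively (\<lambda>N N'. linked E (\<mu> N) N') (take i ns @ drop i ns)"
      using ns unfolding path_def by simp
    then have "successively (\<lambda>N N'. linked E (\<mu> N) N') (drop i ns)"
      unfolding successively_append_iff by blast
    then show ?thesis using ns that set_drop_subset[of i ns] unfolding path_def by auto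
  qed
  define L where "L = \<mu> (last ns)"
  have lastP: "last ns \<in> P" "set ns \<subseteq> P" "ns \<noteq> []" using ns unfolding path_def by auto
  have LP: "L \<in> P" and muL: "\<mu> L = last ns" unfolding L_def using mu lastP by auto
  obtain k l where kl: "k \<in> L" "l \<in> \<mu> L" "{k, l} \<in> M" "\<forall>e\<in>M. e \<inter> L \<noteq> {} \<longrightarrow> e \<subseteq> L \<or> e = {k, l}"
    using exitM[OF LP] by blast
  have exits: "e \<subseteq> L \<or> e = {k, l}" if e: "e \<in> E" "e \<inter> L \<noteq> {}" for e
  proof (rule ccontr)
    assume not: "\<not> (e \<subseteq> L \<or> e = {k, l})"
    then have eM: "e \<notin> M" using kl(4) e by blast
    obtain u v where uv: "e = {u, v}" "u \<noteq> v" "u \<in> V" "v \<in> V" using E[OF e(1)] by blast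
    obtain x y where xy: "e = {y, x}" "x \<in> L" "y \<in> V - L"
    proof (cases "u \<in> L")
      case True then show ?thesis using that[of v u] uv not by (auto simp: insert_commute)
    next
      case False then show ?thesis using that[of u v] uv e by auto
    qed
    obtain X where X: "X \<in> P" "y \<in> X" using xy PV by blast
    have XL: "X \<noteq> L" using X xy by blast
    have "\<exists>i<length ns. X = ns ! i" if "X \<in> set ns" using that unfolding in_set_conv_nth by blast
    moreover have "\<exists>i<length ns. X = \<mu> (ns ! i)" if "X \<in> \<mu> ` set ns"
      using that unfolding image_iff in_set_conv_nth Bex_def by blast
    ultimately consider (path) i where "i < length ns" "X = ns ! i" | (mate) i where "i < length ns" "X = \<mu> (ns ! i)"
      | (new) "X \<notin> set ns" "X \<notin> \<mu> ` set ns" by blast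
    then show False
    proof cases
      case path
      \<comment> \<open>The segment from \<open>X\<close> to \<open>L\<close> is closed by
        \<open>e\<close> into an alternating cycle. Matching it with \<open>e\<close>, and the rest
        as in \<open>M\<close>, gives a perfect matching different from \<open>M\<close>.\<close>
      let ?xs = "drop i ns"
      have xs: "path ?xs" by (rule drop_path[OF path(1)])
      have hl: "hd ?xs = X" "last ?xs = last ns" using path by (simp_all add: hd_drop_conv_nth)
      have yx: "y \<in> hd ?xs" "x \<in> \<mu> (last ?xs)" using hl X xy L_def by auto
      obtain N where N: "pm_on E (span \<mu> ?xs - {y, x}) N"
        using path_facts(2)[OF xs yx] unfolding matchable_def by blast
      have sV: "set ?xs \<subseteq> P" using xs unfolding path_def by blast
      have ysp: "y \<in> span \<mu> ?xs" "x \<in> span \<mu> ?xs"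
        unfolding span_def using yx hd_in_set[of ?xs] last_in_set[of ?xs] xs unfolding path_def by blast+
      have "pm_on E ((span \<mu> ?xs - {y, x}) \<union> {y, x}) (N \<union> {e})"
        unfolding xy(1) by (rule pm_on_Un[OF N pm_on_edge]) (use e(1) xy in auto)
      moreover have "(span \<mu> ?xs - {y, x}) \<union> {y, x} = span \<mu> ?xs" using ysp by blast
      ultimately have "pm_on E (span \<mu> ?xs) (N \<union> {e})" by (simp only:)
      then have "pm_on E (span \<mu> ?xs \<union> (V - span \<mu> ?xs)) ((N \<union> {e}) \<union> {e \<in> M. e \<inter> span \<mu> ?xs = {}})"
        by (rule pm_on_Un[OF _ pm_on_part(2)[OF M span_sub[OF sV] span_closed[OF sV]]]) auto
      moreover have "span \<mu> ?xs \<union> (V - span \<mu> ?xs) = V" using span_sub[OF sV] by blast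
      ultimately have "pm_on E V ((N \<union> {e}) \<union> {e \<in> M. e \<inter> span \<mu> ?xs = {}})" by (simp only:)
      then have "(N \<union> {e}) \<union> {e \<in> M. e \<inter> span \<mu> ?xs = {}} = M" by (rule uniq)
      then show False using eM by blast
    next
      case new
      have "\<mu> X \<notin> set ns" using new(2) mu(3)[OF X(1)] by (metis imageI)
      moreover have "linked E (\<mu> (last ns)) X" unfolding linked_def
        using xy X e(1) L_def by (metis insert_commute)
      ultimately have "path (ns @ [X])"
        using ns new X(1) mu(2)[OF X(1)] unfolding path_def
        by (auto simp: successively_append_iff)
      then show False using nsmax by fastforce
    next
      case mate
      \<comment> \<open>Since \<open>X\<close> is not \<open>L\<close>, some path remains after
        \<open>X\<close>. This remainder is what gets merged with \<open>X\<close>.\<close>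
      have i: "Suc i < length ns"
      proof (rule ccontr)
        assume "\<not> Suc i < length ns"
        then have "i = length ns - 1" using mate(1) by linarith
        then have "ns ! i = last ns" using lastP(3) by (simp add: last_conv_nth)
        then show False using mate(2) XL L_def by simp
      qed
      let ?xs = "drop (Suc i) ns"
      let ?W = "span \<mu> ?xs"
      have xs: "path ?xs" by (rule drop_path[OF i])
      have sV: "set ?xs \<subseteq> P" and xne: "?xs \<noteq> []" using xs unfolding path_def by blast+
      have hl: "hd ?xs = ns ! Suc i" "last ?xs = last ns" using i by (simp_all add: hd_drop_conv_nth)
      have yx: "x \<in> \<mu> (last ?xs)" using hl xy L_def by auto
      have niP: "ns ! i \<in> P" using mate(1) lastP(2) by auto
      have muX: "\<mu> X = ns ! i" using mate(2) mu(3)[OF niP] by simp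
      have nin: "ns ! i \<notin> set ?xs"
      proof
        assume "ns ! i \<in> set ?xs"
        then obtain j where "j < length ?xs" "?xs ! j = ns ! i" by (auto simp: in_set_conv_nth)
        then have "ns ! (Suc i + j) = ns ! i" "Suc i + j < length ns" by auto
        then show False using ns mate(1) unfolding path_def by (auto simp: nth_eq_iff_index_eq)
      qed
      have Xns: "X \<notin> set ns" using ns mate nth_mem[OF mate(1)] unfolding path_def by blast
      have XnW: "Z \<notin> set ?xs" "Z \<notin> \<mu> ` set ?xs" if "Z = X \<or> Z = \<mu> X" for Z
      proof -
        have "X \<notin> set ?xs" using Xns by (meson in_set_dropD)
        moreover have "\<mu> X \<notin> set ?xs" using nin muX by simp
        moreover have "Q \<in> set ?xs \<Longrightarrow> \<mu> Q \<noteq> X" for Q using mu(3) sV \<open>\<mu> X \<notin> set ?xs\<close> by (metis subsetD)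
        moreover have "Q \<in> set ?xs \<Longrightarrow> \<mu> Q \<noteq> \<mu> X" for Q
          using mu(3) sV X(1) \<open>X \<notin> set ?xs\<close> by (metis subsetD)
        ultimately show "Z \<notin> set ?xs" "Z \<notin> \<mu> ` set ?xs" using that by auto
      qed
      have dW: "Z \<inter> ?W = {}" if Z: "Z \<in> P" "Z \<notin> set ?xs" "Z \<notin> \<mu> ` set ?xs" for Z
      proof -
        have "Z \<inter> (N \<union> \<mu> N) = {}" if "N \<in> set ?xs" for N
          using that Pd[OF Z(1), of N] Pd[OF Z(1), of "\<mu> N"] mu(1)[of N] sV Z by (auto simp: Int_Un_distrib)
        then show ?thesis unfolding span_def by blast
      qed
      have XW: "X \<inter> ?W = {}" "\<mu> X \<inter> ?W = {}" using dW[OF X(1) XnW] dW[OF mu(1)[OF X(1)] XnW] by simp_all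
      have "successively (\<lambda>N N'. linked E (\<mu> N) N') ns" using ns unfolding path_def by blast
      then have "linked E (\<mu> (ns ! i)) (ns ! Suc i)"
        using i unfolding successively_conv_nth by blast
      then obtain b w where bw: "b \<in> X" "w \<in> hd ?xs" "{b, w} \<in> E" using mate(2) hl unfolding linked_def by auto
      have hW: "hd ?xs \<subseteq> ?W" "\<mu> (last ?xs) \<subseteq> ?W"
        unfolding span_def using hd_in_set[OF xne] last_in_set[OF xne] by blast+
      have fcX: "matchable E (X - {v})" if "v \<in> X" for v
        using Pfc[OF X(1)] that unfolding factor_critical_def by blast
      \<comment> \<open>The segment hangs on \<open>X\<close> by links at both ends:
        \<open>bw\<close> at its start and \<open>e\<close> at its end. Whichever vertex of the
        segment is deleted, one of the two links completes a matching.\<close>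
      have fcn: "factor_critical E (X \<union> ?W)" unfolding factor_critical_def
      proof
        fix v assume "v \<in> X \<union> ?W"
        then consider "v \<in> X" | "v \<in> ?W" by blast
        then show "matchable E (X \<union> ?W - {v})"
        proof cases
          case 1
          have "matchable E ((X - {v}) \<union> ?W)"
            by (rule matchable_Un[OF fcX[OF 1] path_facts(1)[OF xs]]) (use XW in blast)
          moreover have "(X - {v}) \<union> ?W = X \<union> ?W - {v}" using 1 XW by blast
          ultimately show ?thesis by simp
        next
          case 2
          obtain c z where cz: "c \<in> X" "z \<in> ?W" "{c, z} \<in> E" "z \<noteq> v" "matchable E (?W - {z, v})"
          proof (cases "v \<notin> hd ?xs \<and> (\<forall>u\<in>hd ?xs. matchable E (?W - {u, v}))")
            case True then show ?thesis using that[of b w] bw hW by auto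
          next
            case False
            then have "v \<notin> \<mu> (last ?xs)" "\<forall>u\<in>\<mu> (last ?xs). matchable E (?W - {u, v})"
              using path_facts(3)[OF xs 2] by blast+
            then show ?thesis using that[of y x] yx hW X(2) e(1) xy(1) by auto
          qed
          have "matchable E (X \<union> (?W - {v}))"
            by (rule matchable_link[OF fcX[OF cz(1)] _ cz(3) cz(1)])
              (use cz XW in \<open>auto simp: Diff_insert2[symmetric] insert_commute\<close>)
          moreover have "X \<union> (?W - {v}) = X \<union> ?W - {v}" using 2 XW by blast
          ultimately show ?thesis by simp
        qed
      qed
      define P' where "P' = insert (X \<union> ?W) (P - insert X (set ?xs \<union> \<mu> ` set ?xs))"
      have rest: "Z \<inter> (X \<union> ?W) = {}" if "Z \<in> P - insert X (set ?xs \<union> \<mu> ` set ?xs)" for Z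
        using that dW[of Z] Pd[of Z X] X(1) by (simp add: Int_Un_distrib)
      \<comment> \<open>No edge of \<open>M\<close> leaves the segment, so the exit edge of
        \<open>X\<close> is the exit edge of the merged set.\<close>
      have bl: "blob E V M (X \<union> ?W)"
      proof -
        obtain q r where qr: "q \<in> X" "r \<in> \<mu> X" "{q, r} \<in> M" "\<forall>e\<in>M. e \<inter> X \<noteq> {} \<longrightarrow> e \<subseteq> X \<or> e = {q, r}"
          using exitM[OF X(1)] by blast
        have "r \<notin> X" using Pu[OF X(1) mu(1)[OF X(1)] _ qr(2)] mu(2)[OF X(1)] by blast
        then have "r \<in> V - (X \<union> ?W)" using qr(2) XW mu(1)[OF X(1)] PV by blast
        moreover have "d \<subseteq> X \<union> ?W \<or> d = {q, r}" if "d \<in> M" "d \<inter> (X \<union> ?W) \<noteq> {}" for d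
          using span_closed[OF sV that(1)] qr(4) that by blast
        moreover have "X \<union> ?W \<subseteq> V" using span_sub[OF sV] X(1) PV by blast
        ultimately show ?thesis unfolding blob_def using fcn qr by blast
      qed
      have "blob_partition E V M P'" unfolding blob_partition_def
      proof (intro conjI ballI impI)
        have un: "\<Union>(insert X (set ?xs \<union> \<mu> ` set ?xs)) = X \<union> ?W" unfolding span_def by blast
        have sub: "insert X (set ?xs \<union> \<mu> ` set ?xs) \<subseteq> P" using X(1) sV mu(1) by blast
        have "\<Union>(insert Z (P - R)) = \<Union>P" if "\<Union>R = Z" "R \<subseteq> P" for Z R using that by blast
        from this[OF un sub] show "\<Union>P' = V" unfolding P'_def PV .
        show "blob E V M K" if "K \<in> P'" for K using that bl Pb unfolding P'_def by blast
        show "K \<inter> K' = {}" if "K \<in> P'" "K' \<in> P'" "K \<noteq> K'" for K K'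
          using that rest Pd unfolding P'_def by blast
      qed
      then have "card P \<le> card P'" by (rule Pmin)
      \<comment> \<open>\<open>X\<close> and the first blob of the segment are distinct, so at least
        two blobs are replaced by one.\<close>
      moreover have "card P' < card P"
      proof -
        let ?R = "insert X (set ?xs \<union> \<mu> ` set ?xs)"
        have "?R \<subseteq> P" using X(1) sV mu(1) by blast
        moreover have "{X, hd ?xs} \<subseteq> ?R" using hd_in_set[OF xne] by blast
        moreover have "X \<noteq> hd ?xs" using XnW(1)[of X] hd_in_set[OF xne] by metis
        ultimately have R: "?R \<subseteq> P" "card ?R \<ge> 2"
          using card_mono[of ?R "{X, hd ?xs}"] finP by (auto simp: finite_subset)
        have "card P' \<le> Suc (card (P - ?R))" unfolding P'_def
          by (simp only: card_insert_if finite_Diff[OF finP] split: if_split) simp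
        also have "card (P - ?R) = card P - card ?R"
          by (rule card_Diff_subset) (use R finP finite_subset in blast)+
        finally show ?thesis using R(2) card_mono[OF finP R(1)] by linarith
      qed
      ultimately show False by simp
    qed
  qed
  have "last ns \<noteq> L" using mu(2)[OF LP] muL by simp
  moreover have "l \<in> last ns" using kl(2) muL by simp
  ultimately have "l \<in> V - L" using Pu[OF LP lastP(1), of l] lastP(1) PV by blast
  moreover have "L \<subseteq> V" using LP PV by blast
  ultimately show ?thesis using that[of L k l] kl(1,3) exits by blast
qed

section \<open>Perfect matchings under removal of an edge and under contraction\<close>

lemma pm_on_mono:
  assumes "pm_on E X N" "\<And>e. e \<in> E \<Longrightarrow> e \<subseteq> X \<Longrightarrow> e \<in> E'"
  shows "pm_on E' X N"
proof (rule pm_onI)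
  note a = pm_onD[OF assms(1)]
  show "N \<subseteq> E'" using assms(2) a(1,2) by blast
  show "e \<subseteq> X" if "e \<in> N" for e by (rule a(2)[OF that])
  show "\<exists>!e. e \<in> N \<and> v \<in> e" if "v \<in> X" for v by (rule a(3)[OF that])
qed

lemma pm_on_remove:
  assumes N: "pm_on E X N" and uv: "{u, v} \<in> N"
  shows "pm_on E (X - {u, v}) (N - {{u, v}})"
proof (rule pm_onI)
  note a = pm_onD[OF N]
  have un: "e = {u, v}" if "e \<in> N" "u \<in> e \<or> v \<in> e" for e
    using a(2)[OF uv] a(3)[of u] a(3)[of v] uv that by blast
  show "N - {{u, v}} \<subseteq> E" using a(1) by blast
  show "e \<subseteq> X - {u, v}" if "e \<in> N - {{u, v}}" for e using a(2)[of e] un[of e] that by blast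
  fix w assume w: "w \<in> X - {u, v}"
  then have "e \<in> N - {{u, v}} \<and> w \<in> e \<longleftrightarrow> e \<in> N \<and> w \<in> e" for e by blast
  then show "\<exists>!e. e \<in> N - {{u, v}} \<and> w \<in> e" using a(3)[of w] w by simp
qed

lemma pm_on_insert:
  assumes N: "pm_on E (X - {u, v}) N" and uv: "{u, v} \<in> E" "u \<in> X" "v \<in> X"
  shows "pm_on E X (insert {u, v} N)" "{u, v} \<notin> N"
proof -
  have "pm_on E ((X - {u, v}) \<union> {u, v}) (N \<union> {{u, v}})"
    by (rule pm_on_Un[OF N pm_on_edge[OF uv(1)]]) blast
  moreover have "(X - {u, v}) \<union> {u, v} = X" using uv by blast
  ultimately show "pm_on E X (insert {u, v} N)" by simp
  show "{u, v} \<notin> N" using pm_onD(2)[OF N] by blast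
qed

lemma contract_edge_in:
  assumes g: "graph G" and c: "c \<notin> verts G - S" and e: "e \<subseteq> verts G - S"
  shows "e \<in> edges (contract G S c) \<longleftrightarrow> e \<in> edges G"
proof
  assume h: "e \<in> edges (contract G S c)"
  obtain u w where uw: "e = {u, w}" using h graph_contract[OF g c] by (auto elim: graph_edgeE)
  then show "e \<in> edges G" using h edge_contract_outside[OF g c, of u w] e c by blast
next
  assume h: "e \<in> edges G"
  obtain u w where uw: "e = {u, w}" using h g by (auto elim: graph_edgeE)
  then show "e \<in> edges (contract G S c)" using h edge_contract_outside[OF g c, of u w] e c by blast
qed

lemma pm_on_contract:
  assumes "graph G" "c \<notin> verts G - S" "X \<subseteq> verts G - S"
  shows "pm_on (edges (contract G S c)) X N \<longleftrightarrow> pm_on (edges G) X N"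
  using contract_edge_in[OF assms(1,2)] assms(3)
  by (auto intro: pm_on_mono dest: order_trans)

subsection \<open>Contracting a triangle away from a lonely edge\<close>

text \<open>Loneliness with its witness named, because the triangle to be contracted is chosen with
  respect to this matching.\<close>

definition unique_pm :: "'a graph \<Rightarrow> 'a set \<Rightarrow> 'a set set \<Rightarrow> bool" where
  "unique_pm G e M \<longleftrightarrow> pm_on (edges G) (verts G) M \<and> e \<in> M \<and>
     (\<forall>N. pm_on (edges G) (verts G) N \<and> e \<in> N \<longrightarrow> N = M)"

lemma lonely_iff:
  assumes "graph G"
  shows "lonely G e \<longleftrightarrow> (\<exists>M. unique_pm G e M)"
proof -
  have "(\<exists>M. A = {M}) \<longleftrightarrow> (\<exists>M. M \<in> A \<and> (\<forall>N. N \<in> A \<longrightarrow> N = M))" for A :: "'a set set set"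
    by blast
  from this[of "{M. perfect_matching G M \<and> e \<in> M}"]
  have 1: "card {M. perfect_matching G M \<and> e \<in> M} = 1 \<longleftrightarrow> (\<exists>M. unique_pm G e M)"
    unfolding One_nat_def card_1_singleton_iff unique_pm_def perfect_matching_pm_on[OF assms]
    by simp
  have "e \<in> edges G" if "unique_pm G e M" for M
    using that pm_onD(1)[of "edges G" "verts G" M] unfolding unique_pm_def by blast
  then show ?thesis unfolding lonely_def 1 by (intro iffI conjI) (elim conjE exE, blast)+
qed

text \<open>\<open>A\<close> is one side of the bridge \<open>{k, l}\<close> of \<open>G - a - b\<close>.\<close>

definition side :: "'a graph \<Rightarrow> 'a \<Rightarrow> 'a \<Rightarrow> 'a set set \<Rightarrow> 'a set \<Rightarrow> 'a \<Rightarrow> 'a \<Rightarrow> bool" where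
  "side G a b M A k l \<longleftrightarrow> A \<subseteq> verts G - {a, b} \<and> k \<in> A \<and> l \<in> verts G - {a, b} - A \<and> {k, l} \<in> M \<and>
     (\<forall>u\<in>A. \<forall>w\<in>verts G - {a, b} - A. {u, w} \<in> edges G \<longrightarrow> u = k \<and> w = l)"

lemma side_compl: "side G a b M A k l \<Longrightarrow> side G a b M (verts G - {a, b} - A) l k"
proof -
  assume "side G a b M A k l"
  then have s: "A \<subseteq> verts G - {a, b}" "k \<in> A" "l \<in> verts G - {a, b} - A" "{k, l} \<in> M"
    "\<And>u w. u \<in> A \<Longrightarrow> w \<in> verts G - {a, b} - A \<Longrightarrow> {u, w} \<in> edges G \<Longrightarrow> u = k \<and> w = l"
    unfolding side_def by blast+
  have eq: "verts G - {a, b} - (verts G - {a, b} - A) = A" using s(1) by blast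
  have "{l, k} \<in> M" using s(4) by (simp add: insert_commute)
  moreover have "u = l \<and> w = k" if "u \<in> verts G - {a, b} - A" "w \<in> A" "{u, w} \<in> edges G" for u w
    using s(5)[of w u] that by (simp add: insert_commute)
  ultimately show ?thesis unfolding side_def eq using s(2,3) by blast
qed

lemma side_commute: "side G a b M A k l \<Longrightarrow> side G b a M A k l"
  unfolding side_def by (simp add: insert_commute)

text \<open>Loneliness of \<open>ab\<close> says that \<open>G - a - b\<close> has exactly one
  perfect matching, so Kotzig's theorem provides a set left by a single edge, and that edge belongs
  to the matching.\<close>

lemma side_exists:
  assumes G: "cubic3 G" and M: "unique_pm G {a, b} M"
  obtains A k l where "side G a b M A k l"
proof -
  note g = cubic3D(1)[OF G]
  define V where "V = verts G - {a, b}"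
  define E where "E = {e \<in> edges G. e \<inter> {a, b} = {}}"
  have Mp: "pm_on (edges G) (verts G) M" and ab: "{a, b} \<in> M"
    and un: "\<And>N. pm_on (edges G) (verts G) N \<Longrightarrow> {a, b} \<in> N \<Longrightarrow> N = M"
    using M unfolding unique_pm_def by blast+
  have abE: "{a, b} \<in> edges G" using ab pm_onD(1)[OF Mp] by blast
  have abV: "a \<in> verts G" "b \<in> verts G" using edge_verts[OF g abE] by auto
  have "pm_on (edges G) V (M - {{a, b}})" unfolding V_def by (rule pm_on_remove[OF Mp ab])
  then have M': "pm_on E V (M - {{a, b}})"
    by (rule pm_on_mono) (auto simp: E_def V_def)
  have uniq: "N = M - {{a, b}}" if N: "pm_on E V N" for N
  proof -
    have "pm_on (edges G) V N" by (rule pm_on_mono[OF N]) (auto simp: E_def)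
    note i = pm_on_insert[OF this[unfolded V_def] abE abV]
    then have "insert {a, b} N = M" using un by blast
    then show ?thesis using i(2) by blast
  qed
  have "card V \<ge> 2"
  proof -
    have "card V \<ge> card (verts G) - card {a, b}"
      unfolding V_def by (rule diff_card_le_card_Diff) simp
    then show ?thesis using cubic3D(3)[OF G] edge_verts[OF g abE] by simp
  qed
  then have V: "finite V" "V \<noteq> {}" using finite_verts[OF g] unfolding V_def by (simp, force)
  obtain A k l where A: "A \<subseteq> V" "k \<in> A" "l \<in> V - A" "{k, l} \<in> M - {{a, b}}"
    "\<And>e. e \<in> E \<Longrightarrow> e \<inter> A \<noteq> {} \<Longrightarrow> e \<subseteq> A \<or> e = {k, l}"
  proof (rule Kotzig_unique_matching[OF V M' uniq])
    fix e assume "e \<in> E"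
    then have e: "e \<in> edges G" "e \<inter> {a, b} = {}" by (auto simp: E_def)
    then show "\<exists>u v. e = {u, v} \<and> u \<noteq> v \<and> u \<in> V \<and> v \<in> V"
      using g unfolding V_def by (elim graph_edgeE) auto
  qed blast+
  have "u = k \<and> w = l" if "u \<in> A" "w \<in> V - A" "{u, w} \<in> edges G" for u w
  proof -
    have "{u, w} \<in> E" using that A(1) by (auto simp: E_def V_def)
    then have "{u, w} = {k, l}" using A(5)[of "{u, w}"] that by blast
    then show ?thesis using that A(2,3) by (auto simp: doubleton_eq_iff)
  qed
  then have "side G a b M A k l" using A(1-4) unfolding side_def V_def by blast
  then show ?thesis by (rule that)
qed

text \<open>Without a neighbour of \<open>a\<close>, the rest of \<open>A\<close> would be cut off
  by \<open>b\<close> and \<open>k\<close>. If \<open>A\<close> is just \<open>k\<close>, its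
  neighbours would be \<open>b\<close> and \<open>l\<close> only, contrary to degree 3.\<close>

lemma side_port_nonempty:
  assumes G: "cubic3 G" and ab: "{a, b} \<in> edges G" and s: "side G a b M A k l"
  shows "nbrs G a \<inter> A \<noteq> {}"
proof
  assume e: "nbrs G a \<inter> A = {}"
  note g = cubic3D(1)[OF G]
  have A: "A \<subseteq> verts G - {a, b}" "k \<in> A" "l \<in> verts G - {a, b} - A"
    and x: "\<And>u w. u \<in> A \<Longrightarrow> w \<in> verts G - {a, b} - A \<Longrightarrow> {u, w} \<in> edges G \<Longrightarrow> u = k \<and> w = l"
    using s unfolding side_def by blast+
  have n: "nbrs G u \<subseteq> A \<union> {b} \<union> (if u = k then {l} else {})" if u: "u \<in> A" for u
  proof
    fix w assume w: "w \<in> nbrs G u"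
    have "w \<noteq> a" using e u w nbrs_sym[of w G u] by blast
    moreover have "w \<in> verts G" using w nbrs_sub[OF g] by blast
    moreover have "u = k \<and> w = l" if "w \<in> verts G - {a, b} - A"
      using x[OF u that] w by (simp add: nbrs_def)
    ultimately show "w \<in> A \<union> {b} \<union> (if u = k then {l} else {})" by auto
  qed
  show False
  proof (cases "A = {k}")
    case True
    then have "nbrs G k \<subseteq> {b, l}" using n[of k] nbrs_sub[OF g, of k] by auto
    then have "card (nbrs G k) \<le> 2" using card_mono[of "{b, l}" "nbrs G k"]
      by (simp add: card_insert_if split: if_splits)
    moreover have "k \<in> verts G" using A by blast
    ultimately show False using cubic3D(2)[OF G] by fastforce
  next
    case False
    have "A - {k} = verts G - {b, k}"
    proof (rule cubic3_conn[OF G])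
      show "{b, k} \<subseteq> verts G" using A edge_verts[OF g ab] by auto
      show "card {b, k} \<le> 2" by (simp add: card_insert_if)
      show "A - {k} \<subseteq> verts G - {b, k}" using A by auto
      show "A - {k} \<noteq> {}" using False A by blast
      show "nbrs G u \<subseteq> {b, k} \<union> (A - {k})" if "u \<in> A - {k}" for u using n[of u] that by auto
    qed
    then show False using A by blast
  qed
qed

text \<open>Besides \<open>b\<close>, the vertex \<open>a\<close> has two neighbours, and each of
  the two sides gets at least one.\<close>

lemma side_port:
  assumes G: "cubic3 G" and ab: "{a, b} \<in> edges G" and s: "side G a b M A k l"
  obtains p where "nbrs G a \<inter> A = {p}"
proof -
  note g = cubic3D(1)[OF G]
  define B where "B = verts G - {a, b} - A"
  have A: "A \<subseteq> verts G - {a, b}" using s unfolding side_def by blast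
  have ne: "nbrs G a \<inter> A \<noteq> {}" "nbrs G a \<inter> B \<noteq> {}"
    using side_port_nonempty[OF G ab s] side_port_nonempty[OF G ab side_compl[OF s]]
    unfolding B_def by blast+
  have f: "finite (nbrs G a)" by (rule finite_nbrs[OF g])
  have av: "a \<in> verts G" "b \<noteq> a" using edge_verts[OF g ab] by auto
  have "nbrs G a = {b} \<union> ((nbrs G a \<inter> A) \<union> (nbrs G a \<inter> B))"
    using nbrs_sub[OF g, of a] ab by (auto simp: B_def nbrs_def)
  then have "card (nbrs G a) = card ({b} \<union> ((nbrs G a \<inter> A) \<union> (nbrs G a \<inter> B)))" by simp
  also have "\<dots> = 1 + card ((nbrs G a \<inter> A) \<union> (nbrs G a \<inter> B))"
    using f A by (subst card_Un_disjoint) (auto simp: B_def)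
  also have "card ((nbrs G a \<inter> A) \<union> (nbrs G a \<inter> B)) = card (nbrs G a \<inter> A) + card (nbrs G a \<inter> B)"
    using f by (subst card_Un_disjoint) (auto simp: B_def)
  finally have "card (nbrs G a \<inter> A) + card (nbrs G a \<inter> B) = 2"
    using cubic3D(2)[OF G av(1)] by simp
  moreover have "card (nbrs G a \<inter> A) \<ge> 1" "card (nbrs G a \<inter> B) \<ge> 1"
    using ne f by (simp_all add: Suc_le_eq card_gt_0_iff)
  ultimately have "card (nbrs G a \<inter> A) = 1" by linarith
  then show ?thesis using that by (auto simp: card_1_singleton_iff)
qed

text \<open>Exactly three edges leave \<open>A\<close>, namely \<open>kl\<close> and the edges at
  \<open>a\<close> and \<open>b\<close>, so its complement can be contracted to \<open>a\<close> and
  \<open>kl\<close> becomes \<open>ak\<close>. That edge is lonely again, since a matching of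
  \<open>A - {k}\<close> extends by the outer part of \<open>M\<close> to one of \<open>G\<close>
  through \<open>ab\<close>.\<close>

lemma side_contract:
  assumes G: "cubic3 G" and M: "unique_pm G {a, b} M" and s: "side G a b M A k l"
    and Ak: "A \<noteq> {k}"
  obtains p q where "distinct [k, p, q]" "{p, q} \<subseteq> A"
    "cubic3 (contract G (verts G - A) a)"
    "unique_pm (contract G (verts G - A) a) {a, k} (insert {a, k} {e \<in> M. e \<subseteq> A - {k}})"
    "pm_on (edges G) (A - {k}) {e \<in> M. e \<subseteq> A - {k}}"
proof -
  let ?C = "contract G (verts G - A) a"
  note g = cubic3D(1)[OF G]
  have Mp: "pm_on (edges G) (verts G) M" and abM: "{a, b} \<in> M"
    and un: "\<And>N. pm_on (edges G) (verts G) N \<Longrightarrow> {a, b} \<in> N \<Longrightarrow> N = M"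
    using M unfolding unique_pm_def by blast+
  have ab: "{a, b} \<in> edges G" using abM pm_onD(1)[OF Mp] by blast
  have ba: "{b, a} \<in> edges G" using ab by (simp add: insert_commute)
  have abv: "a \<in> verts G" "b \<in> verts G" "a \<noteq> b" using edge_verts[OF g ab] by auto
  have A: "A \<subseteq> verts G - {a, b}" "k \<in> A" "l \<in> verts G - {a, b} - A" "{k, l} \<in> M"
    and x: "\<And>u w. u \<in> A \<Longrightarrow> w \<in> verts G - {a, b} - A \<Longrightarrow> {u, w} \<in> edges G \<Longrightarrow> u = k \<and> w = l"
    using s unfolding side_def by blast+
  obtain p where p: "nbrs G a \<inter> A = {p}" using side_port[OF G ab s] by blast
  obtain q where q: "nbrs G b \<inter> A = {q}" using side_port[OF G ba side_commute[OF s]] by blast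
  have kl: "{k, l} \<in> edges G" using A(4) pm_onD(1)[OF Mp] by blast
  have pqA: "p \<in> A" "q \<in> A" using p q by blast+
  have ua: "{u, a} \<in> edges G \<longleftrightarrow> u = p" and ub: "{u, b} \<in> edges G \<longleftrightarrow> u = q" if "u \<in> A" for u
    using p q that by (auto simp: nbrs_def insert_commute)
  have exits: "{u, w} \<in> edges G \<longleftrightarrow> (u, w) \<in> {(k, l), (p, a), (q, b)}"
    if u: "u \<in> A" and w: "w \<in> verts G - A" for u w
  proof -
    consider "w = a" | "w = b" | "w \<in> verts G - {a, b} - A" using w by blast
    then show ?thesis
    proof cases
      case 1 then show ?thesis using ua[OF u] A(3) abv by auto
    next
      case 2 then show ?thesis using ub[OF u] A(3) abv by auto
    next
      case 3 then show ?thesis using x[OF u 3] kl by auto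
    qed
  qed
  have n: "nbrs G u \<subseteq> A \<union> {w. (u, w) \<in> {(k, l), (p, a), (q, b)}}" if u: "u \<in> A" for u
    using exits[OF u] nbrs_sub[OF g, of u] unfolding nbrs_def by blast
  \<comment> \<open>Two vertices of \<open>A\<close> that include all three ends would separate the
    rest of \<open>A\<close>. So if two ends coincide, \<open>A\<close> has at most two vertices,
    and one of them has too few neighbours.\<close>
  have sub2: "A \<subseteq> {c, d}" if cd: "c \<in> A" "d \<in> A" "k \<in> {c, d}" "p \<in> {c, d}" "q \<in> {c, d}" for c d
  proof (rule ccontr)
    assume "\<not> A \<subseteq> {c, d}"
    then have ne: "A - {c, d} \<noteq> {}" by blast
    have "A - {c, d} = verts G - {c, d}"
    proof (rule cubic3_conn[OF G _ _ _ ne])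
      show "{c, d} \<subseteq> verts G" using A cd by blast
      show "card {c, d} \<le> 2" by (simp add: card_insert_if)
      show "A - {c, d} \<subseteq> verts G - {c, d}" using A by blast
      show "nbrs G u \<subseteq> {c, d} \<union> (A - {c, d})" if u: "u \<in> A - {c, d}" for u
        using n[of u] u cd by blast
    qed
    then show False using A cd abv by blast
  qed
  have deg: False if "u \<in> A" "nbrs G u \<subseteq> {c, d}" for u c d
  proof -
    have "card (nbrs G u) \<le> card {c, d}" by (rule card_mono) (use that in auto)
    also have "\<dots> \<le> 2" by (simp add: card_insert_if)
    moreover have "u \<in> verts G" using A that by blast
    ultimately show False using cubic3D(2)[OF G] by fastforce
  qed
  have noself: "u \<notin> nbrs G u" for u using nbrs_sub[OF g, of u] by blast
  have "p \<noteq> q"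
  proof
    assume pq: "p = q"
    have A2: "A \<subseteq> {k, p}" using sub2[of k p] A(2) pqA pq by blast
    then have "k \<noteq> p" using Ak A(2) by blast
    then have "nbrs G k \<subseteq> {l, p}" using n[OF A(2)] A2 noself[of k] pq by auto
    then show False using deg[OF A(2)] by blast
  qed
  moreover have "k \<noteq> p"
  proof
    assume kp: "k = p"
    have A2: "A \<subseteq> {k, q}" using sub2[of k q] A(2) pqA kp by blast
    then have "k \<noteq> q" using Ak A(2) by blast
    then have "nbrs G q \<subseteq> {b, k}" using n[OF pqA(2)] A2 noself[of q] kp by auto
    then show False using deg[OF pqA(2)] by blast
  qed
  moreover have "k \<noteq> q"
  proof
    assume kq: "k = q"
    have A2: "A \<subseteq> {k, p}" using sub2[of k p] A(2) pqA kq by blast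
    then have "k \<noteq> p" using Ak A(2) by blast
    then have "nbrs G p \<subseteq> {a, k}" using n[OF pqA(1)] A2 noself[of p] kq by auto
    then show False using deg[OF pqA(1)] by blast
  qed
  ultimately have dist: "distinct [k, p, q]" by simp
  have VA: "verts G - (verts G - A) = A" using A by blast
  have c: "a \<notin> verts G - (verts G - A)" using A VA by blast
  have C: "cubic3 ?C"
  proof (rule cubic3_contract[OF G _ c dist, of l a b])
    show "verts G - A \<subseteq> verts G" by blast
    show "{k, p, q} \<subseteq> verts G - (verts G - A)" unfolding VA using A(2) pqA by blast
    show "{l, a, b} \<subseteq> verts G - A" using A abv by blast
    show "({u, w} \<in> edges G) = ((u, w) \<in> {(k, l), (p, a), (q, b)})"
      if "u \<in> verts G - (verts G - A)" "w \<in> verts G - A" for u w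
      using exits that unfolding VA by blast
  qed
  have vC: "verts ?C = insert a A" using VA by simp
  have akC: "{a, k} \<in> edges ?C"
  proof -
    have lk: "{l, k} \<in> edges G" using kl by (simp add: insert_commute)
    show ?thesis unfolding edge_contract_iff[OF g]
      by (rule exI[of _ l], rule exI[of _ k]) (use A lk in auto)
  qed
  have Mu: "e = d" if "e \<in> M" "d \<in> M" "z \<in> e" "z \<in> d" for e d z
    using pm_onD(2)[OF Mp that(1)] pm_onD(3)[OF Mp, of z] that by blast
  \<comment> \<open>The three edges leaving \<open>A\<close> end in \<open>l\<close>,
    \<open>a\<close> and \<open>b\<close>, which \<open>M\<close> already covers by
    \<open>kl\<close> and \<open>ab\<close>.\<close>
  have cl: "e \<subseteq> A - {k} \<or> e \<inter> (A - {k}) = {}" if e: "e \<in> M" for e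
  proof (rule disjCI)
    assume "e \<inter> (A - {k}) \<noteq> {}"
    then obtain u where u: "u \<in> e" "u \<in> A" "u \<noteq> k" by blast
    have eE: "e \<in> edges G" using e pm_onD(1)[OF Mp] by blast
    obtain w where w: "e = {u, w}" using edge_in_iff[OF g eE u(1)] by blast
    have wv: "w \<in> verts G" using edge_verts[OF g] eE w by blast
    have "u \<noteq> a" "u \<noteq> b" "u \<noteq> l" using u A by blast+
    then have "w \<noteq> k" "w \<noteq> a" "w \<noteq> b" "w \<noteq> l"
      using Mu[OF e A(4), of k] Mu[OF e A(4), of l] Mu[OF e abM, of a] Mu[OF e abM, of b] w u(1,3) by auto
    then have "w \<in> A" using exits[OF u(2), of w] wv eE w by auto
    then show "e \<subseteq> A - {k}" using w u \<open>w \<noteq> k\<close> by blast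
  qed
  have AkV: "A - {k} \<subseteq> verts G" using A by blast
  note parts = pm_on_part[OF Mp AkV cl]
  have Ak_eq: "insert a A - {a, k} = A - {k}" using A by blast
  have pmC: "pm_on (edges ?C) X N \<longleftrightarrow> pm_on (edges G) X N" if "X \<subseteq> A" for X N
    by (rule pm_on_contract[OF g c]) (use that VA in blast)
  have uC: "unique_pm ?C {a, k} (insert {a, k} {e \<in> M. e \<subseteq> A - {k}})"
    unfolding unique_pm_def vC
  proof (intro conjI allI impI)
    have p1: "pm_on (edges ?C) (insert a A - {a, k}) {e \<in> M. e \<subseteq> A - {k}}"
      unfolding Ak_eq by (subst pmC) (use parts(1) in auto)
    show "pm_on (edges ?C) (insert a A) (insert {a, k} {e \<in> M. e \<subseteq> A - {k}})"
      by (rule pm_on_insert(1)[OF p1 akC]) (use A in auto)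
    show "{a, k} \<in> insert {a, k} {e \<in> M. e \<subseteq> A - {k}}" by simp
    fix N assume N: "pm_on (edges ?C) (insert a A) N \<and> {a, k} \<in> N"
    then have "pm_on (edges ?C) (A - {k}) (N - {{a, k}})"
      using pm_on_remove[of "edges ?C" "insert a A" N a k] Ak_eq by simp
    then have N1: "pm_on (edges G) (A - {k}) (N - {{a, k}})" by (subst (asm) pmC) auto
    \<comment> \<open>The part of \<open>M\<close> that completes any competitor \<open>N\<close> to
      a perfect matching of \<open>G\<close> through \<open>ab\<close>, hence to \<open>M\<close>
      itself.\<close>
    define M1 where "M1 = {e \<in> M. e \<inter> (A - {k}) = {}}"
    have "pm_on (edges G) ((A - {k}) \<union> (verts G - (A - {k}))) ((N - {{a, k}}) \<union> M1)"
      unfolding M1_def by (rule pm_on_Un[OF N1 parts(2) Diff_disjoint])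
    moreover have "(A - {k}) \<union> (verts G - (A - {k})) = verts G" using AkV by blast
    moreover have "{a, b} \<in> M1" unfolding M1_def using abM A by blast
    ultimately have eq: "(N - {{a, k}}) \<union> M1 = M" using un[of "(N - {{a, k}}) \<union> M1"] by simp
    have "N - {{a, k}} = {e \<in> M. e \<subseteq> A - {k}}"
    proof
      show "N - {{a, k}} \<subseteq> {e \<in> M. e \<subseteq> A - {k}}" using eq pm_onD(2)[OF N1] by blast
      show "{e \<in> M. e \<subseteq> A - {k}} \<subseteq> N - {{a, k}}"
      proof
        fix e assume e: "e \<in> {e \<in> M. e \<subseteq> A - {k}}"
        then have "e \<in> edges G" using pm_onD(1)[OF Mp] by blast
        then have "e \<noteq> {}" using g by (auto elim: graph_edgeE)
        then have "e \<notin> M1" using e unfolding M1_def by blast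
        then show "e \<in> N - {{a, k}}" using e eq by blast
      qed
    qed
    then show "N = insert {a, k} {e \<in> M. e \<subseteq> A - {k}}" using N by blast
  qed
  show ?thesis by (rule that[OF dist _ C uC parts(1)]) (use pqA in blast)
qed

text \<open>Induction by passing to the contracted side: a triangle found there avoids the
  contracted vertex, so it is a triangle of \<open>G\<close>. The recursion ends when the contracted
  side is \<open>K4\<close>, that is, when \<open>A\<close> is itself a triangle.\<close>

lemma good_triangle:
  assumes "cubic3 G" "unique_pm G {a, b} M" "card (verts G) \<ge> 5"
  shows "\<exists>y1 y2 y3. {y1, y2, y3} \<subseteq> verts G - {a, b} \<and> {y1, y2} \<in> edges G \<and> {y2, y3} \<in> edges G \<and>
    {y1, y3} \<in> edges G \<and> {y1, y2} \<in> M"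
  using assms
proof (induction "card (verts G)" arbitrary: G a b M rule: less_induct)
  case less
  note G = less.prems(1) and M = less.prems(2)
  note g = cubic3D(1)[OF G]
  have abM: "{a, b} \<in> M" and Mp: "pm_on (edges G) (verts G) M" using M unfolding unique_pm_def by blast+
  have abv: "a \<in> verts G" "b \<in> verts G" "a \<noteq> b"
    using edge_verts[OF g, of a b] abM pm_onD(1)[OF Mp] by blast+
  have key: ?case if s: "side G a b M A k l" and Ak: "A \<noteq> {k}" for A k l
  proof -
    let ?C = "contract G (verts G - A) a"
    obtain p q where pq: "distinct [k, p, q]" "{p, q} \<subseteq> A" and C: "cubic3 ?C"
      and uC: "unique_pm ?C {a, k} (insert {a, k} {e \<in> M. e \<subseteq> A - {k}})"
      and pm: "pm_on (edges G) (A - {k}) {e \<in> M. e \<subseteq> A - {k}}"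
      using side_contract[OF G M s Ak] by blast
    have A: "A \<subseteq> verts G - {a, b}" "k \<in> A" using s unfolding side_def by blast+
    have VA: "verts G - (verts G - A) = A" using A by blast
    have c: "a \<notin> verts G - (verts G - A)" using A VA by blast
    have vC: "verts ?C = insert a A" using VA by simp
    have finA: "finite A" using A finite_verts[OF g] finite_subset by blast
    have EC: "e \<in> edges ?C \<longleftrightarrow> e \<in> edges G" if "e \<subseteq> A" for e
      by (rule contract_edge_in[OF g c]) (use that VA in blast)
    show ?case
    proof (cases "card (verts ?C) \<ge> 5")
      case True
      have "insert a A \<subseteq> verts G" "b \<notin> insert a A" using A abv by blast+
      then have "verts ?C \<subset> verts G" unfolding vC using abv(2) by blast
      then have "card (verts ?C) < card (verts G)" using finite_verts[OF g] by (rule psubset_card_mono[rotated])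
      then obtain y1 y2 y3 where y: "{y1, y2, y3} \<subseteq> verts ?C - {a, k}"
          "{y1, y2} \<in> edges ?C" "{y2, y3} \<in> edges ?C" "{y1, y3} \<in> edges ?C"
          "{y1, y2} \<in> insert {a, k} {e \<in> M. e \<subseteq> A - {k}}"
        using less.hyps[OF _ C uC True] by blast
      \<comment> \<open>The triangle avoids \<open>a\<close>, so its matching edge is not the new
        edge \<open>ak\<close> and comes from \<open>M\<close>.\<close>
      have yA: "y1 \<in> A" "y2 \<in> A" "y3 \<in> A" "y1 \<noteq> a" "y2 \<noteq> a" using y(1) unfolding vC by auto
      then have "{y1, y2} \<in> M" using y(5) by (auto simp: doubleton_eq_iff)
      moreover have "{y1, y2} \<in> edges G" "{y2, y3} \<in> edges G" "{y1, y3} \<in> edges G"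
        using EC y(2-4) yA by simp_all
      ultimately show ?thesis using yA A(1) by blast
    next
      case False
      then have "card (insert a A) = 4" using cubic3D(3)[OF C] unfolding vC by simp
      then have "card A = 3" using finA A by (simp add: card_insert_if split: if_splits) blast
      moreover have "card {k, p, q} = 3" using pq(1) by simp
      \<comment> \<open>The vertex \<open>k\<close> is matched outwards, so the remaining matching
        of \<open>A\<close> can only be the edge \<open>pq\<close>.\<close>
      ultimately have AA: "A = {k, p, q}" using pq(2) A(2) finA card_seteq[OF finA, of "{k, p, q}"] by simp
      have full: "{u, w} \<in> edges G" if uw: "u \<in> A" "w \<in> A" "u \<noteq> w" for u w
      proof -
        have "nbrs ?C u \<subseteq> insert a A - {u}" using nbrs_sub[OF cubic3D(1)[OF C], of u] vC by simp
        moreover have "card (insert a A - {u}) = 3" using \<open>card (insert a A) = 4\<close> uw finA by simp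
        moreover have "card (nbrs ?C u) = 3" using cubic3D(2)[OF C, of u] uw(1) unfolding vC by blast
        ultimately have "nbrs ?C u = insert a A - {u}" using finA card_subset_eq[of "insert a A - {u}"] by simp
        then have "{u, w} \<in> edges ?C" using uw unfolding nbrs_def by blast
        then show ?thesis using EC uw by simp
      qed
      have "A - {k} = {p, q}" using AA pq(1) by auto
      then obtain e where e: "e \<in> M" "e \<subseteq> {p, q}" "p \<in> e" using pm_onD(3)[OF pm, of p] by auto
      have "e \<in> edges G" using e pm_onD(1)[OF Mp] by blast
      then obtain w where "e = {p, w}" "w \<noteq> p" using edge_in_iff[OF g _ e(3)] edge_verts[OF g] by blast
      then have "{p, q} \<in> M" using e by auto
      moreover have "{p, q} \<in> edges G" "{q, k} \<in> edges G" "{p, k} \<in> edges G" using full[of p q] full[of q k] full[of p k] AA pq(1) by auto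
      moreover have "{p, q, k} \<subseteq> verts G - {a, b}" using A pq(2) by blast
      ultimately show ?thesis by blast
    qed
  qed
  obtain A k l where s: "side G a b M A k l" using side_exists[OF G M] by blast
  show ?case
  proof (cases "A = {k}")
    case False then show ?thesis using key[OF s] by blast
  next
    case True
    \<comment> \<open>With five vertices the two sides cannot both be singletons, so the opposite
      side serves instead.\<close>
    have "verts G - {a, b} - A \<noteq> {l}"
    proof
      assume "verts G - {a, b} - A = {l}"
      then have "verts G \<subseteq> {a, b, k, l}" using True by blast
      then have "card (verts G) \<le> card {a, b, k, l}" by (rule card_mono[rotated]) simp
      also have "\<dots> \<le> 4" by (simp add: card_insert_if)
      finally show False using less.prems(3) by simp
    qed
    then show ?thesis using key[OF side_compl[OF s]] by blast
  qed
qed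

text \<open>The edge at \<open>c\<close> becomes the outer edge at one triangle vertex, and the
  other two triangle vertices are matched with each other. \<open>tri_drop_pm\<close> goes back, and
  needs the triangle edge in the matching.\<close>

lemma tri_lift_pm:
  assumes t: "tri G y1 y2 y3 o1 o2 o3" and c: "c \<notin> verts G - {y1, y2, y3}"
    and N: "pm_on (edges (contract G {y1, y2, y3} c)) (verts (contract G {y1, y2, y3} c)) N"
      "{c, o1} \<in> N"
  shows "pm_on (edges G) (verts G) (insert {y1, o1} (insert {y2, y3} (N - {{c, o1}})))"
proof -
  let ?Y = "{y1, y2, y3}" let ?C = "contract G ?Y c"
  note g = triD(1)[OF t] and d = tri_neq[OF t] and YV = triD(6)[OF t] and oV = triD(7)[OF t]
  have eq: "verts ?C - {c, o1} = verts G - {y1, o1} - {y2, y3}" using c by auto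
  have "pm_on (edges ?C) (verts G - {y1, o1} - {y2, y3}) (N - {{c, o1}})"
    using pm_on_remove[OF N] unfolding eq .
  then have "pm_on (edges G) (verts G - {y1, o1} - {y2, y3}) (N - {{c, o1}})"
    by (subst (asm) pm_on_contract[OF g c]) auto
  then have "pm_on (edges G) (verts G - {y1, o1}) (insert {y2, y3} (N - {{c, o1}}))"
    by (rule pm_on_insert(1)[OF _ triD(9)[OF t]]) (use YV d in auto)
  then show ?thesis
    by (rule pm_on_insert(1)[OF _ triD(11)[OF t]]) (use YV oV in auto)
qed

lemma tri_drop_pm:
  assumes t: "tri G y1 y2 y3 o1 o2 o3" and c: "c \<notin> verts G - {y1, y2, y3}"
    and M: "pm_on (edges G) (verts G) M" "{y1, o1} \<in> M" "{y2, y3} \<in> M"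
  shows "pm_on (edges (contract G {y1, y2, y3} c)) (verts (contract G {y1, y2, y3} c))
    (insert {c, o1} (M - {{y1, o1}} - {{y2, y3}}))"
proof -
  let ?Y = "{y1, y2, y3}" let ?C = "contract G ?Y c"
  note g = triD(1)[OF t] and d = tri_neq[OF t] and oV = triD(7)[OF t]
  have eq: "verts ?C - {c, o1} = verts G - {y1, o1} - {y2, y3}" using c by auto
  have "{y2, y3} \<in> M - {{y1, o1}}" using M(3) d by (auto simp: doubleton_eq_iff)
  then have "pm_on (edges G) (verts G - {y1, o1} - {y2, y3}) (M - {{y1, o1}} - {{y2, y3}})"
    using pm_on_remove[OF pm_on_remove[OF M(1,2)]] by blast
  then have "pm_on (edges ?C) (verts ?C - {c, o1}) (M - {{y1, o1}} - {{y2, y3}})"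
    unfolding eq by (subst pm_on_contract[OF g c]) auto
  moreover have "{c, o1} \<in> edges ?C"
    using nbrs_contract_tri_new[OF t c] unfolding nbrs_def by blast
  ultimately show ?thesis by (rule pm_on_insert(1)) (use oV in auto)
qed

text \<open>The chosen triangle contains an edge of \<open>M\<close>, so \<open>M\<close> drops to
  the contraction. A competitor there lifts to a matching of \<open>G\<close> through
  \<open>e\<close>, hence to \<open>M\<close>, and this forces it to leave the contracted vertex
  towards \<open>o3\<close>.\<close>

lemma lonely_contract:
  assumes G: "cubic3 G" and l: "lonely G e" and card: "card (verts G) \<ge> 5"
  obtains y1 y2 y3 o1 o2 o3 where "tri G y1 y2 y3 o1 o2 o3"
    "lonely (contract G {y1, y2, y3} y1) e"
proof -
  note g = cubic3D(1)[OF G]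
  obtain M where M: "unique_pm G e M" using l lonely_iff[OF g] by blast
  then have Mp: "pm_on (edges G) (verts G) M" and eM: "e \<in> M"
    and un: "\<And>N. pm_on (edges G) (verts G) N \<Longrightarrow> e \<in> N \<Longrightarrow> N = M"
    unfolding unique_pm_def by blast+
  obtain a b where ab: "e = {a, b}" using l g unfolding lonely_def by (auto elim: graph_edgeE)
  obtain y1 y2 y3 where y: "{y1, y2, y3} \<subseteq> verts G - {a, b}" "{y1, y2} \<in> edges G"
      "{y2, y3} \<in> edges G" "{y1, y3} \<in> edges G" "{y1, y2} \<in> M"
    using good_triangle[OF G M[unfolded ab] card] by blast
  obtain o1 o2 o3 where t: "tri G y1 y2 y3 o1 o2 o3" using tri_of_cubic3[OF G y(2-4) card] by blast
  note d = tri_neq[OF t]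
  let ?Y = "{y1, y2, y3}" let ?C = "contract G ?Y y1"
  have c: "y1 \<notin> verts G - ?Y" by simp
  have gC: "graph ?C" by (rule graph_contract[OF g c])
  have Mu: "d = d'" if "d \<in> M" "d' \<in> M" "z \<in> d" "z \<in> d'" for d d' z
    using pm_onD(2)[OF Mp that(1)] pm_onD(3)[OF Mp, of z] that by blast
  \<comment> \<open>\<open>y1\<close> and \<open>y2\<close> are matched with each other, so only the
    outer edge is left for \<open>y3\<close>.\<close>
  have y3o3: "{y3, o3} \<in> M"
  proof -
    obtain d where d1: "d \<in> M" "y3 \<in> d" using pm_onD(3)[OF Mp, of y3] y(1) by blast
    then have "d \<in> edges G" using pm_onD(1)[OF Mp] by blast
    then obtain w where w: "d = {y3, w}" "w \<in> nbrs G y3"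
      using edge_in_iff[OF g _ d1(2)] unfolding nbrs_def by blast
    have "w \<noteq> y1" "w \<noteq> y2"
      using Mu[OF d1(1) y(5), of w] w(1) d by (auto simp: doubleton_eq_iff)
    then show ?thesis using w d1 triD(5)[OF t] by auto
  qed
  note t3 = tri_perm(4)[OF t]
  have Y3: "{y3, y1, y2} = ?Y" by auto
  have Y2: "{y2, y1, y3} = ?Y" by auto
  define MC where "MC = insert {y1, o3} (M - {{y3, o3}} - {{y1, y2}})"
  have pC: "pm_on (edges ?C) (verts ?C) MC"
    using tri_drop_pm[OF t3 _ Mp y3o3 y(5)] c unfolding MC_def Y3 by blast
  have eY: "e \<noteq> {y3, o3}" "e \<noteq> {y1, y2}" "e \<noteq> {y1, oo}" for oo
    using y(1) ab by auto
  have "unique_pm ?C e MC" unfolding unique_pm_def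
  proof (intro conjI allI impI)
    show "pm_on (edges ?C) (verts ?C) MC" by (rule pC)
    show "e \<in> MC" using eM eY unfolding MC_def by blast
    fix N assume N: "pm_on (edges ?C) (verts ?C) N \<and> e \<in> N"
    obtain d where d1: "d \<in> N" "y1 \<in> d" using pm_onD(3)[of "edges ?C" "verts ?C" N y1] N by auto
    then have "d \<in> edges ?C" using pm_onD(1) N by blast
    then obtain w where w: "d = {y1, w}" "w \<in> {o1, o2, o3}"
      using edge_in_iff[OF gC _ d1(2)] nbrs_contract_tri_new[OF t c] unfolding nbrs_def by blast
    \<comment> \<open>A lift through \<open>o1\<close> or \<open>o2\<close> would put a triangle
      edge at \<open>y3\<close> into \<open>M\<close>, in conflict with \<open>y1y2\<close>.\<close>
    have no: False if h: "insert {u, ou} (insert {x, z} (N - {{y1, ou}})) = M"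
        "x \<in> {y1, y2}" "z = y3" for u ou x z
    proof -
      have "{x, z} \<in> M" using h by blast
      then have "{x, z} = {y1, y2}" using Mu[OF _ y(5), of "{x, z}" x] h(2) by blast
      then show False using h(3) d by (auto simp: doubleton_eq_iff)
    qed
    have "w = o3"
    proof (rule ccontr)
      assume "w \<noteq> o3"
      then consider "w = o1" | "w = o2" using w by blast
      then show False
      proof cases
        case 1
        then have "insert {y1, o1} (insert {y2, y3} (N - {{y1, o1}})) = M"
          using d1 w N eY by (intro un tri_lift_pm[OF t c]) simp_all
        then show False using no by blast
      next
        case 2
        then have "insert {y2, o2} (insert {y1, y3} (N - {{y1, o2}})) = M"
          using d1 w N eY tri_lift_pm[OF tri_perm(1)[OF t], of y1 N, unfolded Y2]
          by (intro un) simp_all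
        then show False using no by blast
      qed
    qed
    then have yN: "{y1, o3} \<in> N" using d1 w by blast
    then have MN: "insert {y3, o3} (insert {y1, y2} (N - {{y1, o3}})) = M"
      using N eY tri_lift_pm[OF t3, of y1 N, unfolded Y3] by (intro un) simp_all
    have "d \<subseteq> verts ?C" if "d \<in> N" for d using pm_onD(2) N that by blast
    then have "{y3, o3} \<notin> N" "{y1, y2} \<notin> N" using d by auto
    then show "N = MC" unfolding MC_def MN[symmetric] using yN by blast
  qed
  then have "lonely ?C e" using lonely_iff[OF gC] by blast
  then show ?thesis using that[OF t] by blast
qed

subsection \<open>Extended prisms as cylinders\<close>

text \<open>The extended prism with pattern \<open>ss\<close> as a cylinder: \<open>T\<^sub>u\<close> is level \<open>0\<close>, \<open>T\<^sub>v\<close> is the last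
  level, and level \<open>l\<close> in between is a rung joining the two strands other than \<open>ss ! (l - 1)\<close>.\<close>

definition cyl_vertex :: "nat list \<Rightarrow> nat \<Rightarrow> nat \<Rightarrow> bool" where
  "cyl_vertex ss l i \<longleftrightarrow> i \<in> {1, 2, 3} \<and> l \<le> Suc (length ss) \<and>
     (0 < l \<and> l \<le> length ss \<longrightarrow> ss ! (l - 1) \<noteq> i)"

text \<open>Level \<open>r\<close> strictly between the ends carries no vertex on strand
  \<open>i\<close> exactly if \<open>ss ! (r - 1) = i\<close>, so \<open>l\<close> and
  \<open>m\<close> are neighbouring levels on that strand. The shift by one arises because level 0
  is the triangle \<open>T_u\<close>.\<close>

definition consec :: "nat list \<Rightarrow> nat \<Rightarrow> nat \<Rightarrow> nat \<Rightarrow> bool" where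
  "consec ss i l m \<longleftrightarrow> l < m \<and> (\<forall>r. l < r \<and> r < m \<longrightarrow> ss ! (r - 1) = i)"

text \<open>One clause for equal levels covers both end triangles and the rungs: an inner level
  simply has only two vertices.\<close>

definition cyl_adj :: "nat list \<Rightarrow> nat \<times> nat \<Rightarrow> nat \<times> nat \<Rightarrow> bool" where
  "cyl_adj ss p q \<longleftrightarrow> cyl_vertex ss (fst p) (snd p) \<and> cyl_vertex ss (fst q) (snd q) \<and>
     (fst p = fst q \<and> snd p \<noteq> snd q \<or>
      snd p = snd q \<and> (consec ss (snd p) (fst p) (fst q) \<or> consec ss (snd p) (fst q) (fst p)))"

definition cyl :: "nat list \<Rightarrow> (nat \<times> nat) graph" where
  "cyl ss = \<lparr>verts = {p. cyl_vertex ss (fst p) (snd p)}, edges = {{p, q} | p q. cyl_adj ss p q}\<rparr>"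

lemma cyl_adj_sym: "cyl_adj ss p q \<Longrightarrow> cyl_adj ss q p"
proof -
  assume h: "cyl_adj ss p q"
  then have v: "cyl_vertex ss (fst p) (snd p)" "cyl_vertex ss (fst q) (snd q)"
    by (simp_all add: cyl_adj_def)
  from h have "fst p = fst q \<and> snd p \<noteq> snd q \<or>
      snd p = snd q \<and> (consec ss (snd p) (fst p) (fst q) \<or> consec ss (snd p) (fst q) (fst p))"
    by (simp add: cyl_adj_def)
  then show ?thesis
  proof (elim disjE conjE)
    assume "fst p = fst q" "snd p \<noteq> snd q"
    then show ?thesis using v unfolding cyl_adj_def by simp
  next
    assume "snd p = snd q" "consec ss (snd p) (fst p) (fst q)"
    then show ?thesis using v unfolding cyl_adj_def by simp
  next
    assume "snd p = snd q" "consec ss (snd p) (fst q) (fst p)"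
    then show ?thesis using v unfolding cyl_adj_def by simp
  qed
qed

lemma cyl_verts: "(l, i) \<in> verts (cyl ss) \<longleftrightarrow> cyl_vertex ss l i"
  by (simp add: cyl_def)

lemma cyl_edges: "{p, q} \<in> edges (cyl ss) \<longleftrightarrow> cyl_adj ss p q"
proof -
  have "{p, q} \<in> edges (cyl ss) \<longleftrightarrow> (\<exists>p' q'. {p, q} = {p', q'} \<and> cyl_adj ss p' q')"
    by (simp add: cyl_def)
  then show ?thesis unfolding doubleton_eq_iff using cyl_adj_sym[of ss] by blast
qed

lemma graph_cyl: "graph (cyl ss)"
  unfolding graph_def
proof (intro conjI ballI)
  have "verts (cyl ss) \<subseteq> {..Suc (length ss)} \<times> {1, 2, 3}"
    by (auto simp: cyl_def cyl_vertex_def)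
  then show "finite (verts (cyl ss))" by (rule finite_subset) simp
  fix e assume "e \<in> edges (cyl ss)"
  then obtain p q where e: "e = {p, q}" "cyl_adj ss p q" by (auto simp: cyl_def)
  have "p \<noteq> q"
  proof
    assume "p = q"
    then show False using e(2) unfolding cyl_adj_def consec_def by simp
  qed
  moreover have "p \<in> verts (cyl ss)" "q \<in> verts (cyl ss)"
    using e(2) by (simp_all add: cyl_def cyl_adj_def)
  ultimately show "\<exists>u v. e = {u, v} \<and> u \<noteq> v \<and> u \<in> verts (cyl ss) \<and> v \<in> verts (cyl ss)"
    using e(1) by blast
qed

lemma cyl_vertex_snoc:
  "cyl_vertex (ss @ [s]) l i \<longleftrightarrow>
    (if l \<le> length ss then cyl_vertex ss l i
     else if l = Suc (length ss) then i \<in> {1, 2, 3} \<and> i \<noteq> s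
     else l = Suc (Suc (length ss)) \<and> i \<in> {1, 2, 3})"
proof -
  consider "l \<le> length ss" | "l = Suc (length ss)" | "l > Suc (length ss)" by linarith
  then show ?thesis
  proof cases
    case 1
    have "(ss @ [s]) ! (l - 1) = ss ! (l - 1)" if "0 < l"
    proof -
      have "l - 1 < length ss" using that 1 by linarith
      then show ?thesis by (simp add: nth_append)
    qed
    then show ?thesis using 1 by (auto simp: cyl_vertex_def)
  next
    case 2 then show ?thesis by (auto simp: cyl_vertex_def)
  next
    case 3 then show ?thesis by (auto simp: cyl_vertex_def)
  qed
qed

lemma consec_snoc:
  assumes "m \<le> Suc (length ss)"
  shows "consec (ss @ [s]) i l m \<longleftrightarrow> consec ss i l m"
proof -
  have "(ss @ [s]) ! (r - 1) = ss ! (r - 1)" if "l < r" "r < m" for r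
  proof -
    have "r - 1 < length ss" using that assms by linarith
    then show ?thesis by (simp add: nth_append)
  qed
  then show ?thesis by (auto simp: consec_def)
qed

lemma consec_snoc_top:
  "consec (ss @ [s]) i l (Suc (Suc (length ss))) \<longleftrightarrow>
    l = Suc (length ss) \<or> s = i \<and> consec ss i l (Suc (length ss))"
proof -
  have "(ss @ [s]) ! length ss = s" by simp
  have "consec (ss @ [s]) i l (Suc (Suc (length ss))) \<longleftrightarrow>
    l = Suc (length ss) \<or> (s = i \<and> consec (ss @ [s]) i l (Suc (length ss)))"
  proof (cases "l < Suc (length ss)")
    case True
    have "(\<forall>r. l < r \<and> r < Suc (Suc (length ss)) \<longrightarrow> (ss @ [s]) ! (r - 1) = i) \<longleftrightarrow>
      (ss @ [s]) ! (Suc (length ss) - 1) = i \<and>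
      (\<forall>r. l < r \<and> r < Suc (length ss) \<longrightarrow> (ss @ [s]) ! (r - 1) = i)"
      using True less_Suc_eq by blast
    then show ?thesis using True unfolding consec_def by auto
  next
    case False
    then show ?thesis unfolding consec_def by auto
  qed
  then show ?thesis by (simp add: consec_snoc)
qed

text \<open>The last vertex below the top level on strand \<open>i\<close>.\<close>

definition port :: "nat list \<Rightarrow> nat \<Rightarrow> nat \<times> nat" where
  "port ss i = (length (dropWhile (\<lambda>s. s = i) (rev ss)), i)"

lemma port_Nil: "port [] i = (0, i)"
  by (simp add: port_def)

lemma port_snoc: "port (ss @ [s]) i = (if s = i then port ss i else (Suc (length ss), i))"
  by (simp add: port_def)

lemma port_le: "fst (port ss i) \<le> length ss"
  using length_dropWhile_le[of _ "rev ss"] by (auto simp: port_def)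

text \<open>An extension of index \<open>i\<close> moves the top level past strand \<open>i\<close>
  and keeps its port; any other extension makes the new rung vertex the port.\<close>

lemma port_iff:
  assumes "i \<in> {1, 2, 3}"
  shows "cyl_vertex ss l i \<and> consec ss i l (Suc (length ss)) \<longleftrightarrow> (l, i) = port ss i"
proof (induction ss rule: rev_induct)
  case Nil
  then show ?case using assms by (auto simp: cyl_vertex_def consec_def port_Nil)
next
  case (snoc s ss)
  have "cyl_vertex (ss @ [s]) l i \<and> consec (ss @ [s]) i l (Suc (Suc (length ss))) \<longleftrightarrow>
    l = Suc (length ss) \<and> i \<noteq> s \<or> s = i \<and> cyl_vertex ss l i \<and> consec ss i l (Suc (length ss))"
    unfolding consec_snoc_top cyl_vertex_snoc using assms by (auto simp: consec_def)
  then show ?case using snoc by (auto simp: port_snoc)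
qed

lemma cyl_adj_top:
  assumes "i \<in> {1, 2, 3}"
  shows "cyl_adj ss (Suc (length ss), i) q \<longleftrightarrow>
    fst q = Suc (length ss) \<and> snd q \<in> {1, 2, 3} \<and> snd q \<noteq> i \<or> q = port ss i"
proof -
  obtain l j where q: "q = (l, j)" by fastforce
  have top: "cyl_vertex ss (Suc (length ss)) j \<longleftrightarrow> j \<in> {1, 2, 3}" for j
    by (auto simp: cyl_vertex_def)
  have no: "\<not> (cyl_vertex ss l j \<and> consec ss i (Suc (length ss)) l)"
    by (auto simp: cyl_vertex_def consec_def)
  have pj: "(l, j) = port ss i \<longleftrightarrow> j = i \<and> (l, i) = port ss i" by (auto simp: port_def)
  have "cyl_adj ss (Suc (length ss), i) (l, j) \<longleftrightarrow>
     l = Suc (length ss) \<and> j \<in> {1, 2, 3} \<and> j \<noteq> i \<or> j = i \<and> cyl_vertex ss l i \<and> consec ss i l (Suc (length ss))"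
    unfolding cyl_adj_def fst_conv snd_conv using assms top no by auto
  then show ?thesis unfolding q pj port_iff[OF assms, symmetric] by simp
qed

abbreviation apex :: "nat list \<Rightarrow> nat \<Rightarrow> nat \<times> nat" where
  "apex ss i \<equiv> (Suc (length ss), i)"

lemma tri_cyl:
  "tri (cyl ss) (apex ss 1) (apex ss 2) (apex ss 3) (port ss 1) (port ss 2) (port ss 3)"
proof -
  have n: "nbrs (cyl ss) (apex ss i) = {q. fst q = Suc (length ss) \<and> snd q \<in> {1, 2, 3} \<and> snd q \<noteq> i} \<union> {port ss i}"
    if "i \<in> {1, 2, 3}" for i
    unfolding nbrs_def cyl_edges using cyl_adj_top[OF that] by auto
  have p: "fst (port ss i) \<noteq> Suc (length ss)" for i using port_le[of ss i] by linarith
  have d: "distinct [apex ss 1, apex ss 2, apex ss 3, port ss 1, port ss 2, port ss 3]"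
    using p[of 1] p[of 2] p[of 3] by (auto simp: port_def)
  show ?thesis unfolding tri_def using graph_cyl d n[of 1] n[of 2] n[of 3] by auto
qed

lemma graph_eqI:
  assumes "graph G" "graph H" "verts G = verts H" "\<And>u v. {u, v} \<in> edges G \<longleftrightarrow> {u, v} \<in> edges H"
  shows "G = H"
proof -
  have "e \<in> edges G \<longleftrightarrow> e \<in> edges H" for e
    using assms by (metis graph_edgeE)
  then have "edges G = edges H" by blast
  then show ?thesis using assms(3) by (cases G, cases H) simp
qed

text \<open>Contracting the top triangle undoes the last extension. With the new vertex placed at
  the vacant position \<open>apex ss s\<close> the result is equal to \<open>cyl ss\<close>, not
  merely isomorphic, so no maps have to be carried along.\<close>

lemma contract_cyl:
  assumes s: "s \<in> {1, 2, 3}"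
  shows "contract (cyl (ss @ [s])) {apex (ss @ [s]) 1, apex (ss @ [s]) 2, apex (ss @ [s]) 3} (apex ss s) = cyl ss"
    (is "contract ?G ?T ?c = ?H")
proof (rule graph_eqI)
  let ?k = "length ss"
  have T: "p \<in> ?T \<longleftrightarrow> fst p = Suc (Suc ?k) \<and> snd p \<in> {1, 2, 3}" for p by (cases p) auto
  have c: "?c \<notin> verts ?G - ?T" using cyl_verts[of _ _ "ss @ [s]"] by (simp add: cyl_vertex_snoc)
  note tG = tri_cyl[of "ss @ [s]"]
  show gC: "graph (contract ?G ?T ?c)" by (rule graph_contract[OF graph_cyl c])
  show "graph ?H" by (rule graph_cyl)
  show vv: "verts (contract ?G ?T ?c) = verts ?H"
  proof -
    have "(l, i) \<in> verts (contract ?G ?T ?c) \<longleftrightarrow> (l, i) \<in> verts ?H" for l i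
      using s by (auto simp: cyl_verts cyl_vertex_snoc) (auto simp: cyl_vertex_def)
    then show ?thesis by (simp add: set_eq_iff split_paired_all)
  qed
  have E0: "{u, v} \<in> edges (contract ?G ?T ?c) \<longleftrightarrow> {u, v} \<in> edges ?H"
    if uv: "u \<in> verts ?H" "v \<in> verts ?H" "u \<noteq> ?c" "v \<noteq> ?c" for u v
  proof -
    have nT: "u \<notin> ?T" "v \<notin> ?T" using uv unfolding T by (auto simp: cyl_def cyl_vertex_def)
    have V: "cyl_vertex (ss @ [s]) (fst w) (snd w) \<and> cyl_vertex ss (fst w) (snd w) \<and> fst w \<le> Suc ?k"
      if "w \<in> {u, v}" for w
    proof -
      have w: "cyl_vertex ss (fst w) (snd w)" "w \<noteq> ?c" using that uv by (auto simp: cyl_def)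
      then have "fst w \<le> Suc ?k" "snd w \<in> {1, 2, 3}" "fst w = Suc ?k \<Longrightarrow> snd w \<noteq> s"
        by (cases w; auto simp: cyl_vertex_def)+
      then show ?thesis using w(1) by (auto simp: cyl_vertex_snoc)
    qed
    have "cyl_adj (ss @ [s]) u v \<longleftrightarrow> cyl_adj ss u v"
      unfolding cyl_adj_def using V[of u] V[of v] by (simp add: consec_snoc)
    then show ?thesis
      using edge_contract_outside[OF graph_cyl c nT uv(3,4)] by (simp only: cyl_edges)
  qed
  have E1: "nbrs (contract ?G ?T ?c) ?c = nbrs ?H ?c"
  proof -
    have "nbrs (contract ?G ?T ?c) ?c = {port (ss @ [s]) 1, port (ss @ [s]) 2, port (ss @ [s]) 3}"
      by (rule nbrs_contract_tri_new[OF tG c])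
    moreover have "nbrs ?H ?c = {q. fst q = Suc ?k \<and> snd q \<in> {1, 2, 3} \<and> snd q \<noteq> s} \<union> {port ss s}"
      unfolding nbrs_def cyl_edges using cyl_adj_top[OF s] by auto
    moreover have "{q. fst q = Suc ?k \<and> snd q \<in> {1, 2, 3} \<and> snd q \<noteq> s} =
      (\<lambda>i. (Suc ?k, i)) ` ({1, 2, 3} - {s})" by force
    ultimately show ?thesis using s by (auto simp: port_snoc)
  qed
  fix u v
  show "{u, v} \<in> edges (contract ?G ?T ?c) \<longleftrightarrow> {u, v} \<in> edges ?H"
  proof (cases "u = ?c \<or> v = ?c")
    case True
    then show ?thesis using E1 unfolding nbrs_def by (auto simp: insert_commute)
  next
    case False
    show ?thesis
    proof (cases "u \<in> verts ?H \<and> v \<in> verts ?H")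
      case True then show ?thesis using E0 False by blast
    next
      case F: False
      then show ?thesis using edge_verts[OF gC, of u v] edge_verts[OF graph_cyl, of u v ss] vv by blast
    qed
  qed
qed

section \<open>3-connectivity and the symmetries of the cylinder\<close>

lemma cubic3_complete:
  assumes g: "graph G" and c: "card (verts G) = 4"
    and e: "\<And>u w. u \<in> verts G \<Longrightarrow> w \<in> verts G \<Longrightarrow> u \<noteq> w \<Longrightarrow> {u, w} \<in> edges G"
  shows "cubic3 G"
proof (rule cubic3I[OF g])
  have n: "nbrs G u = verts G - {u}" if "u \<in> verts G" for u
    using e[OF that] nbrs_sub[OF g, of u] unfolding nbrs_def by blast
  show "card (nbrs G v) = 3" if "v \<in> verts G" for v
    using n[OF that] c that finite_verts[OF g] by simp
  show "4 \<le> card (verts G)" using c by simp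
  fix X P assume P: "P \<subseteq> verts G - X" "P \<noteq> {}" and cl: "\<And>u. u \<in> P \<Longrightarrow> nbrs G u \<subseteq> X \<union> P"
  obtain u where u: "u \<in> P" using P by blast
  then have "verts G - {u} \<subseteq> X \<union> P" using cl n P by blast
  then show "P = verts G - X" using P u by blast
qed

text \<open>The base of all inductions on patterns: the prism with its top triangle contracted is
  \<open>K4\<close>. The position \<open>(1, 1)\<close> of the new vertex is an arbitrary
  choice.\<close>

lemma contract_prism:
  defines "C \<equiv> contract (cyl []) {apex [] 1, apex [] 2, apex [] 3} (1, 1)"
  shows "graph C" "verts C = {(0, 1), (0, 2), (0, 3), (1, 1)}"
    "\<And>u w. u \<in> verts C \<Longrightarrow> w \<in> verts C \<Longrightarrow> u \<noteq> w \<Longrightarrow> {u, w} \<in> edges C"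
proof -
  have c: "(1, 1) \<notin> verts (cyl []) - {apex [] 1, apex [] 2, apex [] 3}" by simp
  let ?C = "contract (cyl []) {apex [] 1, apex [] 2, apex [] 3} (1, 1)"
  note t = tri_cyl[of "[]"]
  show "graph C" unfolding C_def by (rule graph_contract[OF graph_cyl c])
  have v: "verts ?C = {(0, 1), (0, 2), (0, 3), (1, 1)}"
  proof -
    have "(l, i) \<in> verts (cyl []) \<longleftrightarrow> (l = 0 \<or> l = 1) \<and> (i = 1 \<or> i = 2 \<or> i = 3)" for l i
      by (auto simp: cyl_verts cyl_vertex_def)
    then show ?thesis by (auto simp: set_eq_iff)
  qed
  then show "verts C = {(0, 1), (0, 2), (0, 3), (1, 1)}" unfolding C_def .
  have top: "{(1, 1), w} \<in> edges ?C" if "w \<in> {(0, 1), (0, 2), (0, 3)}" for w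
    proof -
      have "w \<in> nbrs ?C (1, 1)"
        using that unfolding nbrs_contract_tri_new[OF t c] by (simp add: port_Nil)
      then show ?thesis by (simp add: nbrs_def)
    qed
    have bot: "{(0, i), (0, j)} \<in> edges ?C" if "i \<in> {1, 2, 3}" "j \<in> {1, 2, 3}" "i \<noteq> j" for i j
    proof -
      have "cyl_adj [] (0, i) (0, j)" using that unfolding cyl_adj_def cyl_vertex_def by simp
      then show ?thesis
        using edge_contract_outside[OF graph_cyl c, of "(0, i)" "(0, j)"] by (simp add: cyl_edges)
    qed
    fix u w assume "u \<in> verts C" "w \<in> verts C" "u \<noteq> w"
    then have uw: "u \<in> verts ?C" "w \<in> verts ?C" "u \<noteq> w" unfolding C_def by blast+
    consider "u = (1, 1)" "w \<in> {(0, 1), (0, 2), (0, 3)}" | "w = (1, 1)" "u \<in> {(0, 1), (0, 2), (0, 3)}"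
      | "u \<in> {(0, 1), (0, 2), (0, 3)}" "w \<in> {(0, 1), (0, 2), (0, 3)}" using uw unfolding v by blast
    then have "{u, w} \<in> edges ?C"
    proof cases
      case 1 then show ?thesis using top[of w] by simp
    next
      case 2 then show ?thesis using top[of u] by (simp add: insert_commute)
    next
      case 3
      then have "u = (0, snd u)" "w = (0, snd w)" "snd u \<in> {1, 2, 3}" "snd w \<in> {1, 2, 3}"
        by auto
      moreover have "snd u \<noteq> snd w" using calculation(1,2) uw(3) by metis
      ultimately show ?thesis using bot[of "snd u" "snd w"] by simp
    qed
  then show "{u, w} \<in> edges C" unfolding C_def .
qed

lemma cubic3_prism: "cubic3 (cyl [])"
proof (rule cubic3_expand[OF tri_cyl])
  show "(1, 1) \<notin> verts (cyl []) - {apex [] 1, apex [] 2, apex [] 3}" by simp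
  show "cubic3 (contract (cyl []) {apex [] 1, apex [] 2, apex [] 3} (1, 1))"
  proof (rule cubic3_complete[OF contract_prism(1)])
    show "card (verts (contract (cyl []) {apex [] 1, apex [] 2, apex [] 3} (1, 1))) = 4"
      unfolding contract_prism(2) by simp
  qed (rule contract_prism(3))
qed

lemma cubic3_cyl: "set ss \<subseteq> {1, 2, 3} \<Longrightarrow> cubic3 (cyl ss)"
proof (induction ss rule: rev_induct)
  case Nil show ?case by (rule cubic3_prism)
next
  case (snoc s ss)
  then have s: "s \<in> {1, 2, 3}" and "cubic3 (cyl ss)" by auto
  then show ?case
    using cubic3_expand[OF tri_cyl[of "ss @ [s]"], of "apex ss s"] contract_cyl[OF s, of ss]
      cyl_verts[of _ _ "ss @ [s]"] by (simp add: cyl_vertex_snoc)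
qed

definition flip :: "nat \<Rightarrow> nat \<times> nat \<Rightarrow> nat \<times> nat" where
  "flip k p = (Suc k - fst p, snd p)"

lemma cyl_vertex_rev:
  assumes h: "cyl_vertex ss l i"
  shows "cyl_vertex (rev ss) (Suc (length ss) - l) i"
  unfolding cyl_vertex_def
proof (intro conjI impI)
  show "i \<in> {1, 2, 3}" using h by (simp add: cyl_vertex_def)
  show "Suc (length ss) - l \<le> Suc (length (rev ss))" by simp
  assume "0 < Suc (length ss) - l \<and> Suc (length ss) - l \<le> length (rev ss)"
  then have l: "0 < l" "l \<le> length ss" by auto
  have "rev ss ! (Suc (length ss) - l - 1) = ss ! (length ss - Suc (Suc (length ss) - l - 1))"
    using l by (intro rev_nth) auto
  also have "length ss - Suc (Suc (length ss) - l - 1) = l - 1" using l by auto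
  finally show "rev ss ! (Suc (length ss) - l - 1) \<noteq> i" using h l by (simp add: cyl_vertex_def)
qed

lemma consec_rev:
  assumes h: "consec ss i l m" "m \<le> Suc (length ss)"
  shows "consec (rev ss) i (Suc (length ss) - m) (Suc (length ss) - l)"
  unfolding consec_def
proof (intro conjI allI impI)
  show "Suc (length ss) - m < Suc (length ss) - l" using h by (auto simp: consec_def)
  fix r assume r: "Suc (length ss) - m < r \<and> r < Suc (length ss) - l"
  have "rev ss ! (r - 1) = ss ! (length ss - Suc (r - 1))" using r by (intro rev_nth) auto
  also have "length ss - Suc (r - 1) = (Suc (length ss) - r) - 1" using r by auto
  also have "ss ! \<dots> = i"
  proof -
    have "l < Suc (length ss) - r" "Suc (length ss) - r < m" using r by linarith+
    then show ?thesis using h(1) unfolding consec_def by blast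
  qed
  finally show "rev ss ! (r - 1) = i" .
qed

lemma cyl_adj_rev:
  assumes h: "cyl_adj ss p q"
  shows "cyl_adj (rev ss) (flip (length ss) p) (flip (length ss) q)"
proof -
  have v: "cyl_vertex ss (fst p) (snd p)" "cyl_vertex ss (fst q) (snd q)"
    using h by (simp_all add: cyl_adj_def)
  then have le: "fst p \<le> Suc (length ss)" "fst q \<le> Suc (length ss)" by (simp_all add: cyl_vertex_def)
  have "consec (rev ss) (snd p) (Suc (length ss) - fst q) (Suc (length ss) - fst p)"
    if "consec ss (snd p) (fst p) (fst q)" by (rule consec_rev[OF that le(2)])
  moreover have "consec (rev ss) (snd p) (Suc (length ss) - fst p) (Suc (length ss) - fst q)"
    if "consec ss (snd p) (fst q) (fst p)" by (rule consec_rev[OF that le(1)])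
  ultimately show ?thesis
    using h cyl_vertex_rev[OF v(1)] cyl_vertex_rev[OF v(2)]
    unfolding cyl_adj_def flip_def fst_conv snd_conv by metis
qed

lemma isom_cyl_rev: "isom (flip (length ss)) (cyl ss) (cyl (rev ss))"
proof (rule isomI[OF graph_cyl graph_cyl])
  have V: "flip (length ss) p \<in> verts (cyl (rev ss))" if "p \<in> verts (cyl ss)" for p ss
    using that cyl_vertex_rev by (simp add: cyl_def flip_def)
  have inv: "flip (length ss) (flip (length ss) p) = p" if "p \<in> verts (cyl ss)" for p ss
    using that by (simp add: cyl_def flip_def cyl_vertex_def)
  show "bij_betw (flip (length ss)) (verts (cyl ss)) (verts (cyl (rev ss)))"
    by (rule bij_betw_byWitness[where f' = "flip (length ss)"])
      (use V[of _ ss] V[of _ "rev ss"] inv[of _ ss] inv[of _ "rev ss"] in auto)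
  show "({u, v} \<in> edges (cyl ss)) = ({flip (length ss) u, flip (length ss) v} \<in> edges (cyl (rev ss)))"
    if "u \<in> verts (cyl ss)" "v \<in> verts (cyl ss)" for u v
    unfolding cyl_edges
    using cyl_adj_rev[of ss u v] cyl_adj_rev[of "rev ss" "flip (length ss) u" "flip (length ss) v"]
      inv[OF that(1)] inv[OF that(2)] by auto
qed

lemma isom_cyl_map:
  assumes p: "bij_betw \<pi> {1, 2, 3} {1, 2, 3}" and ss: "set ss \<subseteq> {1, 2, 3}"
  shows "isom (\<lambda>p. (fst p, \<pi> (snd p))) (cyl ss) (cyl (map \<pi> ss))"
proof (rule isomI[OF graph_cyl graph_cyl])
  have inj: "\<pi> i = \<pi> j \<longleftrightarrow> i = j" if "i \<in> {1, 2, 3}" "j \<in> {1, 2, 3}" for i j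
    using p that unfolding bij_betw_def inj_on_def by blast
  have im: "\<pi> ` {1, 2, 3} = {1, 2, 3}" using p by (simp add: bij_betw_def)
  have nth: "map \<pi> ss ! (r - 1) = \<pi> i \<longleftrightarrow> ss ! (r - 1) = i"
    if "0 < r" "r \<le> length ss" "i \<in> {1, 2, 3}" for r i
  proof -
    have r: "r - 1 < length ss" using that by linarith
    then have "ss ! (r - 1) \<in> {1, 2, 3}" using ss nth_mem by blast
    then show ?thesis using r inj that(3) by (simp only: nth_map)
  qed
  have V: "cyl_vertex (map \<pi> ss) l (\<pi> i) \<longleftrightarrow> cyl_vertex ss l i" if i: "i \<in> {1, 2, 3}" for l i
  proof -
    have "\<pi> i \<in> {1, 2, 3}" using im i by blast
    then show ?thesis unfolding cyl_vertex_def length_map using nth[of l i] i by blast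
  qed
  have C: "consec (map \<pi> ss) (\<pi> i) l m \<longleftrightarrow> consec ss i l m"
    if "i \<in> {1, 2, 3}" "m \<le> Suc (length ss)" for i l m
    unfolding consec_def using nth[of _ i] that by (metis gr_zeroI less_Suc_eq_le not_less_zero order_less_le_trans)
  have i3: "cyl_vertex ss l i \<Longrightarrow> i \<in> {1, 2, 3}" "cyl_vertex ss l i \<Longrightarrow> l \<le> Suc (length ss)" for ss l i
    by (simp_all only: cyl_vertex_def)
  show "bij_betw (\<lambda>p. (fst p, \<pi> (snd p))) (verts (cyl ss)) (verts (cyl (map \<pi> ss)))"
    unfolding bij_betw_def
  proof
    show "inj_on (\<lambda>p. (fst p, \<pi> (snd p))) (verts (cyl ss))"
    proof (rule inj_onI)
      fix p q assume "p \<in> verts (cyl ss)" "q \<in> verts (cyl ss)"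
        "(fst p, \<pi> (snd p)) = (fst q, \<pi> (snd q))"
      then show "p = q" using i3(1)[of ss] inj[of "snd p" "snd q"] by (simp add: cyl_def prod_eq_iff)
    qed
    show "(\<lambda>p. (fst p, \<pi> (snd p))) ` verts (cyl ss) = verts (cyl (map \<pi> ss))"
    proof
      show "(\<lambda>p. (fst p, \<pi> (snd p))) ` verts (cyl ss) \<subseteq> verts (cyl (map \<pi> ss))"
        using V i3(1)[of ss] by (auto simp: cyl_def)
      show "verts (cyl (map \<pi> ss)) \<subseteq> (\<lambda>p. (fst p, \<pi> (snd p))) ` verts (cyl ss)"
      proof
        fix q assume "q \<in> verts (cyl (map \<pi> ss))"
        then have q: "cyl_vertex (map \<pi> ss) (fst q) (snd q)" by (simp add: cyl_def)
        then obtain i where i: "i \<in> {1, 2, 3}" "snd q = \<pi> i" using i3(1) im by (metis imageE)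
        then have "(fst q, i) \<in> verts (cyl ss)" using q V by (simp add: cyl_def)
        moreover have "q = (fst q, \<pi> i)" using i by (simp add: prod_eq_iff)
        ultimately show "q \<in> (\<lambda>p. (fst p, \<pi> (snd p))) ` verts (cyl ss)"
          using image_eqI[of q "\<lambda>p. (fst p, \<pi> (snd p))" "(fst q, i)"] by simp
      qed
    qed
  qed
  fix u v assume "u \<in> verts (cyl ss)" "v \<in> verts (cyl ss)"
  then have uv: "cyl_vertex ss (fst u) (snd u)" "cyl_vertex ss (fst v) (snd v)" by (simp_all add: cyl_def)
  note i = i3(1)[OF uv(1)] i3(1)[OF uv(2)] and le = i3(2)[OF uv(1)] i3(2)[OF uv(2)]
  show "({u, v} \<in> edges (cyl ss)) =
    ({(fst u, \<pi> (snd u)), (fst v, \<pi> (snd v))} \<in> edges (cyl (map \<pi> ss)))"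
    unfolding cyl_edges cyl_adj_def fst_conv snd_conv V[OF i(1)] V[OF i(2)] inj[OF i]
      C[OF i(1) le(1)] C[OF i(1) le(2)] ..
qed

subsection \<open>Expansions and the descendants of the tricorn\<close>

text \<open>The graph produced by \<open>tri_repl\<close>, as a function of its choices;
  \<open>ext_step\<close> is an instance of it as well.\<close>

definition expand :: "'a graph \<Rightarrow> 'a \<Rightarrow> 'a \<Rightarrow> 'a \<Rightarrow> 'a \<Rightarrow> 'a \<Rightarrow> 'a \<Rightarrow> 'a \<Rightarrow> 'a graph" where
  "expand G x a1 a2 a3 y1 y2 y3 = \<lparr>verts = (verts G - {x}) \<union> {y1, y2, y3},
     edges = (edges G - {e. x \<in> e}) \<union>
             {{y1, y2}, {y2, y3}, {y1, y3}, {y1, a1}, {y2, a2}, {y3, a3}}\<rparr>"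

lemma nbrs_iff_edges_at:
  assumes "graph G"
  shows "nbrs G x = {a1, a2, a3} \<longleftrightarrow> {e \<in> edges G. x \<in> e} = {{x, a1}, {x, a2}, {x, a3}}"
proof -
  have inj: "inj (\<lambda>w. {x, w})" by (auto simp: inj_on_def doubleton_eq_iff)
  have A: "{e \<in> edges G. x \<in> e} = (\<lambda>w. {x, w}) ` nbrs G x"
  proof
    show "{e \<in> edges G. x \<in> e} \<subseteq> (\<lambda>w. {x, w}) ` nbrs G x"
    proof
      fix e assume e: "e \<in> {e \<in> edges G. x \<in> e}"
      then obtain w where "e = {x, w}" using edge_in_iff[OF assms, of e x] by blast
      then show "e \<in> (\<lambda>w. {x, w}) ` nbrs G x" using e by (simp add: nbrs_def)
    qed
  qed (auto simp: nbrs_def)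
  have B: "{{x, a1}, {x, a2}, {x, a3}} = (\<lambda>w. {x, w}) ` {a1, a2, a3}" by simp
  show ?thesis unfolding A B inj_image_eq_iff[OF inj] ..
qed

text \<open>Contraction undoes expansion with literal equality. Hence statements about expanded
  graphs can be phrased as statements about a graph with a triangle and its contraction.\<close>

lemma expand_tri:
  assumes g: "graph G" and x: "x \<in> verts G" and n: "nbrs G x = {a1, a2, a3}" and a: "distinct [a1, a2, a3]"
    and y: "distinct [y1, y2, y3]" "y1 \<notin> verts G" "y2 \<notin> verts G" "y3 \<notin> verts G"
  shows "tri (expand G x a1 a2 a3 y1 y2 y3) y1 y2 y3 a1 a2 a3"
    "x \<notin> verts (expand G x a1 a2 a3 y1 y2 y3) - {y1, y2, y3}"
    "contract (expand G x a1 a2 a3 y1 y2 y3) {y1, y2, y3} x = G"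
proof -
  let ?H = "expand G x a1 a2 a3 y1 y2 y3" and ?Y = "{y1, y2, y3}"
  have av: "a1 \<in> verts G" "a2 \<in> verts G" "a3 \<in> verts G" "x \<noteq> a1" "x \<noteq> a2" "x \<noteq> a3"
    using nbrs_sub[OF g, of x] unfolding n by auto
  have ay: "a \<noteq> y1" "a \<noteq> y2" "a \<noteq> y3" if "a \<in> verts G" for a using y(2-4) that by metis+
  define S where "S = {{y1, y2}, {y2, y3}, {y1, y3}, {y1, a1}, {y2, a2}, {y3, a3}}"
  have EH: "edges ?H = (edges G - {e. x \<in> e}) \<union> S" by (simp add: expand_def S_def)
  have E: "{u, v} \<in> edges ?H \<longleftrightarrow> ({u, v} \<in> edges G \<and> u \<noteq> x \<and> v \<noteq> x) \<or> {u, v} \<in> S" for u v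
    unfolding EH by blast
  have SY: "e \<inter> ?Y \<noteq> {}" if "e \<in> S" for e using that unfolding S_def by blast
  have V: "verts ?H = (verts G - {x}) \<union> ?Y" by (simp add: expand_def)
  have gH: "graph ?H" unfolding graph_def
  proof (intro conjI ballI)
    show "finite (verts ?H)" using finite_verts[OF g] by (simp add: V)
    fix e assume "e \<in> edges ?H"
    then have "e \<in> edges G \<and> x \<notin> e \<or> e \<in> S" unfolding EH by blast
    then consider "e \<in> edges G" "x \<notin> e" | "e \<in> S" by blast
    then show "\<exists>u v. e = {u, v} \<and> u \<noteq> v \<and> u \<in> verts ?H \<and> v \<in> verts ?H"
    proof cases
      case 1
      obtain u v where uv: "e = {u, v}" "u \<noteq> v" "u \<in> verts G" "v \<in> verts G"
        using 1(1) g by (auto elim: graph_edgeE)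
      show ?thesis unfolding V by (rule exI[of _ u], rule exI[of _ v]) (use uv 1(2) in auto)
    next
      case 2
      have ok: "\<exists>u v. {p, q} = {u, v} \<and> u \<noteq> v \<and> u \<in> verts ?H \<and> v \<in> verts ?H"
        if "p \<noteq> q" "p \<in> verts ?H" "q \<in> verts ?H" for p q using that by blast
      have mem: "y1 \<in> verts ?H" "y2 \<in> verts ?H" "y3 \<in> verts ?H"
        "a1 \<in> verts ?H" "a2 \<in> verts ?H" "a3 \<in> verts ?H" using av by (simp_all add: V)
      have ne: "y1 \<noteq> y2" "y2 \<noteq> y3" "y1 \<noteq> y3" "y1 \<noteq> a1" "y2 \<noteq> a2" "y3 \<noteq> a3"
        using y(1) ay(1)[OF av(1)] ay(2)[OF av(2)] ay(3)[OF av(3)] by simp_all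
      show ?thesis
        using 2[unfolded S_def] ok[OF ne(1) mem(1,2)] ok[OF ne(2) mem(2,3)] ok[OF ne(3) mem(1,3)]
          ok[OF ne(4) mem(1,4)] ok[OF ne(5) mem(2,5)] ok[OF ne(6) mem(3,6)]
        by (elim insertE emptyE) (simp_all only:)
    qed
  qed
  have yG: "{y, v} \<notin> edges G" if "y \<in> ?Y" for y v using edge_verts[OF g, of y v] that y by auto
  have N: "v \<in> nbrs ?H y \<longleftrightarrow> {y, v} \<in> S" if "y \<in> ?Y" for y v unfolding nbrs_def mem_Collect_eq E using yG[OF that] by blast
  have dd: "y1 \<noteq> y2" "y1 \<noteq> y3" "y2 \<noteq> y3" "y2 \<noteq> y1" "y3 \<noteq> y1" "y3 \<noteq> y2"
     "a1 \<noteq> a2" "a1 \<noteq> a3" "a2 \<noteq> a3" using y a by auto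
  have d: "distinct [y1, y2, y3, a1, a2, a3]" using dd ay[OF av(1)] ay[OF av(2)] ay[OF av(3)] by simp
  have "v \<in> nbrs ?H y1 \<longleftrightarrow> v \<in> {y2, y3, a1}" for v
    unfolding N[OF insertI1] S_def using ay[OF av(1)] ay[OF av(2)] ay[OF av(3)] dd
    by (auto simp: doubleton_eq_iff)
  moreover have "v \<in> nbrs ?H y2 \<longleftrightarrow> v \<in> {y1, y3, a2}" for v
    unfolding N[of y2 v, simplified] S_def using ay[OF av(1)] ay[OF av(2)] ay[OF av(3)] dd by (auto simp: doubleton_eq_iff)
  moreover have "v \<in> nbrs ?H y3 \<longleftrightarrow> v \<in> {y1, y2, a3}" for v
    unfolding N[of y3 v, simplified] S_def using ay[OF av(1)] ay[OF av(2)] ay[OF av(3)] dd by (auto simp: doubleton_eq_iff)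
  ultimately show t: "tri ?H y1 y2 y3 a1 a2 a3"
    unfolding tri_def using gH d by blast
  show c: "x \<notin> verts ?H - ?Y" unfolding V by blast
  have gC: "graph (contract ?H ?Y x)" by (rule graph_contract[OF gH c])
  have vC: "verts (contract ?H ?Y x) = verts G" unfolding verts_contract V using x y by auto
  show "contract ?H ?Y x = G"
  proof (rule graph_eqI[OF gC g vC])
    fix u v
    have xn: "{x, v} \<in> edges (contract ?H ?Y x) \<longleftrightarrow> {x, v} \<in> edges G" for v
      using nbrs_contract_tri_new[OF t c] n unfolding nbrs_def by blast
    show "{u, v} \<in> edges (contract ?H ?Y x) \<longleftrightarrow> {u, v} \<in> edges G"
    proof (cases "u \<in> verts G \<and> v \<in> verts G \<and> u \<noteq> x \<and> v \<noteq> x")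
      case True
      then have uvY: "u \<notin> ?Y" "v \<notin> ?Y" using y by auto
      have "{u, v} \<notin> S" using SY[of "{u, v}"] uvY by blast
      then show ?thesis using edge_contract_outside[OF gH c uvY] True E[of u v] by simp
    next
      case False
      then consider "u \<notin> verts G \<or> v \<notin> verts G" | "u = x" | "v = x" by blast
      then show ?thesis
      proof cases
        case 1 then show ?thesis using edge_verts[OF gC, of u v] edge_verts[OF g, of u v] vC by blast
      next
        case 2 then show ?thesis using xn by blast
      next
        case 3 then show ?thesis using xn[of u] by (simp add: insert_commute)
      qed
    qed
  qed
qed

text \<open>Vertices of type \<open>nat\<close> provide fresh names above any bound
  \<open>m\<close>.\<close>

lemma tri_repl_ex:
  fixes G :: "nat graph"
  assumes g: "graph G" and x: "x \<in> verts G" and n: "card (nbrs G x) = 3"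
  obtains H y1 y2 y3 o1 o2 o3 where "tri_repl G H" "tri H y1 y2 y3 o1 o2 o3"
    "x \<notin> verts H - {y1, y2, y3}" "contract H {y1, y2, y3} x = G"
proof -
  obtain a1 a2 a3 where a: "nbrs G x = {a1, a2, a3}" "distinct [a1, a2, a3]"
    using n by (auto simp: card_3_iff)
  obtain m where m: "\<forall>v\<in>verts G. v < m"
    using finite_verts[OF g] finite_nat_set_iff_bounded by blast
  have y: "distinct [m, m + 1, m + 2]" "m \<notin> verts G" "m + 1 \<notin> verts G" "m + 2 \<notin> verts G"
    using m by auto
  have "tri_repl G (expand G x a1 a2 a3 m (m + 1) (m + 2))"
    unfolding tri_repl_def using x a y nbrs_iff_edges_at[OF g, of x a1 a2 a3] expand_def by metis
  then show ?thesis using that expand_tri[OF g x a y] by blast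
qed

text \<open>The tricorn together with its descendants, up to isomorphism: the reflexive closure
  makes this one class closed under expansion, over any vertex type.\<close>

definition tdesc :: "'a graph \<Rightarrow> bool" where
  "tdesc G \<longleftrightarrow> (\<exists>D. tri_repl\<^sup>*\<^sup>* tricorn D \<and> iso G D)"

lemma tdesc_iff: "tdesc G \<longleftrightarrow> iso G tricorn \<or> (\<exists>D. descendant tricorn D \<and> iso G D)"
proof -
  have *: "tri_repl\<^sup>*\<^sup>* tricorn D \<longleftrightarrow> D = tricorn \<or> tri_repl\<^sup>+\<^sup>+ tricorn D" for D
    by (auto dest: rtranclpD intro: tranclp_into_rtranclp)
  show ?thesis unfolding tdesc_def descendant_def * by blast
qed

text \<open>Expand the corresponding vertex of the representative in \<open>nat\<close>; expansions
  of corresponding vertices are isomorphic.\<close>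

lemma tdesc_expand:
  assumes t: "tri G y1 y2 y3 o1 o2 o3" and c: "c \<notin> verts G - {y1, y2, y3}"
    and d: "tdesc (contract G {y1, y2, y3} c)"
  shows "tdesc G"
proof -
  let ?C = "contract G {y1, y2, y3} c"
  obtain D f where D: "tri_repl\<^sup>*\<^sup>* tricorn D" and f: "isom f ?C D"
    using d unfolding tdesc_def iso_iff by blast
  have cv: "c \<in> verts ?C" by simp
  have "inj_on f (nbrs ?C c)"
    by (rule inj_on_subset[OF isomD(4)[OF f]]) (use nbrs_sub[OF isomD(1)[OF f], of c] in blast)
  moreover have "card (nbrs ?C c) = 3"
    using tri_neq[OF t] unfolding nbrs_contract_tri_new[OF t c] by simp
  ultimately have n: "card (nbrs D (f c)) = 3" unfolding isom_nbrs[OF f cv] by (simp add: card_image)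
  have fc: "f c \<in> verts D" using isomD(5)[OF f] cv by blast
  obtain H z1 z2 z3 p1 p2 p3 where H: "tri_repl D H" "tri H z1 z2 z3 p1 p2 p3"
    "f c \<notin> verts H - {z1, z2, z3}" "contract H {z1, z2, z3} (f c) = D"
    using tri_repl_ex[OF isomD(2)[OF f] fc n] by blast
  have f': "isom f ?C (contract H {z1, z2, z3} (f c))" using f H(4) by simp
  obtain h where "isom h G H" by (rule isom_expand_ex[OF t H(2) c H(3) f' refl])
  moreover have "tri_repl\<^sup>*\<^sup>* tricorn H" using D H(1) by (rule rtranclp.rtrancl_into_rtrancl)
  ultimately show ?thesis unfolding tdesc_def iso_iff by blast
qed

text \<open>Allows a level of the cylinder to be stripped while an expanded triangle elsewhere is
  kept.\<close>

lemma contract_commute: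
  assumes "S \<inter> T = {}" "c \<notin> T" "d \<notin> S"
  shows "contract (contract G S c) T d = contract (contract G T d) S c"
proof -
  have E: "edges (contract (contract G S c) T d) =
    {(\<lambda>v. if v \<in> S then c else if v \<in> T then d else v) ` e | e. e \<in> edges G \<and> \<not> e \<subseteq> S \<and> \<not> e \<subseteq> T}"
    if "S \<inter> T = {}" "c \<notin> T" "d \<notin> S" for S T :: "'a set" and c d
  proof -
    have sub: "(\<lambda>v. if v \<in> S then c else v) ` e \<subseteq> T \<longleftrightarrow> e \<subseteq> T" for e
      using that by (auto split: if_splits)
    have comp: "(\<lambda>v. if v \<in> T then d else v) ` (\<lambda>v. if v \<in> S then c else v) ` e =
       (\<lambda>v. if v \<in> S then c else if v \<in> T then d else v) ` e" for e
      unfolding image_image by (rule image_cong[OF refl]) (use that in auto)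
    have "edges (contract (contract G S c) T d) = {(\<lambda>v. if v \<in> T then d else v) ` (\<lambda>v. if v \<in> S then c else v) ` e | e.
      e \<in> edges G \<and> \<not> e \<subseteq> S \<and> \<not> (\<lambda>v. if v \<in> S then c else v) ` e \<subseteq> T}"
      unfolding contract_def graph.select_convs by blast
    then show ?thesis unfolding sub comp .
  qed
  have f: "(\<lambda>v. if v \<in> S then c else if v \<in> T then d else v) = (\<lambda>v. if v \<in> T then d else if v \<in> S then c else v)"
    by (rule ext) (use assms(1) in auto)
  have "edges (contract (contract G S c) T d) = edges (contract (contract G T d) S c)"
    unfolding E[OF assms] E[OF _ assms(3,2), unfolded Int_commute[of T S], OF assms(1)] f by blast
  moreover have "verts (contract (contract G S c) T d) = verts (contract (contract G T d) S c)"
    using assms by auto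
  ultimately show ?thesis by simp
qed

section \<open>The tricorn as an expansion of the one-level cylinder\<close>

lemma graph_tricorn: "graph tricorn"
  unfolding graph_def tricorn_def graph.select_convs ball_simps
  by (intro conjI) (simp | (rule exI, rule exI, rule conjI, rule refl, simp))+

lemma tricorn_edge:
  "{u, v} \<in> edges tricorn \<longleftrightarrow> (u, v) \<in> {(0, 10), (10, 0), (0, 20), (20, 0), (0, 30), (30, 0), (10, 12), (12, 10), (12, 13), (13, 12),
     (10, 13), (13, 10), (20, 21), (21, 20), (21, 23), (23, 21), (20, 23), (23, 20), (30, 31), (31,
     30), (31, 32), (32, 31), (30, 32), (32, 30), (12, 21), (21, 12), (13, 31), (31, 13), (23, 32),
     (32, 23)}"
  unfolding tricorn_def by (simp add: doubleton_eq_iff)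

lemma tri_tricorn: "tri tricorn 30 31 32 0 13 23"
  unfolding tri_def nbrs_def tricorn_edge using graph_tricorn by auto

lemma consec_single:
  assumes "m \<le> 2"
  shows "consec [Suc 0] i l m \<longleftrightarrow> l < m \<and> (l = 0 \<and> m = 2 \<longrightarrow> i = Suc 0)"
proof -
  have "l < r \<and> r < m \<longleftrightarrow> r = 1 \<and> l = 0 \<and> m = 2" for r using assms by linarith
  then show ?thesis unfolding consec_def by auto
qed

lemma verts_cyl_single:
  "verts (cyl [1]) = {(0, 1), (0, 2), (0, 3), (1, 2), (1, 3), (2, 1), (2, 2), (2, 3)}"
proof (rule set_eqI)
  fix p :: "nat \<times> nat"
  obtain l i where p: "p = (l, i)" by fastforce
  have "cyl_vertex [1] l i \<longleftrightarrow> (i = 1 \<or> i = 2 \<or> i = 3) \<and> (l = 0 \<or> l = 2 \<or> l = 1 \<and> i \<noteq> 1)"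
  proof -
    consider "l = 0" | "l = 1" | "l = 2" | "l > 2" by linarith
    then show ?thesis by cases (auto simp: cyl_vertex_def)
  qed
  also have "\<dots> \<longleftrightarrow> (l, i) \<in> {(0, 1), (0, 2), (0, 3), (1, 2), (1, 3), (2, 1), (2, 2), (2, 3)}" by auto
  finally show "p \<in> verts (cyl [1]) \<longleftrightarrow>
      p \<in> {(0, 1), (0, 2), (0, 3), (1, 2), (1, 3), (2, 1), (2, 2), (2, 3)}"
    unfolding p cyl_verts .
qed

text \<open>The end triangles of \<open>cyl [1]\<close> go to the triangles of the tricorn numbered
  1 and 2; the rung goes to the edge between vertex 0 and the third triangle, contracted to
  30.\<close>

definition tricorn_map :: "nat \<times> nat \<Rightarrow> nat" where
  "tricorn_map p = (if p = (0, 1) then 12 else if p = (0, 2) then 13 else if p = (0, 3) then 10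
     else if p = (1, 2) then 30 else if p = (1, 3) then 0
     else if p = (2, 1) then 21 else if p = (2, 2) then 23 else 20)"

lemma edges_contract_tricorn:
  "{u, v} \<in> edges (contract tricorn {30, 31, 32} 30) \<longleftrightarrow>
     (u, v) \<in> {(0, 10), (10, 0), (0, 20), (20, 0), (0, 30), (30, 0), (10, 12), (12, 10), (12, 13), (13, 12),
     (10, 13), (13, 10), (20, 21), (21, 20), (21, 23), (23, 21), (20, 23), (23, 20), (12, 21), (21,
     12), (13, 30), (30, 13), (23, 30), (30, 23)}" (is "_ \<longleftrightarrow> ?R")
proof -
  have c: "30 \<notin> verts tricorn - {30, 31, 32}" by simp
  have gC: "graph (contract tricorn {30, 31, 32} 30)" by (rule graph_contract[OF graph_tricorn c])
  have n: "{30, w} \<in> edges (contract tricorn {30, 31, 32} 30) \<longleftrightarrow> w = 0 \<or> w = 13 \<or> w = 23" for w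
    using nbrs_contract_tri_new[OF tri_tricorn c] unfolding nbrs_def by blast
  consider "u = 30" | "v = 30" | "u = 31 \<or> u = 32 \<or> v = 31 \<or> v = 32" | "u \<notin> {30, 31, 32}" "v \<notin> {30, 31, 32}"
    by auto
  then show ?thesis
  proof cases
    case 1 then show ?thesis unfolding 1 n by auto
  next
    case 2
    have "{u, 30} \<in> edges (contract tricorn {30, 31, 32} 30) \<longleftrightarrow> u = 0 \<or> u = 13 \<or> u = 23"
      using n[of u] by (simp only: insert_commute)
    then show ?thesis unfolding 2 by auto
  next
    case 3
    have vs: "31 \<notin> verts (contract tricorn {30, 31, 32} 30)" "32 \<notin> verts (contract tricorn {30, 31, 32} 30)"
      by simp_all
    have "{u, v} \<notin> edges (contract tricorn {30, 31, 32} 30)"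
    proof
      assume "{u, v} \<in> edges (contract tricorn {30, 31, 32} 30)"
      note uv = edge_verts(2,3)[OF gC this]
      have "x \<in> verts (contract tricorn {30, 31, 32} 30) \<Longrightarrow> x \<noteq> 31 \<and> x \<noteq> 32" for x
        using vs by blast
      from this[OF uv(1)] this[OF uv(2)] show False using 3 by blast
    qed
    moreover have "\<not> ?R" using 3 by (elim disjE; hypsubst; simp)
    ultimately show ?thesis by iprover
  next
    case 4
    then have ne: "u \<noteq> 30" "u \<noteq> 31" "u \<noteq> 32" "v \<noteq> 30" "v \<noteq> 31" "v \<noteq> 32" by simp_all
    have "{u, v} \<in> edges (contract tricorn {30, 31, 32} 30) \<longleftrightarrow> {u, v} \<in> edges tricorn"
      by (rule edge_contract_outside[OF graph_tricorn c 4 ne(1,4)])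
    then show ?thesis
      unfolding tricorn_edge using ne by (simp only: insert_iff prod.inject empty_iff simp_thms)
  qed
qed

lemma isom_tricorn_map: "isom tricorn_map (cyl [1]) (contract tricorn {30, 31, 32} 30)"
proof (rule isomI[OF graph_cyl])
  show "graph (contract tricorn {30, 31, 32} 30)" by (rule graph_contract[OF graph_tricorn]) simp
  have "verts (contract tricorn {30, 31, 32} 30) = {0, 10, 12, 13, 20, 21, 23, 30}"
    by (auto simp: tricorn_def)
  then show "bij_betw tricorn_map (verts (cyl [1])) (verts (contract tricorn {30, 31, 32} 30))"
    unfolding verts_cyl_single bij_betw_def by (simp add: tricorn_map_def insert_commute)
  fix u v assume "u \<in> verts (cyl [1])" "v \<in> verts (cyl [1])"
  then show "({u, v} \<in> edges (cyl [1])) =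
    ({tricorn_map u, tricorn_map v} \<in> edges (contract tricorn {30, 31, 32} 30))"
    unfolding edges_contract_tricorn cyl_edges verts_cyl_single
    by (elim insertE emptyE; simp add: tricorn_map_def cyl_adj_def cyl_vertex_def consec_single)
qed

lemma third_strand:
  assumes "a \<in> {1, 2, 3 :: nat}" "b \<in> {1, 2, 3}" "a \<noteq> b"
  shows "{1, 2, 3} = {a, b, 6 - a - b}" "6 - a - b \<noteq> a" "6 - a - b \<noteq> b"
proof -
  consider "a = 1" "b = 2" | "a = 1" "b = 3" | "a = 2" "b = 1" | "a = 2" "b = 3"
    | "a = 3" "b = 1" | "a = 3" "b = 2" using assms by auto
  then have "{1, 2, 3} = {a, b, 6 - a - b} \<and> 6 - a - b \<noteq> a \<and> 6 - a - b \<noteq> b"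
    by cases auto
  then show "{1, 2, 3} = {a, b, 6 - a - b}" "6 - a - b \<noteq> a" "6 - a - b \<noteq> b" by blast+
qed

text \<open>Strands are interchangeable, so a pattern can be normalised by prescribing two of them;
  the remaining strand is \<open>6 - a - b\<close> since the three sum to 6.\<close>

lemma perm3:
  assumes "a \<in> {1, 2, 3 :: nat}" "b \<in> {1, 2, 3}" "a \<noteq> b" "a' \<in> {1, 2, 3 :: nat}" "b' \<in> {1, 2, 3}" "a' \<noteq> b'"
  obtains \<pi> :: "nat \<Rightarrow> nat" where "bij_betw \<pi> {1, 2, 3} {1, 2, 3}" "\<pi> a = a'" "\<pi> b = b'" "\<pi> (6 - a - b) = 6 - a' - b'"
proof -
  define c c' where "c = 6 - a - b" and "c' = 6 - a' - b'"
  note t = third_strand[OF assms(1-3), folded c_def] and t' = third_strand[OF assms(4-6), folded c'_def]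
  define \<pi> where "\<pi> i = (if i = a then a' else if i = b then b' else c')" for i
  have pi: "\<pi> a = a'" "\<pi> b = b'" "\<pi> c = c'" using assms(3) t by (simp_all add: \<pi>_def)
  have "bij_betw \<pi> {a, b, c} {a', b', c'}"
    unfolding bij_betw_def inj_on_def using pi assms(6) t' by simp
  then have "bij_betw \<pi> {1, 2, 3} {1, 2, 3}" using t(1) t'(1) by simp
  then show ?thesis using pi unfolding c_def c'_def by (rule that)
qed

text \<open>Expanding a vertex that lies on neither end triangle: strip levels from the far end until
  one level is left, where the expansion is the tricorn.\<close>

lemma tdesc_interior:
  assumes "cubic3 G" "tri G y1 y2 y3 o1 o2 o3" "c \<notin> verts G - {y1, y2, y3}"
    "set ss \<subseteq> {1, 2, 3}" "isom f (contract G {y1, y2, y3} c) (cyl ss)"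
    "0 < fst (f c)" "fst (f c) \<le> length ss"
  shows "tdesc G"
  using assms
proof (induction "length ss" arbitrary: G y1 y2 y3 o1 o2 o3 c ss f rule: less_induct)
  case less
  note G = less.prems(1) and t = less.prems(2) and c = less.prems(3) and ss = less.prems(4)
  note f = less.prems(5)
  let ?Y = "{y1, y2, y3}" let ?C = "contract G ?Y c"
  note g = cubic3D(1)[OF G]
  \<comment> \<open>Here \<open>c\<close> lies below the last rung, so after stripping the top level
    its image is still an interior vertex. Preimages of the top and bottom triangles are
    \<open>w\<close> and \<open>u\<close>.\<close>
  have key: "tdesc G" if ss: "set ss \<subseteq> {1, 2, 3}" and f: "isom f ?C (cyl ss)" and l: "0 < fst (f c)" "fst (f c) < length ss"
    and IH: "\<And>(H :: 'a graph) z1 z2 z3 p1 p2 p3 d h. cubic3 H \<Longrightarrow> tri H z1 z2 z3 p1 p2 p3 \<Longrightarrow> d \<notin> verts H - {z1, z2, z3} \<Longrightarrow>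
        isom h (contract H {z1, z2, z3} d) (cyl (butlast ss)) \<Longrightarrow> 0 < fst (h d) \<Longrightarrow>
        fst (h d) \<le> length (butlast ss) \<Longrightarrow> tdesc H" for ss f
  proof -
    obtain ss' s where sn: "ss = ss' @ [s]" using l(2) by (cases ss rule: rev_cases) auto
    have s: "s \<in> {1, 2, 3}" using ss sn by auto
    note d = isomD[OF f]
    have av: "apex ss i \<in> verts (cyl ss)" "(0, i) \<in> verts (cyl ss)" if "i \<in> {1, 2, 3}" for i
      using that unfolding cyl_verts cyl_vertex_def by auto
    define w where "w i = inv_into (verts ?C) f (apex ss i)" for i
    define u where "u i = inv_into (verts ?C) f (0, i)" for i
    have w: "f (w i) = apex ss i" "w i \<in> verts ?C" if "i \<in> {1, 2, 3}" for i
      unfolding w_def using av(1)[OF that] d(5) by (metis f_inv_into_f, metis inv_into_into)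
    have u: "f (u i) = (0, i)" "u i \<in> verts ?C" if "i \<in> {1, 2, 3}" for i
      unfolding u_def using av(2)[OF that] d(5) by (metis f_inv_into_f, metis inv_into_into)
    have wc: "w i \<noteq> c" "u i \<noteq> c" if "i \<in> {1, 2, 3}" for i
      using w(1)[OF that] u(1)[OF that] l sn by auto
    have wV: "w i \<in> verts G - ?Y" "u i \<in> verts G - ?Y" if "i \<in> {1, 2, 3}" for i
      using w(2)[OF that] u(2)[OF that] wc[OF that] by auto
    have une: "u i \<noteq> u j" if "i \<in> {1, 2, 3}" "j \<in> {1, 2, 3}" "i \<noteq> j" for i j
      using u(1)[OF that(1)] u(1)[OF that(2)] that(3) by auto
    have uw: "u i \<noteq> w j" if "i \<in> {1, 2, 3}" "j \<in> {1, 2, 3}" for i j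
      using u(1)[OF that(1)] w(1)[OF that(2)] by auto
    have we: "{w i, w j} \<in> edges G" if ij: "i \<in> {1, 2, 3}" "j \<in> {1, 2, 3}" "i \<noteq> j" for i j
    proof -
      have "cyl_adj ss (apex ss i) (apex ss j)"
        using ij unfolding cyl_adj_top[OF ij(1)] by simp
      then have "{w i, w j} \<in> edges ?C"
        using d(6)[OF w(2)[OF ij(1)] w(2)[OF ij(2)]] w(1)[OF ij(1)] w(1)[OF ij(2)] by (simp add: cyl_edges)
      then show ?thesis
        using edge_contract_outside[OF g c, of "w i" "w j"] wV[OF ij(1)] wV[OF ij(2)] wc[OF ij(1)] wc[OF ij(2)]
        by blast
    qed
    let ?W = "{w 1, w 2, w 3}"
    have YW: "?Y \<inter> ?W = {}" using wV(1)[of 1] wV(1)[of 2] wV(1)[of 3] by auto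
    have YV: "?Y \<subseteq> verts G" by (rule triD(6)[OF t])
    \<comment> \<open>Five vertices guarantee distinct outer neighbours of a triangle; the bound is
      needed for \<open>G\<close> and again for the stripped graph.\<close>
    have five: "card (verts H) \<ge> 5" if "?Y \<union> {u 1, u 2} \<subseteq> verts H" "graph H" for H
    proof -
      have "distinct [y1, y2, y3, u 1, u 2]"
        using tri_neq[OF t] wV(2)[of 1] wV(2)[of 2] une[of 1 2] by auto
      then have "card (set [y1, y2, y3, u 1, u 2]) = 5" by (simp only: distinct_card) simp
      moreover have "set [y1, y2, y3, u 1, u 2] \<subseteq> verts H" using that(1) by auto
      ultimately show ?thesis using card_mono[OF finite_verts[OF that(2)]] by metis
    qed
    have "card (verts G) \<ge> 5" by (rule five[OF _ g]) (use YV wV(2)[of 1] wV(2)[of 2] in auto)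
    then obtain p1 p2 p3 where tw: "tri G (w 1) (w 2) (w 3) p1 p2 p3"
      using tri_of_cubic3[OF G we[of 1 2] we[of 2 3] we[of 1 3]] by auto
    have cw: "w 1 \<notin> verts G - ?W" by simp
    let ?R = "contract G ?W (w 1)"
    have R: "cubic3 ?R" by (rule cubic3_contract_tri[OF G tw cw])
    have yR: "{y, y'} \<in> edges ?R" if "{y, y'} \<in> edges G" "y \<in> ?Y" "y' \<in> ?Y" for y y'
      using edge_contract_outside[OF g cw, of y y'] that YW by blast
    have "card (verts ?R) \<ge> 5"
      by (rule five[OF _ cubic3D(1)[OF R]])
        (use YV YW wV(2)[of 1] wV(2)[of 2] uw[of 1 1] uw[of 1 2] uw[of 1 3] uw[of 2 1] uw[of 2 2] uw[of 2 3] in auto)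
    then obtain q1 q2 q3 where ty: "tri ?R y1 y2 y3 q1 q2 q3"
      using tri_of_cubic3[OF R yR[OF triD(8)[OF t]] yR[OF triD(9)[OF t]] yR[OF triD(10)[OF t]]] by auto
    have cR: "c \<notin> verts ?R - ?Y" using c wc(1)[of 1] by auto
    have com: "contract ?R ?Y c = contract ?C ?W (w 1)"
      by (rule contract_commute) (use YW wc(1) in auto)
    have fW: "f ` ?W = {apex ss 1, apex ss 2, apex ss 3}" using w(1)[of 1] w(1)[of 2] w(1)[of 3] by simp
    have iR: "isom (f(w 1 := apex ss' s)) (contract ?R ?Y c) (cyl ss')"
    proof -
      have "isom (f(w 1 := apex ss' s)) (contract ?C ?W (w 1)) (contract (cyl ss) (f ` ?W) (apex ss' s))"
      proof (rule isom_contract[OF f])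
        show "?W \<subseteq> verts ?C" using w(2)[of 1] w(2)[of 2] w(2)[of 3] by auto
        show "w 1 \<notin> verts ?C - ?W" by simp
        show "apex ss' s \<notin> verts (cyl ss) - f ` ?W" by (simp add: cyl_verts cyl_vertex_snoc sn)
      qed
      then show ?thesis unfolding com fW unfolding sn contract_cyl[OF s] .
    qed
    have "tdesc ?R"
    proof (rule IH[OF R ty cR])
      show "isom (f(w 1 := apex ss' s)) (contract ?R ?Y c) (cyl (butlast ss))" using iR sn by simp
      show "0 < fst ((f(w 1 := apex ss' s)) c)" using l(1) wc(1)[of 1] by simp
      show "fst ((f(w 1 := apex ss' s)) c) \<le> length (butlast ss)" using l(2) wc(1)[of 1] sn by simp
    qed
    then show ?thesis by (rule tdesc_expand[OF tw cw])
  qed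
  \<comment> \<open>Stated for every pattern of the same length, since it serves both
    \<open>ss\<close> and its reversal.\<close>
  have IH: "tdesc H" if "cubic3 H" "tri H z1 z2 z3 p1 p2 p3" "d \<notin> verts H - {z1, z2, z3}"
      "isom h (contract H {z1, z2, z3} d) (cyl (butlast ss'))" "0 < fst (h d)"
      "fst (h d) \<le> length (butlast ss')" "set ss' \<subseteq> {1, 2, 3}" "length ss' = length ss" "ss \<noteq> []"
    for H :: "'a graph" and z1 z2 z3 p1 p2 p3 d h ss'
    by (rule less.hyps[OF _ that(1-3) _ that(4-6)]) (use that(7-9) in \<open>auto dest: in_set_butlastD\<close>)
  have ne: "ss \<noteq> []" using less.prems(6,7) by auto
  consider "fst (f c) < length ss" | "fst (f c) = length ss" "length ss > 1" | "length ss = 1"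
    using less.prems(7) ne by (cases "length ss") fastforce+
  then show ?case
  proof cases
    case 1
    show ?thesis by (rule key[OF ss f less.prems(6) 1]) (rule IH[OF _ _ _ _ _ _ ss refl ne])
  next
    case 2
    \<comment> \<open>On the last rung of at least two, the vertex moves to level 1 when the
      cylinder is turned upside down, and the last level can then be stripped.\<close>
    have f2: "isom (\<lambda>x. flip (length ss) (f x)) ?C (cyl (rev ss))" by (rule isom_trans[OF f isom_cyl_rev])
    have "set (rev ss) \<subseteq> {1, 2, 3}" using ss by simp
    moreover have "0 < fst (flip (length ss) (f c))" "fst (flip (length ss) (f c)) < length (rev ss)"
      using 2 by (simp_all add: flip_def)
    ultimately show ?thesis
      by (rule key[OF _ f2]) (rule IH[OF _ _ _ _ _ _ _ length_rev ne], assumption+, use ss in simp)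
  next
    case 3
    then obtain s where sn: "ss = [s]" by (auto simp: length_Suc_conv)
    have s: "s \<in> {1, 2, 3}" using ss sn by simp
    have fc: "fst (f c) = 1" using less.prems(6,7) 3 by simp
    have "f c \<in> verts (cyl ss)" using isomD(5)[OF f] by auto
    then have j: "snd (f c) \<in> {1, 2, 3}" "s \<noteq> snd (f c)"
      using fc by (auto simp: cyl_def cyl_vertex_def sn)
    obtain \<pi> :: "nat \<Rightarrow> nat" where pi: "bij_betw \<pi> {1, 2, 3} {1, 2, 3}" "\<pi> s = 1" "\<pi> (snd (f c)) = 2"
      using perm3[OF s j(1) j(2), of 1 2] by auto
    \<comment> \<open>The strand of \<open>c\<close> was sent to 2, so that \<open>c\<close> lands
      on 30, the vertex whose expansion is the tricorn.\<close>
    have "isom (\<lambda>x. tricorn_map (fst (f x), \<pi> (snd (f x)))) ?C (contract tricorn {30, 31, 32} 30)"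
      using isom_trans[OF isom_trans[OF f isom_cyl_map[OF pi(1) ss]], of tricorn_map] isom_tricorn_map pi(2)
      by (simp add: sn)
    moreover have "tricorn_map (fst (f c), \<pi> (snd (f c))) = 30" using fc pi(3) by (simp add: tricorn_map_def)
    moreover have "30 \<notin> verts tricorn - {30, 31, 32}" by simp
    ultimately obtain h where "isom h G tricorn"
      using isom_expand_ex[OF t tri_tricorn c] by blast
    then show ?thesis unfolding tdesc_def iso_iff by blast
  qed
qed

subsection \<open>Lonely edges of an explicitly given graph\<close>

text \<open>Edges as pairs in lists, so that the simplifier can evaluate membership and enumerate
  matchings of concrete graphs.\<close>

definition pair_edges :: "('a \<times> 'a) list \<Rightarrow> 'a set set" where
  "pair_edges ps = (\<lambda>(u, v). {u, v}) ` set ps"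

definition listed :: "('a \<times> 'a) list \<Rightarrow> 'a \<times> 'a \<Rightarrow> bool" where
  "listed ps e \<longleftrightarrow> e \<in> set ps \<or> prod.swap e \<in> set ps"

lemma pair_edges_iff: "{u, v} \<in> pair_edges ps \<longleftrightarrow> listed ps (u, v)"
  by (force simp: pair_edges_def listed_def doubleton_eq_iff)

function matchings :: "('a \<times> 'a) list \<Rightarrow> 'a list \<Rightarrow> ('a \<times> 'a) list list" where
  "matchings es [] = [[]]"
| "matchings es (v # vs) =
    concat (map (\<lambda>w. map ((#) (v, w)) (matchings es (remove1 w vs))) (filter (\<lambda>w. listed es (v, w)) vs))"
  by pat_completeness auto
termination by (relation "measure (\<lambda>(es, vs). length vs)") (auto simp: length_remove1)

lemma pm_on_matchings:
  assumes "distinct vs" "\<forall>(u, v)\<in>set es. u \<noteq> v"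
  shows "pm_on (pair_edges es) (set vs) N \<longleftrightarrow> N \<in> pair_edges ` set (matchings es vs)"
  using assms
proof (induction es vs arbitrary: N rule: matchings.induct)
  case (1 es)
  have "e = {}" if "pm_on (pair_edges es) {} N" "e \<in> N" for e using pm_onD(2)[OF that] by blast
  moreover have "{} \<notin> pair_edges es" by (auto simp: pair_edges_def)
  ultimately have "pm_on (pair_edges es) {} N \<longleftrightarrow> N = {}"
    using pm_onD(1) by (fastforce simp: pm_on_def)
  then show ?case by (simp add: pair_edges_def)
next
  case (2 es v vs)
  have ins: "pair_edges ((v, w) # ps) = insert {v, w} (pair_edges ps)" for w ps by (simp add: pair_edges_def)
  have rem: "set (v # vs) - {v, w} = set (remove1 w vs)" for w using 2(2) by auto
  have IH: "pm_on (pair_edges es) (set (v # vs) - {v, w}) N \<longleftrightarrow> N \<in> pair_edges ` set (matchings es (remove1 w vs))"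
    if "w \<in> set vs" "listed es (v, w)" for w N
    unfolding rem by (rule 2(1)) (use that 2(2,3) in auto)
  have mem: "ps \<in> set (matchings es (v # vs)) \<longleftrightarrow> (\<exists>w qs. ps = (v, w) # qs \<and> w \<in> set vs \<and>
      listed es (v, w) \<and> qs \<in> set (matchings es (remove1 w vs)))" for ps by auto
  show ?case
  proof
    assume N: "pm_on (pair_edges es) (set (v # vs)) N"
    have ne: "\<And>a b. (a, b) \<in> set es \<Longrightarrow> a \<noteq> b" using 2(3) by blast
    obtain e where e: "e \<in> N" "v \<in> e" using pm_onD(3)[OF N, of v] by auto
    have eE: "e \<in> pair_edges es" "e \<subseteq> set (v # vs)" using pm_onD(1,2)[OF N] e(1) by auto
    from eE(1) obtain a b where "(a, b) \<in> set es" "e = {a, b}" by (auto simp: pair_edges_def)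
    then obtain w where w: "e = {v, w}" "w \<noteq> v" using e(2) ne[of a b] by fast
    have wv: "w \<in> set vs" "listed es (v, w)"
      using eE w pair_edges_iff[of v w es] by auto
    obtain qs where "qs \<in> set (matchings es (remove1 w vs))" "N - {{v, w}} = pair_edges qs"
      using pm_on_remove[OF N, of v w] IH[OF wv] e(1) w(1) by auto
    moreover have "N = insert {v, w} (N - {{v, w}})" using e(1) w(1) by blast
    ultimately show "N \<in> pair_edges ` set (matchings es (v # vs))" using mem ins wv by (metis image_eqI)
  next
    assume "N \<in> pair_edges ` set (matchings es (v # vs))"
    then obtain w qs where "N = insert {v, w} (pair_edges qs)" "w \<in> set vs" "listed es (v, w)"
      "qs \<in> set (matchings es (remove1 w vs))" using mem ins by auto
    then show "pm_on (pair_edges es) (set (v # vs)) N"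
      using pm_on_insert(1)[of "pair_edges es" "set (v # vs)" v w "pair_edges qs"] IH pair_edges_iff by fastforce
  qed
qed

text \<open>Matchings are compared as edge sets in both directions, so repetitions in the list would
  do no harm.\<close>

fun unique_listed :: "('a \<times> 'a) list list \<Rightarrow> 'a \<times> 'a \<Rightarrow> bool" where
  "unique_listed L e \<longleftrightarrow> (case filter (\<lambda>ps. listed ps e) L of [] \<Rightarrow> False
     | ps # pss \<Rightarrow> list_all (\<lambda>qs. list_all (listed ps) qs \<and> list_all (listed qs) ps) pss)"

lemma pair_edges_eq: "pair_edges ps = pair_edges qs \<longleftrightarrow> list_all (listed qs) ps \<and> list_all (listed ps) qs"
proof -
  have "pair_edges ps \<subseteq> E \<longleftrightarrow> (\<forall>(u, v)\<in>set ps. {u, v} \<in> E)" for ps :: "('a \<times> 'a) list" and E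
    by (auto simp: pair_edges_def)
  then show ?thesis by (simp add: set_eq_subset pair_edges_iff list_all_iff case_prod_beta)
qed

lemma lonely_unique_listed:
  assumes "graph G" "edges G = pair_edges es" "verts G = set vs" "distinct vs"
  shows "lonely G {u, v} \<longleftrightarrow> unique_listed (matchings es vs) (u, v)"
proof -
  have ne: "\<forall>(u, v)\<in>set es. u \<noteq> v"
    using assms(1,2) unfolding graph_def pair_edges_def by (force simp: doubleton_eq_iff)
  have "lonely G {u, v} \<longleftrightarrow> (\<exists>ps\<in>set (matchings es vs). listed ps (u, v) \<and>
      (\<forall>qs\<in>set (matchings es vs). listed qs (u, v) \<longrightarrow> pair_edges qs = pair_edges ps))"
    unfolding lonely_iff[OF assms(1)] unique_pm_def assms(2,3) pm_on_matchings[OF assms(4) ne] pair_edges_iff[symmetric]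
    by blast
  also have "\<dots> \<longleftrightarrow> unique_listed (matchings es vs) (u, v)"
  proof (cases "filter (\<lambda>ps. listed ps (u, v)) (matchings es vs)")
    case Nil
    then show ?thesis by (auto simp: filter_empty_conv)
  next
    case (Cons ps pss)
    have "set (matchings es vs) \<inter> {ps. listed ps (u, v)} = insert ps (set pss)"
      using arg_cong[OF Cons, of set] by auto
    then have "(\<exists>ps\<in>set (matchings es vs). listed ps (u, v) \<and>
      (\<forall>qs\<in>set (matchings es vs). listed qs (u, v) \<longrightarrow> pair_edges qs = pair_edges ps)) \<longleftrightarrow>
      (\<exists>p\<in>insert ps (set pss). \<forall>qs\<in>insert ps (set pss). pair_edges qs = pair_edges p)" by blast
    also have "\<dots> \<longleftrightarrow> (\<forall>qs\<in>set pss. pair_edges ps = pair_edges qs)" by auto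
    finally show ?thesis using Cons by (simp add: pair_edges_eq list_all_iff conj_commute)
  qed
  finally show ?thesis .
qed

definition tricorn_pairs :: "(nat \<times> nat) list" where
  "tricorn_pairs = [(0, 10), (0, 20), (0, 30), (10, 12), (12, 13), (10, 13), (20, 21), (21, 23), (20, 23),
     (30, 31), (31, 32), (30, 32), (12, 21), (13, 31), (23, 32)]"

lemma lonely_edges_listed:
  assumes "graph G" "edges G = pair_edges es" "verts G = set vs" "distinct vs"
  shows "{e \<in> edges G. lonely G e} = pair_edges (filter (unique_listed (matchings es vs)) es)"
  using lonely_unique_listed[OF assms] unfolding assms(2) pair_edges_def
  by (auto simp del: unique_listed.simps)

text \<open>Of the six perfect matchings, each triangle edge opposite to the neighbour of 0 meets
  only one; every other edge lies in two or more.\<close>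

lemma num_lonely_tricorn: "num_lonely tricorn = 3"
proof -
  let ?vs = "[0, 10, 12, 13, 20, 21, 23, 30, 31, 32]"
  have m: "matchings tricorn_pairs ?vs =
    [[(0, 10), (12, 13), (20, 21), (23, 32), (30, 31)], [(0, 10), (12, 21), (13, 31), (20, 23), (30, 32)],
     [(0, 20), (10, 12), (13, 31), (21, 23), (30, 32)], [(0, 20), (10, 13), (12, 21), (23, 32), (30, 31)],
     [(0, 30), (10, 12), (13, 31), (20, 21), (23, 32)], [(0, 30), (10, 13), (12, 21), (20, 23), (31, 32)]]"
    by (simp add: tricorn_pairs_def listed_def)
  have "{e \<in> edges tricorn. lonely tricorn e} = pair_edges (filter (unique_listed (matchings tricorn_pairs ?vs)) tricorn_pairs)"
    by (rule lonely_edges_listed[OF graph_tricorn])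
      (simp_all add: tricorn_def tricorn_pairs_def pair_edges_def)
  also have "filter (unique_listed (matchings tricorn_pairs ?vs)) tricorn_pairs = [(12, 13), (21, 23), (31, 32)]"
    unfolding m by (simp add: tricorn_pairs_def listed_def)
  finally show ?thesis unfolding num_lonely_def by (simp add: pair_edges_def doubleton_eq_iff)
qed

lemma cubic3_four_complete:
  assumes G: "cubic3 G" and c: "card (verts G) = 4" and uw: "u \<in> verts G" "w \<in> verts G" "u \<noteq> w"
  shows "{u, w} \<in> edges G"
proof -
  note g = cubic3D(1)[OF G]
  have "card (verts G - {u}) = 3" using c uw finite_verts[OF g] by simp
  then have "nbrs G u = verts G - {u}"
    using card_subset_eq[of "verts G - {u}" "nbrs G u"] nbrs_sub[OF g, of u] cubic3D(2)[OF G uw(1)]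
      finite_verts[OF g] by simp
  then show ?thesis using uw unfolding nbrs_def by blast
qed

text \<open>The three perfect matchings of \<open>K4\<close> are disjoint, so all six edges are
  lonely.\<close>

lemma num_lonely_four:
  assumes G: "cubic3 G" and c: "card (verts G) = 4"
  shows "num_lonely G \<noteq> 3"
proof -
  note g = cubic3D(1)[OF G]
  obtain vs where vs: "set vs = verts G" "distinct vs" using finite_distinct_list[OF finite_verts[OF g]] by blast
  then have "length vs = 4" using c distinct_card[of vs] by simp
  then obtain x y z w where vs': "vs = [x, y, z, w]" by (auto simp: length_Suc_conv eval_nat_numeral)
  define es where "es = [(x, y), (x, z), (x, w), (y, z), (y, w), (z, w)]"
  have d: "x \<noteq> y" "x \<noteq> z" "x \<noteq> w" "y \<noteq> z" "y \<noteq> w" "z \<noteq> w" using vs(2) vs' by auto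
  have e: "{u, v} \<in> edges G \<longleftrightarrow> v \<in> set vs \<and> v \<noteq> u" if "u \<in> set vs" for u v
    using cubic3_four_complete[OF G c] edge_verts[OF g, of u v] that unfolding vs(1) by blast
  have E: "edges G = pair_edges es"
  proof
    show "edges G \<subseteq> pair_edges es"
    proof
      fix p assume p: "p \<in> edges G"
      then obtain u v where uv: "p = {u, v}" "u \<noteq> v" "u \<in> verts G" "v \<in> verts G" by (rule graph_edgeE[OF g])
      then show "p \<in> pair_edges es"
        unfolding uv(1) pair_edges_iff vs(1)[symmetric] vs' es_def listed_def by auto
    qed
    show "pair_edges es \<subseteq> edges G" unfolding pair_edges_def es_def using d by (simp add: e vs')
  qed
  have m: "matchings es vs = [[(x, y), (z, w)], [(x, z), (y, w)], [(x, w), (y, z)]]"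
    unfolding vs' es_def using d d[symmetric] by (simp add: listed_def)
  have "filter (unique_listed (matchings es vs)) es = es"
    unfolding m unfolding es_def using d d[symmetric] by (simp add: listed_def)
  then have "num_lonely G = card (pair_edges es)"
    using lonely_edges_listed[OF g E vs(1)[symmetric] vs(2)] by (simp add: num_lonely_def)
  also have "\<dots> = 6" unfolding pair_edges_def es_def using d by (simp add: doubleton_eq_iff)
  finally show ?thesis by simp
qed

subsection \<open>Graphs with a lonely edge\<close>

text \<open>Contracting the triangle of \<open>lonely_contract\<close> keeps a lonely edge, so by induction the
  contracted graph is known, and only the position of the contracted vertex matters.\<close>

lemma lonely_structure:
  assumes "cubic3 G" "lonely G e"
  shows "card (verts G) = 4 \<or> (\<exists>ss f. set ss \<subseteq> {1, 2, 3} \<and> isom f G (cyl ss)) \<or> tdesc G"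
  using assms
proof (induction "card (verts G)" arbitrary: G rule: less_induct)
  case less
  note G = less.prems(1) and g = cubic3D(1)[OF less.prems(1)]
  show ?case
  proof (cases "card (verts G) = 4")
    case False
    then have c5: "card (verts G) \<ge> 5" using cubic3D(3)[OF G] by simp
    obtain y1 y2 y3 o1 o2 o3 where t: "tri G y1 y2 y3 o1 o2 o3"
      and l: "lonely (contract G {y1, y2, y3} y1) e"
      by (rule lonely_contract[OF G less.prems(2) c5])
    let ?Y = "{y1, y2, y3}" let ?C = "contract G ?Y y1"
    have c: "y1 \<notin> verts G - ?Y" by simp
    have C: "cubic3 ?C" by (rule cubic3_contract_tri[OF G t c])
    have "y2 \<notin> verts ?C" "verts ?C \<subseteq> verts G" "y2 \<in> verts G"
      using tri_neq[OF t] triD(6)[OF t] by auto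
    then have "verts ?C \<subset> verts G" by blast
    then have lt: "card (verts ?C) < card (verts G)" by (rule psubset_card_mono[OF finite_verts[OF g]])
    from less.hyps[OF lt C l] show ?thesis
    proof (elim disjE exE conjE)
      \<comment> \<open>Any bijection between copies of \<open>K4\<close> is an isomorphism, so the
        contracted vertices can be made to correspond, and \<open>G\<close> is the prism.\<close>
      assume c4: "card (verts ?C) = 4"
      have oV: "o1 \<in> verts ?C" "o2 \<in> verts ?C" "o3 \<in> verts ?C" using triD(7)[OF t] by auto
      have d: "distinct [o1, o2, o3, y1]" using tri_neq[OF t] by auto
      then have "card (set [o1, o2, o3, y1]) = 4" by (simp only: distinct_card) simp
      moreover have "set [o1, o2, o3, y1] \<subseteq> verts ?C" using oV by auto
      ultimately have VC: "verts ?C = {o1, o2, o3, y1}"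
        using card_seteq[OF finite_verts[OF cubic3D(1)[OF C]], of "set [o1, o2, o3, y1]"] c4 by auto
      define h :: "'a \<Rightarrow> nat \<times> nat"
        where "h v = (if v = y1 then (1, 1) else if v = o1 then (0, 1) else if v = o2 then (0, 2) else (0, 3))" for v
      let ?D = "contract (cyl []) {apex [] 1, apex [] 2, apex [] 3} (1, 1)"
      have hv: "h o1 = (0, 1)" "h o2 = (0, 2)" "h o3 = (0, 3)" "h y1 = (1, 1)"
        using d by (auto simp: h_def)
      have bij: "bij_betw h (verts ?C) (verts ?D)"
        unfolding VC contract_prism(2) bij_betw_def inj_on_def by (simp add: hv)
      have ih: "isom h ?C ?D"
      proof (rule isomI[OF cubic3D(1)[OF C] contract_prism(1) bij])
        fix u v assume uv: "u \<in> verts ?C" "v \<in> verts ?C"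
        then have huv: "h u \<in> verts ?D" "h v \<in> verts ?D" "h u = h v \<longleftrightarrow> u = v"
          using bij by (auto simp: bij_betw_def inj_on_def simp del: verts_contract)
        show "({u, v} \<in> edges ?C) = ({h u, h v} \<in> edges ?D)"
        proof (cases "u = v")
          case True
          then show ?thesis
            using edge_verts(1)[OF cubic3D(1)[OF C], of u u] edge_verts(1)[OF contract_prism(1), of "h u" "h u"] by blast
        next
          case F: False
          then show ?thesis
            using cubic3_four_complete[OF C c4 uv F] contract_prism(3)[OF huv(1,2)] huv(3) by blast
        qed
      qed
      have c': "(1, 1) \<notin> verts (cyl []) - {apex [] 1, apex [] 2, apex [] 3}" by simp
      obtain k where "isom k G (cyl [])" by (rule isom_expand_ex[OF t tri_cyl c c' ih hv(4)])
      then have "\<exists>ss f. set ss \<subseteq> {1, 2, 3} \<and> isom f G (cyl ss)" by (intro exI[of _ "[]"]) auto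
      then show ?thesis by blast
    next
      fix ss f assume ss: "set ss \<subseteq> {1, 2, 3}" and f: "isom f ?C (cyl ss)"
      \<comment> \<open>Expanding the apex on strand \<open>s\<close> is an extension of index
        \<open>s\<close>, which appends \<open>s\<close> to the pattern.\<close>
      have top: "\<exists>ss f. set ss \<subseteq> {1, 2, 3} \<and> isom f G (cyl ss)"
        if ss: "set ss \<subseteq> {1, 2, 3}" and f: "isom f ?C (cyl ss)" and l: "fst (f y1) = Suc (length ss)" for ss f
      proof -
        have fv: "f y1 \<in> verts (cyl ss)" using isomD(5)[OF f] by auto
        define s where "s = snd (f y1)"
        have s: "s \<in> {1, 2, 3}" using fv unfolding s_def cyl_def cyl_vertex_def by simp
        have fy: "f y1 = apex ss s" using l by (simp add: s_def prod_eq_iff)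
        let ?T = "{apex (ss @ [s]) 1, apex (ss @ [s]) 2, apex (ss @ [s]) 3}"
        have c': "apex ss s \<notin> verts (cyl (ss @ [s])) - ?T" by (simp add: cyl_verts cyl_vertex_snoc)
        have i: "isom f ?C (contract (cyl (ss @ [s])) ?T (apex ss s))" unfolding contract_cyl[OF s] by (rule f)
        obtain k where "isom k G (cyl (ss @ [s]))" by (rule isom_expand_ex[OF t tri_cyl c c' i fy])
        moreover have "set (ss @ [s]) \<subseteq> {1, 2, 3}" using ss s by simp
        ultimately show ?thesis by blast
      qed
      have fv: "f y1 \<in> verts (cyl ss)" using isomD(5)[OF f] by auto
      then have "fst (f y1) \<le> Suc (length ss)" by (simp add: cyl_def cyl_vertex_def)
      then consider "fst (f y1) = 0" | "fst (f y1) = Suc (length ss)" | "0 < fst (f y1)" "fst (f y1) \<le> length ss"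
        by linarith
      then show ?thesis
      proof cases
        case 1
        have "isom (\<lambda>x. flip (length ss) (f x)) ?C (cyl (rev ss))" by (rule isom_trans[OF f isom_cyl_rev])
        moreover have "fst (flip (length ss) (f y1)) = Suc (length (rev ss))" using 1 by (simp add: flip_def)
        moreover have "set (rev ss) \<subseteq> {1, 2, 3}" using ss by simp
        ultimately show ?thesis using top[of "rev ss" "\<lambda>x. flip (length ss) (f x)"] by blast
      next
        case 2 then show ?thesis using top[OF ss f] by blast
      next
        case 3 then show ?thesis using tdesc_interior[OF G t c ss f] by blast
      qed
    next
      assume "tdesc ?C"
      then show ?thesis using tdesc_expand[OF t c] by blast
    qed
  qed simp
qed

lemma cubic3_tricorn: "cubic3 tricorn"
proof (rule cubic3_expand[OF tri_tricorn])
  show "30 \<notin> verts tricorn - {30, 31, 32}" by simp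
  show "cubic3 (contract tricorn {30, 31, 32} 30)"
    by (rule isom_cubic3[OF isom_tricorn_map cubic3_cyl]) simp
qed

subsection \<open>Lonely edges of the cylinder\<close>

text \<open>With \<open>F\<close> empty this counts all matchings of \<open>X\<close>, with
  \<open>F = {e}\<close> those through \<open>e\<close>; one recursion then serves both.\<close>

definition cnt :: "'a set set \<Rightarrow> 'a set \<Rightarrow> 'a set set \<Rightarrow> nat" where
  "cnt E X F = card {N. pm_on E X N \<and> F \<subseteq> N}"

lemma cnt_force:
  assumes uv: "{u, v} \<in> E" "u \<in> X" "v \<in> X" and F: "{u, v} \<notin> F"
  shows "cnt E X (insert {u, v} F) = cnt E (X - {u, v}) F"
  unfolding cnt_def
proof (rule bij_betw_same_card[of "\<lambda>N. N - {{u, v}}"],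
    rule bij_betw_byWitness[where f' = "insert {u, v}"])
  show "\<forall>N\<in>{N. pm_on E X N \<and> insert {u, v} F \<subseteq> N}. insert {u, v} (N - {{u, v}}) = N" by blast
  show "\<forall>N\<in>{N. pm_on E (X - {u, v}) N \<and> F \<subseteq> N}. insert {u, v} N - {{u, v}} = N"
    using pm_on_insert(2)[OF _ uv] by auto
  show "(\<lambda>N. N - {{u, v}}) ` {N. pm_on E X N \<and> insert {u, v} F \<subseteq> N} \<subseteq> {N. pm_on E (X - {u, v}) N \<and> F \<subseteq> N}"
    using pm_on_remove F by fastforce
  show "insert {u, v} ` {N. pm_on E (X - {u, v}) N \<and> F \<subseteq> N} \<subseteq> {N. pm_on E X N \<and> insert {u, v} F \<subseteq> N}"
    using pm_on_insert(1)[OF _ uv] by auto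
qed

lemma cnt_zero: "e \<in> F \<Longrightarrow> \<not> e \<subseteq> X \<Longrightarrow> cnt E X F = 0"
proof -
  assume "e \<in> F" "\<not> e \<subseteq> X"
  then have "{N. pm_on E X N \<and> F \<subseteq> N} = {}" using pm_onD(2) by fastforce
  then show ?thesis unfolding cnt_def by (simp only: card.empty)
qed

lemma cnt_empty:
  assumes "graph G"
  shows "cnt (edges G) {} {} = 1"
proof -
  have "{} \<notin> edges G" using assms by (auto elim: graph_edgeE)
  have "e \<notin> N" if "pm_on (edges G) {} N" for N e
  proof
    assume "e \<in> N"
    then have "e \<in> edges G" "e \<subseteq> {}" using pm_onD(1,2)[OF that] by blast+
    then show False using \<open>{} \<notin> edges G\<close> by simp
  qed
  then have "N = {}" if "pm_on (edges G) {} N" for N using that by blast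
  moreover have "pm_on (edges G) {} {}" by (simp add: pm_on_def)
  ultimately have "{N. pm_on (edges G) {} N \<and> {} \<subseteq> N} = {{}}" by blast
  then show ?thesis by (simp add: cnt_def)
qed

lemma pm_on_at:
  assumes g: "graph G" and N: "pm_on (edges G) X N" and v: "v \<in> X"
  obtains w where "{v, w} \<in> N" "w \<in> nbrs G v \<inter> X" "\<And>z. {v, z} \<in> N \<Longrightarrow> z = w"
proof -
  obtain e where e: "e \<in> N" "v \<in> e" "\<And>e'. e' \<in> N \<Longrightarrow> v \<in> e' \<Longrightarrow> e' = e"
    using pm_onD(3)[OF N v] by blast
  have eE: "e \<in> edges G" using e(1) pm_onD(1)[OF N] by blast
  then obtain w where w: "e = {v, w}" using edge_in_iff[OF g _ e(2)] by blast
  have "w \<in> nbrs G v \<inter> X" using eE w pm_onD(2)[OF N e(1)] by (simp add: nbrs_def)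
  moreover have "z = w" if "{v, z} \<in> N" for z
    using e(3)[OF that] w by (auto simp: doubleton_eq_iff)
  ultimately show ?thesis using that e(1) w by blast
qed

text \<open>Matchings are sorted by the partner of \<open>v\<close>; forcing an edge amounts to
  deleting its two ends.\<close>

lemma cnt_branch:
  assumes g: "graph G" and v: "v \<in> X" and F: "\<And>w. w \<in> nbrs G v \<inter> X \<Longrightarrow> {v, w} \<notin> F"
  shows "cnt (edges G) X F = (\<Sum>w\<in>nbrs G v \<inter> X. cnt (edges G) (X - {v, w}) F)"
proof -
  let ?S = "\<lambda>F. {N. pm_on (edges G) X N \<and> F \<subseteq> N}"
  have fin: "finite (?S F)" for F
    by (rule finite_subset[of _ "Pow (edges G)"]) (use pm_onD(1) finite_edges[OF g] in auto)
  have dis: "?S (insert {v, w} F) \<inter> ?S (insert {v, z} F) = {}" if "w \<noteq> z" for w z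
  proof (rule ccontr)
    assume "?S (insert {v, w} F) \<inter> ?S (insert {v, z} F) \<noteq> {}"
    then obtain N where N: "pm_on (edges G) X N" "{v, w} \<in> N" "{v, z} \<in> N" by blast
    obtain y where "{v, y} \<in> N" "y \<in> nbrs G v \<inter> X" "\<And>z. {v, z} \<in> N \<Longrightarrow> z = y"
      using pm_on_at[OF g N(1) v] by blast
    then show False using N that by blast
  qed
  have "?S F = (\<Union>w\<in>nbrs G v \<inter> X. ?S (insert {v, w} F))"
  proof
    show "?S F \<subseteq> (\<Union>w\<in>nbrs G v \<inter> X. ?S (insert {v, w} F))"
    proof
      fix N assume N: "N \<in> ?S F"
      then have "pm_on (edges G) X N" by simp
      then obtain w where "{v, w} \<in> N" "w \<in> nbrs G v \<inter> X" by (rule pm_on_at[OF g _ v])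
      then show "N \<in> (\<Union>w\<in>nbrs G v \<inter> X. ?S (insert {v, w} F))" using N by auto
    qed
  qed auto
  then have "card (?S F) = card (\<Union>w\<in>nbrs G v \<inter> X. ?S (insert {v, w} F))" by (rule arg_cong)
  also have "\<dots> = (\<Sum>w\<in>nbrs G v \<inter> X. card (?S (insert {v, w} F)))"
    by (intro card_UN_disjoint ballI impI fin dis) (use finite_nbrs[OF g, of v] in simp_all)
  also have "\<dots> = (\<Sum>w\<in>nbrs G v \<inter> X. cnt (edges G) (X - {v, w}) F)"
  proof (rule sum.cong[OF refl])
    fix w assume w: "w \<in> nbrs G v \<inter> X"
    then show "card (?S (insert {v, w} F)) = cnt (edges G) (X - {v, w}) F"
      using cnt_force[of v w "edges G" X F] v F[OF w] by (simp add: nbrs_def cnt_def)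
  qed
  finally show ?thesis by (simp only: cnt_def)
qed

lemma cnt_one:
  assumes "graph G" "v \<in> X" "nbrs G v \<inter> X = {w}" "{v, w} \<notin> F"
  shows "cnt (edges G) X F = cnt (edges G) (X - {v, w}) F"
  using cnt_branch[OF assms(1,2), of F] assms(3,4) by simp

lemma cnt_two:
  assumes "graph G" "v \<in> X" "nbrs G v \<inter> X = {a, b}" "a \<noteq> b" "{v, a} \<notin> F" "{v, b} \<notin> F"
  shows "cnt (edges G) X F = cnt (edges G) (X - {v, a}) F + cnt (edges G) (X - {v, b}) F"
  using cnt_branch[OF assms(1,2), of F] assms(3-6) by auto

lemma cnt_contract:
  assumes "graph G" "c \<notin> verts G - S" "X \<subseteq> verts G - S"
  shows "cnt (edges (contract G S c)) X F = cnt (edges G) X F"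
  unfolding cnt_def pm_on_contract[OF assms] ..

lemma cnt_tri_one:
  assumes t: "tri G xs xj xk ps pj pk" and F: "{xk, pk} \<notin> F"
  shows "cnt (edges G) (verts G - {xs, xj}) F = cnt (edges G) (verts G - {xs, xj, xk} - {pk}) F"
proof -
  note ne = tri_neq[OF t] and V = triD(6,7)[OF t]
  have n: "nbrs G xk \<inter> (verts G - {xs, xj}) = {pk}" unfolding triD(5)[OF t] using ne V by auto
  have "cnt (edges G) (verts G - {xs, xj}) F = cnt (edges G) (verts G - {xs, xj} - {xk, pk}) F"
    by (rule cnt_one[OF triD(1)[OF t] _ n F]) (use ne V in auto)
  also have "verts G - {xs, xj} - {xk, pk} = verts G - {xs, xj, xk} - {pk}" by blast
  finally show ?thesis .
qed

text \<open>The vertex \<open>xj\<close> is matched either with \<open>xk\<close>, or with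
  \<open>pj\<close>, in which case \<open>xk\<close> has only \<open>pk\<close> left.\<close>

lemma cnt_tri_two:
  assumes t: "tri G xs xj xk ps pj pk" and F: "{xj, xk} \<notin> F" "{xj, pj} \<notin> F" "{xk, pk} \<notin> F"
  shows "cnt (edges G) (verts G - {xs, ps}) F = cnt (edges G) (verts G - {xs, xj, xk} - {ps}) F +
    cnt (edges G) (verts G - {xs, xj, xk} - {ps, pj, pk}) F"
proof -
  note g = triD(1)[OF t] and ne = tri_neq[OF t] and V = triD(6,7)[OF t]
  let ?X = "verts G - {xs, ps}"
  have n: "nbrs G xj \<inter> ?X = {xk, pj}" unfolding triD(4)[OF t] using ne V by auto
  have 1: "cnt (edges G) ?X F = cnt (edges G) (?X - {xj, xk}) F + cnt (edges G) (?X - {xj, pj}) F"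
    by (rule cnt_two[OF g _ n]) (use ne V F in auto)
  have n': "nbrs G xk \<inter> (?X - {xj, pj}) = {pk}" unfolding triD(5)[OF t] using ne V by auto
  have 2: "cnt (edges G) (?X - {xj, pj}) F = cnt (edges G) (?X - {xj, pj} - {xk, pk}) F"
    by (rule cnt_one[OF g _ n' F(3)]) (use ne V in auto)
  have "?X - {xj, xk} = verts G - {xs, xj, xk} - {ps}"
    "?X - {xj, pj} - {xk, pk} = verts G - {xs, xj, xk} - {ps, pj, pk}" by blast+
  then show ?thesis using 1 2 by simp
qed

text \<open>Counts through an edge at the triangle. The first and the last two items feed the
  extension step, the second and third the edges of the finished top triangle.\<close>

lemma cnt_tri_inner:
  assumes t: "tri G xs xj xk ps pj pk"
  shows "cnt (edges G) (verts G - {xs, ps}) {{xj, xk}} = cnt (edges G) (verts G - {xs, xj, xk} - {ps}) {}"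
    "cnt (edges G) (verts G) {{xj, xk}} = cnt (edges G) (verts G - {xs, xj, xk} - {ps}) {}"
    "cnt (edges G) (verts G) {{xs, ps}} = cnt (edges G) (verts G - {xs, xj, xk} - {ps}) {} +
       cnt (edges G) (verts G - {xs, xj, xk} - {ps, pj, pk}) {}"
    "cnt (edges G) (verts G - {xs, ps}) {{xj, pj}} = cnt (edges G) (verts G - {xs, xj, xk} - {ps, pj, pk}) {}"
    "cnt (edges G) (verts G - {xs, xk}) {{xj, pj}} = cnt (edges G) (verts G - {xs, xj, xk} - {pj}) {}"
proof -
  note g = triD(1)[OF t] and ne = tri_neq[OF t] and V = triD(6,7)[OF t]
  let ?W = "verts G - {xs, xj, xk}"
  have "verts G - {xs, ps} - {xj, xk} = ?W - {ps}" by blast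
  then show "cnt (edges G) (verts G - {xs, ps}) {{xj, xk}} = cnt (edges G) (?W - {ps}) {}"
    using cnt_force[of xj xk "edges G" "verts G - {xs, ps}" "{}"] triD(9)[OF t] ne V by simp
  have "verts G - {xj, xk, xs} - {ps} = ?W - {ps}" by blast
  then show "cnt (edges G) (verts G) {{xj, xk}} = cnt (edges G) (?W - {ps}) {}"
    using cnt_force[of xj xk "edges G" "verts G" "{}"] triD(9)[OF t] V
      cnt_tri_one[OF tri_perm(2)[OF t], of "{}"] by simp
  show "cnt (edges G) (verts G) {{xs, ps}} = cnt (edges G) (?W - {ps}) {} + cnt (edges G) (?W - {ps, pj, pk}) {}"
    using cnt_force[of xs ps "edges G" "verts G" "{}"] triD(11)[OF t] V cnt_tri_two[OF t, of "{}"] by simp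
  have n': "nbrs G xk \<inter> (verts G - {xs, ps} - {xj, pj}) = {pk}" unfolding triD(5)[OF t] using ne V by auto
  have "cnt (edges G) (verts G - {xs, ps} - {xj, pj}) {} = cnt (edges G) (verts G - {xs, ps} - {xj, pj} - {xk, pk}) {}"
    by (rule cnt_one[OF g _ n']) (use ne V in auto)
  moreover have "verts G - {xs, ps} - {xj, pj} - {xk, pk} = ?W - {ps, pj, pk}" by blast
  ultimately show "cnt (edges G) (verts G - {xs, ps}) {{xj, pj}} = cnt (edges G) (?W - {ps, pj, pk}) {}"
    using cnt_force[of xj pj "edges G" "verts G - {xs, ps}" "{}"] triD(12)[OF t] ne V by simp
  have "verts G - {xs, xk} - {xj, pj} = ?W - {pj}" by blast
  then show "cnt (edges G) (verts G - {xs, xk}) {{xj, pj}} = cnt (edges G) (?W - {pj}) {}"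
    using cnt_force[of xj pj "edges G" "verts G - {xs, xk}" "{}"] triD(12)[OF t] ne V by simp
qed

text \<open>A perfect matching meets the triangle in one edge, leaving one port to be covered from
  above, or in none, leaving all three.\<close>

lemma cnt_tri_all:
  assumes t: "tri G x1 x2 x3 p1 p2 p3" and F: "\<And>e. e \<in> F \<Longrightarrow> e \<subseteq> verts G - {x1, x2, x3}"
  shows "cnt (edges G) (verts G) F = cnt (edges G) (verts G - {x1, x2, x3} - {p1}) F +
    cnt (edges G) (verts G - {x1, x2, x3} - {p2}) F + cnt (edges G) (verts G - {x1, x2, x3} - {p3}) F +
    cnt (edges G) (verts G - {x1, x2, x3} - {p1, p2, p3}) F"
proof -
  note g = triD(1)[OF t] and ne = tri_neq[OF t] and V = triD(6,7)[OF t]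
  have no: "{x, z} \<notin> F" if "x \<in> {x1, x2, x3}" for x z using F that by blast
  have n: "nbrs G x1 \<inter> verts G = {x2, x3, p1}" unfolding triD(3)[OF t] using V by auto
  have "cnt (edges G) (verts G) F = (\<Sum>w\<in>{x2, x3, p1}. cnt (edges G) (verts G - {x1, w}) F)"
    using cnt_branch[OF g, of x1 "verts G" F] no V unfolding n by simp
  also have "\<dots> = cnt (edges G) (verts G - {x1, x2}) F + cnt (edges G) (verts G - {x1, x3}) F +
      cnt (edges G) (verts G - {x1, p1}) F"
    using ne by simp
  finally have "cnt (edges G) (verts G) F = cnt (edges G) (verts G - {x1, x2}) F +
      cnt (edges G) (verts G - {x1, x3}) F + cnt (edges G) (verts G - {x1, p1}) F" .
  moreover have nF: "{x2, x3} \<notin> F" "{x2, p2} \<notin> F" "{x3, p3} \<notin> F" using no by simp_all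
  moreover have "verts G - {x1, x3, x2} = verts G - {x1, x2, x3}" by blast
  ultimately show ?thesis
    using cnt_tri_one[OF t nF(3)] cnt_tri_one[OF tri_perm(3)[OF t] nF(2)] cnt_tri_two[OF t nF]
    by simp
qed

lemma lonely_cnt:
  assumes g: "graph G"
  shows "lonely G e \<longleftrightarrow> e \<in> edges G \<and> cnt (edges G) (verts G) {e} = 1"
  unfolding lonely_def cnt_def perfect_matching_pm_on[OF g] by simp

definition core :: "nat list \<Rightarrow> (nat \<times> nat) set" where
  "core ss = verts (cyl ss) - {apex ss 1, apex ss 2, apex ss 3}"

text \<open>Numbers of matchings of the cylinder without its top triangle that leave exactly one port,
  respectively all three ports, to be matched from above.\<close>

definition cn :: "nat list \<Rightarrow> nat \<Rightarrow> (nat \<times> nat) set set \<Rightarrow> nat" where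
  "cn ss i F = cnt (edges (cyl ss)) (core ss - {port ss i}) F"

definition cn0 :: "nat list \<Rightarrow> (nat \<times> nat) set set \<Rightarrow> nat" where
  "cn0 ss F = cnt (edges (cyl ss)) (core ss - {port ss 1, port ss 2, port ss 3}) F"

lemma perm_cases:
  assumes "{s, j, k} = {1, 2, 3 :: nat}" "distinct [s, j, k]"
  obtains "s = 1" "j = 2" "k = 3" | "s = 1" "j = 3" "k = 2" | "s = 2" "j = 1" "k = 3"
    | "s = 2" "j = 3" "k = 1" | "s = 3" "j = 1" "k = 2" | "s = 3" "j = 2" "k = 1"
proof -
  have "s \<in> {1, 2, 3}" "j \<in> {1, 2, 3}" "k \<in> {1, 2, 3}" using assms(1) by blast+
  then have "s = 1 \<or> s = 2 \<or> s = 3" "j = 1 \<or> j = 2 \<or> j = 3" "k = 1 \<or> k = 2 \<or> k = 3" by simp_all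
  then show ?thesis using assms(2) that by (elim disjE) simp_all
qed

lemma tri_cyl_perm:
  assumes "{s, j, k} = {1, 2, 3 :: nat}" "distinct [s, j, k]"
  shows "tri (cyl ss) (apex ss s) (apex ss j) (apex ss k) (port ss s) (port ss j) (port ss k)"
  by (rule perm_cases[OF assms]) (use tri_cyl[of ss] tri_perm[OF tri_cyl[of ss]] in simp_all)

lemma core_perm:
  assumes "{s, j, k} = {1, 2, 3 :: nat}"
  shows "core ss = verts (cyl ss) - {apex ss s, apex ss j, apex ss k}"
    "cn0 ss F = cnt (edges (cyl ss)) (core ss - {port ss s, port ss j, port ss k}) F"
proof -
  have "(\<lambda>i. f i) ` {s, j, k} = f ` {1, 2, 3}" for f :: "nat \<Rightarrow> nat \<times> nat" by (simp only: assms)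
  then have *: "{f s, f j, f k} = {f 1, f 2, f 3}" for f :: "nat \<Rightarrow> nat \<times> nat" by simp
  show "core ss = verts (cyl ss) - {apex ss s, apex ss j, apex ss k}"
    unfolding core_def *[of "apex ss"] ..
  show "cn0 ss F = cnt (edges (cyl ss)) (core ss - {port ss s, port ss j, port ss k}) F"
    unfolding cn0_def *[of "port ss"] ..
qed

text \<open>Contraction of the new top triangle identifies the new core with \<open>cyl ss\<close>
  minus \<open>apex ss s\<close>. The new ports are the old port of \<open>s\<close> and the two old
  apexes on the other strands.\<close>

lemma cn_snoc:
  assumes sjk: "{s, j, k} = {1, 2, 3 :: nat}" "distinct [s, j, k]"
  shows "core (ss @ [s]) = verts (cyl ss) - {apex ss s}"
    "cn (ss @ [s]) s F = cnt (edges (cyl ss)) (verts (cyl ss) - {apex ss s, port ss s}) F"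
    "cn (ss @ [s]) j F = cnt (edges (cyl ss)) (verts (cyl ss) - {apex ss s, apex ss j}) F"
    "cn (ss @ [s]) k F = cnt (edges (cyl ss)) (verts (cyl ss) - {apex ss s, apex ss k}) F"
    "cn0 (ss @ [s]) F = cn ss s F"
    "\<And>e. e \<subseteq> core (ss @ [s]) \<Longrightarrow> e \<in> edges (cyl (ss @ [s])) \<longleftrightarrow> e \<in> edges (cyl ss)"
proof -
  have s: "s \<in> {1, 2, 3}" using sjk by auto
  let ?G = "cyl (ss @ [s])" and ?T = "{apex (ss @ [s]) 1, apex (ss @ [s]) 2, apex (ss @ [s]) 3}"
  have c: "apex ss s \<notin> verts ?G - ?T" by (simp add: cyl_verts cyl_vertex_snoc)
  have con: "contract ?G ?T (apex ss s) = cyl ss" by (rule contract_cyl[OF s])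
  have cs: "core (ss @ [s]) = verts ?G - ?T" by (simp add: core_def)
  have V: "verts (cyl ss) = insert (apex ss s) (core (ss @ [s]))"
    unfolding cs con[symmetric] by simp
  have "apex ss s \<notin> core (ss @ [s])" unfolding cs by (rule c)
  from Diff_insert_absorb[OF this]
  show core: "core (ss @ [s]) = verts (cyl ss) - {apex ss s}" by (simp only: V)
  have E: "cnt (edges ?G) X F = cnt (edges (cyl ss)) X F" if "X \<subseteq> core (ss @ [s])" for X F
    using cnt_contract[OF graph_cyl c, of X F] that unfolding con cs by simp
  have p: "port (ss @ [s]) s = port ss s" "port (ss @ [s]) j = apex ss j" "port (ss @ [s]) k = apex ss k"
    using sjk(2) by (auto simp: port_snoc)
  have d2: "A - {x} - {y} = A - {x, y}" for A :: "(nat \<times> nat) set" and x y by blast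
  show "cn (ss @ [s]) s F = cnt (edges (cyl ss)) (verts (cyl ss) - {apex ss s, port ss s}) F"
    "cn (ss @ [s]) j F = cnt (edges (cyl ss)) (verts (cyl ss) - {apex ss s, apex ss j}) F"
    "cn (ss @ [s]) k F = cnt (edges (cyl ss)) (verts (cyl ss) - {apex ss s, apex ss k}) F"
    unfolding cn_def p by (subst E, blast, simp only: core d2)+
  have "core (ss @ [s]) - {port ss s, apex ss j, apex ss k} = core ss - {port ss s}"
    unfolding core core_perm(1)[OF sjk(1), of ss] by blast
  then show "cn0 (ss @ [s]) F = cn ss s F"
    unfolding core_perm(2)[OF sjk(1)] p cn_def by (subst E) auto
  show "e \<in> edges ?G \<longleftrightarrow> e \<in> edges (cyl ss)" if "e \<subseteq> core (ss @ [s])" for e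
    using contract_edge_in[OF graph_cyl c] that unfolding con cs by blast
qed


text \<open>These are the three edges that an extension adds to the core: the rung and the strand
  edges at its two ends.\<close>

lemma edge_in_core:
  assumes sjk: "{s, j, k} = {1, 2, 3 :: nat}" "distinct [s, j, k]"
    and e: "e \<in> edges (cyl ss)" "e \<subseteq> verts (cyl ss) - {apex ss s}"
  shows "e \<subseteq> core ss \<or> e = {apex ss j, apex ss k} \<or> e = {apex ss j, port ss j} \<or> e = {apex ss k, port ss k}"
proof (cases "e \<subseteq> core ss")
  case False
  note t = tri_cyl_perm[OF sjk, of ss]
  have "apex ss j \<in> e \<or> apex ss k \<in> e" using False e(2) unfolding core_perm(1)[OF sjk(1)] by blast
  then show ?thesis
  proof
    assume "apex ss j \<in> e"
    then obtain w where w: "e = {apex ss j, w}" using edge_in_iff[OF graph_cyl e(1)] by blast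
    then have "w \<in> nbrs (cyl ss) (apex ss j)" using e(1) by (simp add: nbrs_def)
    then have "w \<in> {apex ss s, apex ss k, port ss j}" unfolding triD(4)[OF t] .
    then show ?thesis using w e(2) by blast
  next
    assume "apex ss k \<in> e"
    then obtain w where w: "e = {apex ss k, w}" using edge_in_iff[OF graph_cyl e(1)] by blast
    then have "w \<in> nbrs (cyl ss) (apex ss k)" using e(1) by (simp add: nbrs_def)
    then have "w \<in> {apex ss s, apex ss j, port ss k}" unfolding triD(5)[OF t] .
    then show ?thesis using w e(2) insert_commute[of "apex ss k" "apex ss j" "{}"] by blast
  qed
qed simp

text \<open>An edge of the core that lies in one matching in total, counted over all four ways of
  leaving ports, where that matching leaves port \<open>i\<close> alone.\<close>

definition tok :: "nat list \<Rightarrow> nat \<Rightarrow> (nat \<times> nat) set set" where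
  "tok ss i = {e \<in> edges (cyl ss). e \<subseteq> core ss \<and> cn ss i {e} = 1 \<and> cn0 ss {e} = 0 \<and>
     (\<forall>j\<in>{1, 2, 3} - {i}. cn ss j {e} = 0)}"

definition third :: "nat \<Rightarrow> nat \<Rightarrow> nat" where
  "third s i = 6 - s - i"

text \<open>The lonely edges are governed by a finite state: \<open>A\<close> is the set of strands \<open>i\<close> with
  \<open>cn ss i {} = 1\<close>, and \<open>B\<close> the set of strands \<open>i\<close> such that some edge below the top triangle lies
  in exactly one matching, which leaves port \<open>i\<close>.\<close>

definition state :: "nat list \<Rightarrow> nat set \<Rightarrow> nat set \<Rightarrow> bool" where
  "state ss A B \<longleftrightarrow> A \<subseteq> {1, 2, 3} \<and> B \<subseteq> {1, 2, 3} \<and> cn0 ss {} \<ge> 1 \<and>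
     (\<forall>i\<in>{1, 2, 3}. cn ss i {} \<ge> 1 \<and> (cn ss i {} = 1 \<longleftrightarrow> i \<in> A) \<and>
        card (tok ss i) = (if i \<in> B then 1 else 0)) \<and>
     (\<forall>e\<in>edges (cyl ss). e \<subseteq> core ss \<longrightarrow> cn0 ss {e} = 0 \<or> (\<exists>i\<in>{1, 2, 3}. cn ss i {e} \<noteq> 0))"

text \<open>If port \<open>s\<close> is left, the rung vertices are matched with each other or both
  downwards, giving the two summands. If rung vertex \<open>j\<close> is left, the other goes down
  along strand \<open>k\<close>. If all three are left, nothing below is used beyond leaving port
  \<open>s\<close>.\<close>

lemma cn_step:
  assumes sjk: "{s, j, k} = {1, 2, 3 :: nat}" "distinct [s, j, k]"
    and F: "\<And>e. e \<in> F \<Longrightarrow> e \<subseteq> core ss"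
  shows "cn (ss @ [s]) s F = cn ss s F + cn0 ss F" "cn (ss @ [s]) j F = cn ss k F"
    "cn (ss @ [s]) k F = cn ss j F" "cn0 (ss @ [s]) F = cn ss s F"
proof -
  note t = tri_cyl_perm[OF sjk, of ss]
  note cc = core_perm[OF sjk(1), of ss]
  have no: "{apex ss i, z} \<notin> F" if "i \<in> {s, j, k}" for i z
    using F that unfolding cc(1) by blast
  show "cn (ss @ [s]) s F = cn ss s F + cn0 ss F"
    unfolding cn_snoc(2)[OF sjk] cc(2) unfolding cn_def cc(1)
    by (rule cnt_tri_two[OF t]) (use no in auto)
  show "cn (ss @ [s]) j F = cn ss k F"
    unfolding cn_snoc(3)[OF sjk] unfolding cn_def cc(1)
    by (rule cnt_tri_one[OF t]) (use no in auto)
  have "verts (cyl ss) - {apex ss s, apex ss j, apex ss k} = verts (cyl ss) - {apex ss s, apex ss k, apex ss j}"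
    by blast
  then show "cn (ss @ [s]) k F = cn ss j F"
    unfolding cn_snoc(4)[OF sjk] unfolding cn_def cc(1)
    using cnt_tri_one[OF tri_perm(3)[OF t], of F] no by simp
  show "cn0 (ss @ [s]) F = cn ss s F" by (rule cn_snoc(5)[OF sjk])
qed

text \<open>Shows when a new token is born: the rung lies in one matching exactly if
  \<open>cn ss s {}\<close> is 1.\<close>

lemma cn_step_rung:
  fixes ss :: "nat list"
  assumes sjk: "{s, j, k} = {1, 2, 3 :: nat}" "distinct [s, j, k]"
  defines "e \<equiv> {apex ss j, apex ss k}"
  shows "cn (ss @ [s]) s {e} = cn ss s {}" "cn (ss @ [s]) j {e} = 0"
    "cn (ss @ [s]) k {e} = 0" "cn0 (ss @ [s]) {e} = 0"
proof -
  note t = tri_cyl_perm[OF sjk, of ss]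
  note cc = core_perm[OF sjk(1), of ss]
  show "cn (ss @ [s]) s {e} = cn ss s {}"
    unfolding cn_snoc(2)[OF sjk] e_def cnt_tri_inner(1)[OF t] unfolding cn_def cc(1) ..
  show "cn (ss @ [s]) j {e} = 0" "cn (ss @ [s]) k {e} = 0"
    unfolding cn_snoc(3,4)[OF sjk] e_def by (rule cnt_zero, simp, simp)+
  show "cn0 (ss @ [s]) {e} = 0"
    unfolding cn_snoc(5)[OF sjk] unfolding cn_def cc(1) e_def by (rule cnt_zero, simp, simp)
qed

text \<open>Two different counts are positive, so a strand edge never becomes a token.\<close>

lemma cn_step_strand:
  fixes ss :: "nat list"
  assumes sjk: "{s, j, k} = {1, 2, 3 :: nat}" "distinct [s, j, k]"
  defines "e \<equiv> {apex ss j, port ss j}"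
  shows "cn (ss @ [s]) s {e} = cn0 ss {}" "cn (ss @ [s]) k {e} = cn ss j {}"
proof -
  note t = tri_cyl_perm[OF sjk, of ss]
  note cc = core_perm[OF sjk(1), of ss]
  show "cn (ss @ [s]) s {e} = cn0 ss {}"
    unfolding cn_snoc(2)[OF sjk] e_def cnt_tri_inner(4)[OF t] cc(2) unfolding cc(1) ..
  show "cn (ss @ [s]) k {e} = cn ss j {}"
    unfolding cn_snoc(4)[OF sjk] e_def cnt_tri_inner(5)[OF t] unfolding cn_def cc(1) ..
qed

lemma strands:
  assumes "s \<in> {1, 2, 3 :: nat}"
  obtains j k where "{s, j, k} = {1, 2, 3}" "distinct [s, j, k]" "third s j = k" "third s k = j"
proof -
  consider "s = 1" | "s = 2" | "s = 3" using assms by auto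
  then show ?thesis
  proof cases
    case 1 then show ?thesis using that[of 2 3] by (simp add: third_def)
  next
    case 2 then show ?thesis using that[of 1 3] by (simp add: third_def insert_commute)
  next
    case 3 then show ?thesis using that[of 1 2] by (simp add: third_def insert_commute)
  qed
qed

text \<open>Strand \<open>s\<close> drops out of \<open>A\<close> because its count becomes a sum of
  two positive numbers, while the other two strands exchange their counts and tokens. A token on
  \<open>s\<close> is lost, since its edge is then also counted by \<open>cn0\<close>; the new rung
  replaces it if \<open>s\<close> was in \<open>A\<close>.\<close>

lemma state_snoc:
  assumes st: "state ss A B" and s: "s \<in> {1, 2, 3}"
  shows "state (ss @ [s]) (third s ` (A - {s})) (third s ` (B - {s}) \<union> (A \<inter> {s}))"
proof -
  obtain j k where sjk: "{s, j, k} = {1, 2, 3}" "distinct [s, j, k]" and th: "third s j = k" "third s k = j"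
    by (rule strands[OF s])
  have skj: "{s, k, j} = {1, 2, 3}" "distinct [s, k, j]" using sjk by auto
  let ?ss = "ss @ [s]" let ?rung = "{apex ss j, apex ss k}"
  have OT: "A \<subseteq> {s, j, k}" "B \<subseteq> {s, j, k}" and n0: "cn0 ss {} \<ge> 1"
    and ni: "\<And>i. i \<in> {s, j, k} \<Longrightarrow> cn ss i {} \<ge> 1 \<and> (cn ss i {} = 1 \<longleftrightarrow> i \<in> A) \<and>
        card (tok ss i) = (if i \<in> B then 1 else 0)"
    and nq: "\<And>e. e \<in> edges (cyl ss) \<Longrightarrow> e \<subseteq> core ss \<Longrightarrow> cn0 ss {e} = 0 \<or> (\<exists>i\<in>{s, j, k}. cn ss i {e} \<noteq> 0)"
    using st unfolding state_def sjk(1) by blast+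
  have d: "s \<noteq> j" "s \<noteq> k" "j \<noteq> k" "j \<noteq> s" "k \<noteq> s" "k \<noteq> j" using sjk(2) by auto
  have img: "third s ` (S - {s}) \<subseteq> {j, k} \<and> (j \<in> third s ` (S - {s}) \<longleftrightarrow> k \<in> S) \<and>
      (k \<in> third s ` (S - {s}) \<longleftrightarrow> j \<in> S)" if "S \<subseteq> {s, j, k}" for S
  proof -
    have "S - {s} = (if j \<in> S then {j} else {}) \<union> (if k \<in> S then {k} else {})" using that d by auto
    then show ?thesis using th d by auto
  qed
  have A': "third s ` (A - {s}) \<subseteq> {s, j, k}" "s \<notin> third s ` (A - {s})"
    "j \<in> third s ` (A - {s}) \<longleftrightarrow> k \<in> A" "k \<in> third s ` (A - {s}) \<longleftrightarrow> j \<in> A"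
    using img[OF OT(1)] d by blast+
  have B': "third s ` (B - {s}) \<union> (A \<inter> {s}) \<subseteq> {s, j, k}"
    "s \<in> third s ` (B - {s}) \<union> (A \<inter> {s}) \<longleftrightarrow> s \<in> A"
    "j \<in> third s ` (B - {s}) \<union> (A \<inter> {s}) \<longleftrightarrow> k \<in> B"
    "k \<in> third s ` (B - {s}) \<union> (A \<inter> {s}) \<longleftrightarrow> j \<in> B"
    using img[OF OT(2)] d by blast+
  note c0 = cn_step[OF sjk, where F = "{}", simplified]
  have cs: "core ?ss = verts (cyl ss) - {apex ss s}" by (rule cn_snoc(1)[OF sjk])
  have core_sub: "core ss \<subseteq> core ?ss" unfolding cs core_perm(1)[OF sjk(1), of ss] by blast
  have Eiff: "e \<subseteq> core ?ss \<Longrightarrow> e \<in> edges (cyl ?ss) \<longleftrightarrow> e \<in> edges (cyl ss)" for e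
    by (rule cn_snoc(6)[OF sjk])
  have edge: "e \<subseteq> core ss \<or> e = ?rung \<or> e = {apex ss j, port ss j} \<or> e = {apex ss k, port ss k}"
    if "e \<in> edges (cyl ?ss)" "e \<subseteq> core ?ss" for e
    using edge_in_core[OF sjk, of e ss] that Eiff[OF that(2)] unfolding cs by blast
  note t = tri_cyl_perm[OF sjk, of ss]
  have rungE: "?rung \<in> edges (cyl ?ss)" "?rung \<subseteq> core ?ss"
  proof -
    show r: "?rung \<subseteq> core ?ss" unfolding cs using triD(6)[OF t] tri_neq[OF t] by auto
    show "?rung \<in> edges (cyl ?ss)" unfolding Eiff[OF r] by (rule triD(9)[OF t])
  qed
  have ci: "cn ?ss s {e} = cn ss s {e} + cn0 ss {e}" "cn ?ss j {e} = cn ss k {e}"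
    "cn ?ss k {e} = cn ss j {e}" "cn0 ?ss {e} = cn ss s {e}" if "e \<subseteq> core ss" for e
    using cn_step[OF sjk, where F = "{e}"] that by simp_all
  note cr = cn_step_rung[OF sjk, of ss]
  have cst: "cn ?ss s {e} \<ge> 1 \<and> (cn ?ss k {e} \<ge> 1 \<or> cn ?ss j {e} \<ge> 1)"
    if "e = {apex ss j, port ss j} \<or> e = {apex ss k, port ss k}" for e
    using that cn_step_strand[OF sjk, of ss] cn_step_strand[OF skj, of ss] n0 ni[of j] ni[of k] by auto
  have tokE: "e \<in> tok ss' i \<longleftrightarrow> e \<in> edges (cyl ss') \<and> e \<subseteq> core ss' \<and> cn ss' i {e} = 1 \<and> cn0 ss' {e} = 0 \<and>
     (\<forall>j\<in>{s, j, k} - {i}. cn ss' j {e} = 0)" for e ss' i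
    by (simp only: tok_def sjk(1) mem_Collect_eq)
  have ts: "tok ?ss s = (if s \<in> A then {?rung} else {})"
  proof -
    have "e \<in> tok ?ss s \<longleftrightarrow> e = ?rung \<and> s \<in> A" for e
    proof
      assume e: "e \<in> tok ?ss s"
      then have eE: "e \<in> edges (cyl ?ss)" "e \<subseteq> core ?ss"
        and c: "cn ?ss s {e} = 1" "cn0 ?ss {e} = 0" "cn ?ss j {e} = 0" "cn ?ss k {e} = 0"
        unfolding tokE using d by auto
      have "\<not> e \<subseteq> core ss"
      proof
        assume ec: "e \<subseteq> core ss"
        then have "e \<in> edges (cyl ss)" using eE Eiff by blast
        \<comment> \<open>Without the last clause of \<open>state\<close>, an old edge used only
          when all three ports are left could become a token on \<open>s\<close>.\<close>
        then show False using nq[OF _ ec] c unfolding ci[OF ec] by auto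
      qed
      have "e = ?rung"
      proof (rule ccontr)
        assume "e \<noteq> ?rung"
        then have "e = {apex ss j, port ss j} \<or> e = {apex ss k, port ss k}"
          using edge[OF eE] \<open>\<not> e \<subseteq> core ss\<close> by blast
        from cst[OF this] show False using c by linarith
      qed
      then show "e = ?rung \<and> s \<in> A" using c(1) cr(1) ni[of s] by simp
    next
      assume e: "e = ?rung \<and> s \<in> A"
      have "cn ?ss s {?rung} = 1" using cr(1) ni[of s] e by simp
      moreover have "\<forall>i\<in>{s, j, k} - {s}. cn ?ss i {?rung} = 0" using cr(2,3) by auto
      ultimately have "?rung \<in> tok ?ss s" unfolding tokE using rungE cr(4) by (intro conjI)
      then show "e \<in> tok ?ss s" using e by (simp only:)
    qed
    then show ?thesis by (intro set_eqI) simp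
  qed
  have tj: "tok ?ss a = tok ss b" if ab: "a = j \<and> b = k \<or> a = k \<and> b = j" for a b
  proof -
    have tok_a: "e \<in> tok ss' a \<longleftrightarrow> e \<in> edges (cyl ss') \<and> e \<subseteq> core ss' \<and> cn ss' a {e} = 1 \<and> cn0 ss' {e} = 0 \<and>
        cn ss' s {e} = 0 \<and> cn ss' b {e} = 0" for e ss' unfolding tokE using d ab by auto
    have tok_b: "e \<in> tok ss' b \<longleftrightarrow> e \<in> edges (cyl ss') \<and> e \<subseteq> core ss' \<and> cn ss' b {e} = 1 \<and> cn0 ss' {e} = 0 \<and>
        cn ss' s {e} = 0 \<and> cn ss' a {e} = 0" for e ss' unfolding tokE using d ab by auto
    have cab: "cn ?ss a {e} = cn ss b {e}" "cn ?ss b {e} = cn ss a {e}" if "e \<subseteq> core ss" for e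
      using ci(2,3)[OF that] ab by auto
    have "e \<in> tok ?ss a \<longleftrightarrow> e \<in> tok ss b" for e
    proof
      assume e: "e \<in> tok ?ss a"
      then have eE: "e \<in> edges (cyl ?ss)" "e \<subseteq> core ?ss"
        and c: "cn ?ss a {e} = 1" "cn0 ?ss {e} = 0" "cn ?ss s {e} = 0" "cn ?ss b {e} = 0"
        unfolding tok_a by blast+
      have ec: "e \<subseteq> core ss"
      proof (rule ccontr)
        assume "\<not> e \<subseteq> core ss"
        then consider "e = ?rung" | "e = {apex ss j, port ss j} \<or> e = {apex ss k, port ss k}"
          using edge[OF eE] by blast
        then show False
        proof cases
          case 1 then show False using c(1) cr(2,3) ab by auto
        next
          case 2 then show False using c(3) cst by fastforce
        qed
      qed
      have "e \<in> edges (cyl ss)" using eE Eiff by blast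
      moreover have "cn ss b {e} = 1" using c(1) cab(1)[OF ec] by linarith
      moreover have "cn ss a {e} = 0" using c(4) cab(2)[OF ec] by linarith
      moreover have "cn ss s {e} = 0" "cn0 ss {e} = 0" using c(2,3) ci(1,4)[OF ec] by linarith+
      ultimately show "e \<in> tok ss b" unfolding tok_b using ec by (intro conjI)
    next
      assume "e \<in> tok ss b"
      then have eE: "e \<in> edges (cyl ss)" and ec: "e \<subseteq> core ss"
        and c: "cn ss b {e} = 1" "cn0 ss {e} = 0" "cn ss s {e} = 0" "cn ss a {e} = 0"
        unfolding tok_b by blast+
      have e': "e \<subseteq> core ?ss" using ec core_sub by blast
      then have "e \<in> edges (cyl ?ss)" using eE Eiff by blast
      moreover have "cn ?ss a {e} = 1" using c(1) cab(1)[OF ec] by linarith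
      moreover have "cn ?ss b {e} = 0" using c(4) cab(2)[OF ec] by linarith
      moreover have "cn ?ss s {e} = 0" "cn0 ?ss {e} = 0" using c(2,3) ci(1,4)[OF ec] by linarith+
      ultimately show "e \<in> tok ?ss a" unfolding tok_a using e' by (intro conjI)
    qed
    then show ?thesis by blast
  qed
  show ?thesis unfolding state_def sjk(1)[symmetric]
  proof (intro conjI ballI impI)
    show "third s ` (A - {s}) \<subseteq> {s, j, k}" "third s ` (B - {s}) \<union> (A \<inter> {s}) \<subseteq> {s, j, k}"
      by (fact A'(1) B'(1))+
    show "1 \<le> cn0 ?ss {}" using c0(4) ni[of s] by simp
    fix i assume "i \<in> {s, j, k}"
    then consider "i = s" | "i = j" | "i = k" by blast
    note i = this
    show "1 \<le> cn ?ss i {}" using i c0 ni[of s] ni[of j] ni[of k] by cases auto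
    show "(cn ?ss i {} = 1) = (i \<in> third s ` (A - {s}))"
      using i c0 A' ni[of s] ni[of j] ni[of k] n0 by cases auto
    show "card (tok ?ss i) = (if i \<in> third s ` (B - {s}) \<union> (A \<inter> {s}) then 1 else 0)"
      using i
    proof cases
      case 1 then show ?thesis using ts B'(2) by auto
    next
      case 2 then show ?thesis using tj[of j k] B'(3) ni[of k] by auto
    next
      case 3 then show ?thesis using tj[of k j] B'(4) ni[of j] by auto
    qed
  next
    fix e assume eE: "e \<in> edges (cyl ?ss)" "e \<subseteq> core ?ss"
    consider "e \<subseteq> core ss" | "e = ?rung" | "e = {apex ss j, port ss j} \<or> e = {apex ss k, port ss k}"
      using edge[OF eE] by blast
    then show "cn0 ?ss {e} = 0 \<or> (\<exists>i\<in>{s, j, k}. cn ?ss i {e} \<noteq> 0)"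
    proof cases
      case 1 then show ?thesis using ci[OF 1] by auto
    next
      case 2 then show ?thesis using cr(4) by simp
    next
      case 3 then show ?thesis using cst[OF 3] by auto
    qed
  qed
qed

lemma core_Nil: "core [] = {(0, 1), (0, 2), (0, 3)}"
proof -
  have "(l, i) \<in> verts (cyl []) \<longleftrightarrow> (l = 0 \<or> l = 1) \<and> (i = 1 \<or> i = 2 \<or> i = 3)" for l i
    by (auto simp: cyl_verts cyl_vertex_def)
  then show ?thesis unfolding core_def by (auto simp: set_eq_iff)
qed

text \<open>The core is the triangle \<open>T_u\<close>: removing one vertex leaves the opposite
  edge, which is its token, and removing all three leaves the empty matching.\<close>

lemma state_Nil: "state [] {1, 2, 3} {1, 2, 3}"
proof -
  let ?E = "edges (cyl [])"
  have b: "{(0, i), (0, j)} \<in> ?E" if "i \<in> {1, 2, 3}" "j \<in> {1, 2, 3}" "i \<noteq> j" for i j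
    unfolding cyl_edges cyl_adj_def cyl_vertex_def using that by simp
  have core: "core [] = {(0, s), (0, j), (0, k)}" if "{s, j, k} = {1, 2, 3}" for s j k
  proof -
    have "Pair 0 ` {s, j, k} = core []" unfolding that core_Nil by simp
    then show ?thesis by simp
  qed
  have n0: "cn0 [] {} = 1"
    unfolding cn0_def core_Nil port_Nil by (simp add: cnt_empty[OF graph_cyl, simplified])
  have pair: "cnt ?E {(0, j), (0, k)} {} = 1" if jk: "j \<in> {1, 2, 3}" "k \<in> {1, 2, 3}" "j \<noteq> k" for j k
  proof -
    have "nbrs (cyl []) (0, j) \<inter> {(0, j), (0, k)} = {(0, k)}"
      using b[OF jk] nbrs_sub[OF graph_cyl, of "[]" "(0, j)"] by (auto simp: nbrs_def)
    then have "cnt ?E {(0, j), (0, k)} {} = cnt ?E ({(0, j), (0, k)} - {(0, j), (0, k)}) {}"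
      by (intro cnt_one[OF graph_cyl]) auto
    then show ?thesis using cnt_empty[OF graph_cyl] by simp
  qed
  have main: "cn [] s {} = 1 \<and> tok [] s = {{(0, j), (0, k)}}"
    if sjk: "{s, j, k} = {1, 2, 3}" "distinct [s, j, k]" for s j k
  proof -
    have m: "s \<in> {1, 2, 3}" "j \<in> {1, 2, 3}" "k \<in> {1, 2, 3}" using sjk(1) by blast+
    have d: "s \<noteq> j" "s \<noteq> k" "j \<noteq> k" using sjk(2) by auto
    have X: "core [] - {port [] s} = {(0, j), (0, k)}" "core [] - {port [] j} = {(0, s), (0, k)}"
      "core [] - {port [] k} = {(0, s), (0, j)}"
      unfolding core[OF sjk(1)] port_Nil using d by auto
    have c1: "cn [] s {} = 1" unfolding cn_def X using pair m d by simp
    have eq: "e = {(0, j), (0, k)}" if e: "e \<in> ?E" "e \<subseteq> {(0, j), (0, k)}" for e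
    proof -
      obtain u v where "e = {u, v}" "u \<noteq> v" using e(1) by (rule graph_edgeE[OF graph_cyl])
      then show ?thesis using e(2) by auto
    qed
    have force: "cnt ?E {(0, j), (0, k)} {{(0, j), (0, k)}} = 1"
      using cnt_force[of "(0, j)" "(0, k)" ?E "{(0, j), (0, k)}" "{}"] b[OF m(2,3) d(3)]
        cnt_empty[OF graph_cyl, of "[]"] by simp
    have "e \<in> tok [] s \<longleftrightarrow> e = {(0, j), (0, k)}" for e
    proof
      assume e: "e \<in> tok [] s"
      then have "cn [] s {e} = 1" "e \<in> ?E" unfolding tok_def by blast+
      then have "e \<subseteq> {(0, j), (0, k)}" using cnt_zero[of e "{e}" "{(0, j), (0, k)}" ?E] unfolding cn_def X by auto
      then show "e = {(0, j), (0, k)}" using eq \<open>e \<in> ?E\<close> by blast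
    next
      assume e: "e = {(0, j), (0, k)}"
      have "cn [] i {e} = 0" if "i \<in> {1, 2, 3} - {s}" for i
      proof -
        have "i = j \<or> i = k" using that unfolding sjk(1)[symmetric] by blast
        moreover have "\<not> e \<subseteq> core [] - {port [] j}" unfolding e X(2) using d by simp
        moreover have "\<not> e \<subseteq> core [] - {port [] k}" unfolding e X(3) using d by simp
        ultimately have "\<not> e \<subseteq> core [] - {port [] i}" by metis
        then show ?thesis unfolding cn_def by (intro cnt_zero[of e]) simp_all
      qed
      moreover have "cn0 [] {e} = 0" unfolding cn0_def core_Nil port_Nil e
        by (rule cnt_zero) auto
      moreover have "cn [] s {e} = 1" unfolding cn_def X e by (rule force)
      ultimately show "e \<in> tok [] s" unfolding tok_def e core[OF sjk(1)] using b[OF m(2,3) d(3)] by simp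
    qed
    then show ?thesis using c1 by blast
  qed
  have s1: "cn [] i {} = 1 \<and> card (tok [] i) = 1" if i: "i \<in> {1, 2, 3}" for i
  proof -
    obtain j k where "{i, j, k} = {1, 2, 3}" "distinct [i, j, k]" "third i j = k" "third i k = j"
      by (rule strands[OF i])
    then show ?thesis using main by simp
  qed
  have "cn0 [] {e} = 0" if e: "e \<in> ?E" for e
  proof -
    obtain u v where "e = {u, v}" using e by (rule graph_edgeE[OF graph_cyl])
    then show ?thesis unfolding cn0_def core_Nil port_Nil by (intro cnt_zero[of e]) auto
  qed
  then show ?thesis unfolding state_def using s1 n0 by simp
qed

fun run :: "nat set \<times> nat set \<Rightarrow> nat list \<Rightarrow> nat set \<times> nat set" where
  "run (A, B) [] = (A, B)"
| "run (A, B) (s # ss) = run (third s ` (A - {s}), third s ` (B - {s}) \<union> (A \<inter> {s})) ss"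

lemma run_append: "run AB (ss @ ts) = run (run AB ss) ts"
  by (induction AB ss rule: run.induct) simp_all

definition final :: "nat list \<Rightarrow> nat set \<times> nat set" where
  "final ss = run ({1, 2, 3}, {1, 2, 3}) ss"

lemma final_snoc:
  "final (ss @ [s]) = (case final ss of (A, B) \<Rightarrow> (third s ` (A - {s}), third s ` (B - {s}) \<union> (A \<inter> {s})))"
  unfolding final_def run_append by (cases "run ({1, 2, 3}, {1, 2, 3}) ss") simp

lemma state_final: "set ss \<subseteq> {1, 2, 3} \<Longrightarrow> state ss (fst (final ss)) (snd (final ss))"
proof (induction ss rule: rev_induct)
  case Nil then show ?case using state_Nil by (simp add: final_def)
next
  case (snoc s ss)
  then show ?case using state_snoc[of ss "fst (final ss)" "snd (final ss)" s]
    by (cases "final ss") (simp add: final_snoc)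
qed

text \<open>A top edge opposite to apex \<open>i\<close> forces the strand edge at \<open>i\<close>
  and has count \<open>cn ss i {}\<close>, hence the summand \<open>card A\<close>. A strand edge at
  the top has at least two matchings. Inside the core the lonely edges are exactly the
  tokens.\<close>

lemma num_lonely_state:
  assumes st: "state ss A B"
  shows "num_lonely (cyl ss) = card A + card B"
proof -
  let ?G = "cyl ss" let ?E = "edges (cyl ss)"
  have AB: "A \<subseteq> {1, 2, 3}" "B \<subseteq> {1, 2, 3}" and n0: "cn0 ss {} \<ge> 1"
    and ni: "\<And>i. i \<in> {1, 2, 3} \<Longrightarrow> cn ss i {} \<ge> 1 \<and> (cn ss i {} = 1 \<longleftrightarrow> i \<in> A) \<and>
        card (tok ss i) = (if i \<in> B then 1 else 0)"
    and nq: "\<And>e. e \<in> ?E \<Longrightarrow> e \<subseteq> core ss \<Longrightarrow> cn0 ss {e} = 0 \<or> (\<exists>i\<in>{1, 2, 3}. cn ss i {e} \<noteq> 0)"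
    using st unfolding state_def by blast+
  note t = tri_cyl[of ss]
  define opp where "opp i = apex ss ` ({1, 2, 3} - {i})" for i
  have opp: "opp s = {apex ss j, apex ss k}" if "{s, j, k} = {1, 2, 3}" "distinct [s, j, k]" for s j k
    unfolding opp_def that(1)[symmetric] using that(2) by auto
  have oppl: "lonely ?G (opp i) \<longleftrightarrow> i \<in> A" "opp i \<in> ?E" "\<not> opp i \<subseteq> core ss"
    "\<not> lonely ?G {apex ss i, port ss i}" if i: "i \<in> {1, 2, 3}" for i
  proof -
    obtain j k where sjk: "{i, j, k} = {1, 2, 3}" "distinct [i, j, k]" "third i j = k" "third i k = j"
      by (rule strands[OF i])
    note ts = tri_cyl_perm[OF sjk(1,2), of ss]
    note cc = core_perm[OF sjk(1), of ss]
    show oe: "opp i \<in> ?E" unfolding opp[OF sjk(1,2)] by (rule triD(9)[OF ts])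
    show "\<not> opp i \<subseteq> core ss" unfolding opp[OF sjk(1,2)] cc(1) by blast
    have "cnt ?E (verts ?G) {opp i} = cn ss i {}"
      unfolding opp[OF sjk(1,2)] cnt_tri_inner(2)[OF ts] cn_def cc(1) ..
    then show "lonely ?G (opp i) \<longleftrightarrow> i \<in> A" unfolding lonely_cnt[OF graph_cyl] using oe ni[OF i] by simp
    have "cnt ?E (verts ?G) {{apex ss i, port ss i}} = cn ss i {} + cn0 ss {}"
      unfolding cnt_tri_inner(3)[OF ts] cc(2) unfolding cn_def cc(1) ..
    then show "\<not> lonely ?G {apex ss i, port ss i}"
      unfolding lonely_cnt[OF graph_cyl] using ni[OF i] n0 by simp
  qed
  have inner: "lonely ?G e \<longleftrightarrow> (\<exists>i\<in>{1, 2, 3}. e \<in> tok ss i)" if e: "e \<in> ?E" "e \<subseteq> core ss" for e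
  proof -
    have "cnt ?E (verts ?G) {e} = cn ss 1 {e} + cn ss 2 {e} + cn ss 3 {e} + cn0 ss {e}"
      using cnt_tri_all[OF t, of "{e}"] e(2) unfolding cn_def cn0_def core_def by simp
    then have lo: "lonely ?G e \<longleftrightarrow> cn ss 1 {e} + cn ss 2 {e} + cn ss 3 {e} + cn0 ss {e} = 1"
      unfolding lonely_cnt[OF graph_cyl] using e(1) by simp
    have tk: "e \<in> tok ss i \<longleftrightarrow> cn ss i {e} = 1 \<and> cn0 ss {e} = 0 \<and> (\<forall>j\<in>{1, 2, 3} - {i}. cn ss j {e} = 0)" for i
      unfolding tok_def mem_Collect_eq by (simp only: e simp_thms)
    have "e \<in> tok ss 1 \<longleftrightarrow> cn ss 1 {e} = 1 \<and> cn0 ss {e} = 0 \<and> cn ss 2 {e} = 0 \<and> cn ss 3 {e} = 0"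
      "e \<in> tok ss 2 \<longleftrightarrow> cn ss 2 {e} = 1 \<and> cn0 ss {e} = 0 \<and> cn ss 1 {e} = 0 \<and> cn ss 3 {e} = 0"
      "e \<in> tok ss 3 \<longleftrightarrow> cn ss 3 {e} = 1 \<and> cn0 ss {e} = 0 \<and> cn ss 1 {e} = 0 \<and> cn ss 2 {e} = 0"
      unfolding tk by (simp_all add: insert_Diff_if)
    moreover have "cn0 ss {e} = 0 \<or> cn ss 1 {e} \<noteq> 0 \<or> cn ss 2 {e} \<noteq> 0 \<or> cn ss 3 {e} \<noteq> 0"
      using nq[OF e] by blast
    \<comment> \<open>The value 1 cannot come from \<open>cn0\<close> alone, by the last clause of
      \<open>state\<close>, so it sits on one strand.\<close>
    moreover have "(a + b + c + d = 1) \<longleftrightarrow> (a = 1 \<and> d = 0 \<and> b = 0 \<and> c = 0) \<or>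
        (b = 1 \<and> d = 0 \<and> a = 0 \<and> c = 0) \<or> (c = 1 \<and> d = 0 \<and> a = 0 \<and> b = 0)"
      if "d = 0 \<or> a \<noteq> 0 \<or> b \<noteq> 0 \<or> c \<noteq> 0" for a b c d :: nat using that by (auto simp: add_is_1)
    moreover have "(\<exists>i\<in>{1, 2, 3}. e \<in> tok ss i) \<longleftrightarrow> e \<in> tok ss 1 \<or> e \<in> tok ss 2 \<or> e \<in> tok ss 3" by simp
    ultimately show ?thesis unfolding lo by simp
  qed
  have edge_class: "e \<subseteq> core ss \<or> (\<exists>i\<in>{1, 2, 3}. e = opp i \<or> e = {apex ss i, port ss i})" if e: "e \<in> ?E" for e
  proof (cases "apex ss 1 \<in> e")
    case True
    then obtain w where w: "e = {apex ss 1, w}" using edge_in_iff[OF graph_cyl e] by blast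
    then have "w \<in> nbrs ?G (apex ss 1)" using e by (simp add: nbrs_def)
    then have "w = apex ss 2 \<or> w = apex ss 3 \<or> w = port ss 1" unfolding triD(3)[OF t] by blast
    moreover have "opp 3 = {apex ss 1, apex ss 2}" "opp 2 = {apex ss 1, apex ss 3}"
      using opp[of 3 1 2] opp[of 2 1 3] by auto
    ultimately have "e = opp 3 \<or> e = opp 2 \<or> e = {apex ss 1, port ss 1}" using w by metis
    then show ?thesis by (elim disjE) simp_all
  next
    case False
    have sub: "e \<subseteq> verts ?G - {apex ss 1}" using False edge_subset[OF graph_cyl e] by blast
    have p: "{1, 2, 3} = {1, 2, 3 :: nat}" "distinct [1, 2, 3 :: nat]" by simp_all
    have "e \<subseteq> core ss \<or> e = opp 1 \<or> e = {apex ss 2, port ss 2} \<or> e = {apex ss 3, port ss 3}"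
      unfolding opp[OF p] by (rule edge_in_core[OF p e sub])
    then show ?thesis by (elim disjE) simp_all
  qed
  have tokE: "tok ss i \<subseteq> {e \<in> ?E. e \<subseteq> core ss}" for i unfolding tok_def by blast
  have fin: "finite ?E" by (rule finite_edges[OF graph_cyl])
  have eq: "{e \<in> ?E. lonely ?G e} = (\<Union>i\<in>{1, 2, 3}. tok ss i) \<union> opp ` A"
  proof (rule set_eqI)
    fix e
    show "e \<in> {e \<in> ?E. lonely ?G e} \<longleftrightarrow> e \<in> (\<Union>i\<in>{1, 2, 3}. tok ss i) \<union> opp ` A"
    proof
      assume "e \<in> {e \<in> ?E. lonely ?G e}"
      then have e: "e \<in> ?E" "lonely ?G e" by blast+
      consider "e \<subseteq> core ss" | i where "i \<in> {1, 2, 3}" "e = opp i" | i where "i \<in> {1, 2, 3}" "e = {apex ss i, port ss i}"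
        using edge_class[OF e(1)] by blast
      then show "e \<in> (\<Union>i\<in>{1, 2, 3}. tok ss i) \<union> opp ` A"
      proof cases
        case 1 then show ?thesis using inner[OF e(1) 1] e(2) by blast
      next
        case 2 then show ?thesis using oppl(1)[OF 2(1)] e(2) by blast
      next
        case 3 then show ?thesis using oppl(4)[OF 3(1)] e(2) by blast
      qed
    next
      assume "e \<in> (\<Union>i\<in>{1, 2, 3}. tok ss i) \<union> opp ` A"
      then consider i where "i \<in> {1, 2, 3}" "e \<in> tok ss i" | i where "i \<in> A" "e = opp i" by blast
      then show "e \<in> {e \<in> ?E. lonely ?G e}"
      proof cases
        case 1
        then have "e \<in> ?E" "e \<subseteq> core ss" using tokE[of i] by blast+
        then show ?thesis using inner 1 by blast
      next
        case 2
        then have "i \<in> {1, 2, 3}" using AB(1) by blast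
        then show ?thesis using oppl(1,2) 2 by blast
      qed
    qed
  qed
  have disj: "(\<Union>i\<in>{1, 2, 3}. tok ss i) \<inter> opp ` A = {}"
  proof (rule equals0I)
    fix e assume "e \<in> (\<Union>i\<in>{1, 2, 3}. tok ss i) \<inter> opp ` A"
    then obtain i a where "e \<in> tok ss i" "e = opp a" "a \<in> A" by blast
    then show False using tokE[of i] oppl(3)[of a] AB(1) by blast
  qed
  have fint: "finite (tok ss i)" for i using tokE[of i] fin finite_subset[of "tok ss i" ?E] by blast
  have tdisj: "tok ss i \<inter> tok ss j = {}" if "i \<in> {1, 2, 3}" "j \<in> {1, 2, 3}" "i \<noteq> j" for i j
  proof -
    have "e \<in> tok ss l \<Longrightarrow> cn ss l {e} = 1 \<and> (\<forall>j\<in>{1, 2, 3} - {l}. cn ss j {e} = 0)" for e l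
      unfolding tok_def mem_Collect_eq by (elim conjE) (intro conjI)
    from this[of _ i] this[of _ j] have "e \<notin> tok ss i \<inter> tok ss j" for e using that by fastforce
    then show ?thesis by blast
  qed
  have "card (\<Union>i\<in>{1, 2, 3}. tok ss i) = (\<Sum>i\<in>{1, 2, 3}. card (tok ss i))"
    by (rule card_UN_disjoint) (use fint tdisj in auto)
  also have "\<dots> = (\<Sum>i\<in>{1, 2, 3}. if i \<in> B then 1 else 0)" by (rule sum.cong) (use ni in auto)
  also have "\<dots> = card B"
    using AB(2) by (simp add: sum.If_cases Int_absorb1 del: sum.insert)
  finally have c1: "card (\<Union>i\<in>{1, 2, 3}. tok ss i) = card B" .
  have "inj_on opp A"
  proof (rule inj_onI)
    fix i j assume ij: "i \<in> A" "j \<in> A" "opp i = opp j"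
    show "i = j"
    proof (rule ccontr)
      assume "i \<noteq> j"
      then have "apex ss j \<in> opp i" "apex ss j \<notin> opp j" using ij(2) AB(1) unfolding opp_def by auto
      then show False using ij(3) by simp
    qed
  qed
  then have c2: "card (opp ` A) = card A" by (rule card_image)
  have finA: "finite (opp ` A)" using AB(1) finite_subset[of A "{1, 2, 3}"] by simp
  have "num_lonely ?G = card (\<Union>i\<in>{1, 2, 3}. tok ss i) + card (opp ` A)"
    unfolding num_lonely_def eq by (rule card_Un_disjoint[OF _ finA disj]) (use fint in simp)
  then show ?thesis using c1 c2 by simp
qed

subsection \<open>Patterns with three lonely edges\<close>

definition strand_perm :: "nat \<Rightarrow> nat \<Rightarrow> nat \<Rightarrow> bool" where
  "strand_perm a b c \<longleftrightarrow> {a, b, c} = {1, 2, 3} \<and> distinct [a, b, c]"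

lemma strand_permD:
  assumes "strand_perm a b c"
  shows "third a b = c" "third b a = c" "third a c = b" "third c a = b" "third b c = a" "third c b = a"
    "a \<noteq> b" "a \<noteq> c" "b \<noteq> c" "b \<noteq> a" "c \<noteq> a" "c \<noteq> b" "{1, 2, 3} = {a, b, c}" "c = 6 - a - b"
proof -
  have s: "{a, b, c} = {1, 2, 3}" "distinct [a, b, c]" using assms by (simp_all add: strand_perm_def)
  show "third a b = c" "third b a = c" "third a c = b" "third c a = b" "third b c = a" "third c b = a" "c = 6 - a - b"
    by (rule perm_cases[OF s]; simp add: third_def)+
  show "a \<noteq> b" "a \<noteq> c" "b \<noteq> c" "b \<noteq> a" "c \<noteq> a" "c \<noteq> b" "{1, 2, 3} = {a, b, c}" using s by auto
qed

lemma strand_perm_commute: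
  assumes "strand_perm a b c"
  shows "strand_perm b a c" "strand_perm a c b" "strand_perm c a b"
  using assms unfolding strand_perm_def by (auto simp: insert_commute)

lemma strand_perm_ex: "s \<in> {1, 2, 3} \<Longrightarrow> \<exists>j k. strand_perm s j k"
  by (erule strands) (auto simp: strand_perm_def)

abbreviation bent :: "nat \<Rightarrow> nat \<Rightarrow> nat \<Rightarrow> nat \<Rightarrow> nat \<Rightarrow> nat list" where
  "bent p r a b c \<equiv> replicate p a @ b # replicate r c"

context
  fixes a b c :: nat
  assumes p: "strand_perm a b c"
begin

lemma final_one: "final [a] = ({b, c}, {a, b, c})"
  using strand_permD[OF p] by (simp add: final_def insert_Diff_if insert_commute)

lemma final_replicate: "final (replicate (Suc (Suc m)) a) = ({b, c}, {b, c})"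
proof (induction m)
  case 0
  have "final (replicate (Suc (Suc 0)) a) = final ([a] @ [a])" by simp
  also have "\<dots> = ({b, c}, {b, c})"
    unfolding final_snoc[of "[a]"] final_one using strand_permD(1-12)[OF p] by (simp add: insert_Diff_if insert_commute)
  finally show ?case .
next
  case (Suc m)
  have snoc: "replicate (Suc (Suc (Suc m))) a = replicate (Suc (Suc m)) a @ [a]" by (simp add: replicate_append_same)
  show ?case
    unfolding snoc final_snoc Suc using strand_permD(1-12)[OF p] by (simp add: insert_Diff_if insert_commute)
qed

lemma final_two: "final [a, b] = ({a}, {a, b, c})"
  using strand_permD(1-12)[OF p] final_snoc[of "[a]" b] by (simp add: final_one insert_Diff_if insert_commute)

lemma final_aba: "final [a, b, a] = ({}, {a, b, c})"
  using strand_permD(1-12)[OF p] final_snoc[of "[a, b]" a] by (simp add: final_two insert_Diff_if insert_commute)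

lemma final_abb: "final [a, b, b] = ({c}, {a, c})"
  using strand_permD(1-12)[OF p] final_snoc[of "[a, b]" b] by (simp add: final_two insert_Diff_if insert_commute)

lemma final_abc: "final [a, b, c] = ({b}, {a, b})"
  using strand_permD(1-12)[OF p] final_snoc[of "[a, b]" c] by (simp add: final_two insert_Diff_if insert_commute)

text \<open>Index \<open>c\<close> exchanges strands \<open>a\<close> and \<open>b\<close> and meets
  neither a token nor a member of \<open>A\<close>, so nothing is lost.\<close>

lemma final_bent_step:
  assumes "final ss = ({a}, {a, b}) \<or> final ss = ({b}, {a, b})"
  shows "final (ss @ [c]) = ({a}, {a, b}) \<or> final (ss @ [c]) = ({b}, {a, b})"
  using assms strand_permD(1-12)[OF p] by (auto simp: final_snoc insert_Diff_if insert_commute)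

text \<open>Indices \<open>a\<close> and \<open>b\<close> both carry a token. Either
  \<open>A\<close> shrinks while the new rung replaces that token, or the token is lost without
  replacement.\<close>

lemma final_bent_other:
  assumes "final ss = ({a}, {a, b}) \<or> final ss = ({b}, {a, b})" "s = a \<or> s = b"
  shows "card (fst (final (ss @ [s]))) + card (snd (final (ss @ [s]))) \<le> 2"
  using assms strand_permD(1-12)[OF p] by (auto simp: final_snoc insert_Diff_if)

end

text \<open>The bound \<open>n + r >= 2\<close> is where the total has come down from 6 to 3; the
  two patterns of length 3 with a nonempty last block are evaluated directly.\<close>

lemma final_bent:
  assumes p: "strand_perm a b c"
  shows "n + r \<ge> 2 \<Longrightarrow> final (bent n r a b c) = ({a}, {a, b}) \<or> final (bent n r a b c) = ({b}, {a, b})"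
proof (induction r)
  case 0
  then obtain m where m: "n = Suc (Suc m)" by (metis add_0_right add_2_eq_Suc le_Suc_ex)
  have "final (replicate n a @ [b]) = ({a}, {a, b})"
    unfolding final_snoc m final_replicate[OF p] using strand_permD(1-12)[OF p] by (simp add: insert_Diff_if insert_commute)
  then show ?case by simp
next
  case (Suc r)
  show ?case
  proof (cases "n + r \<ge> 2")
    case True
    have "bent n (Suc r) a b c = bent n r a b c @ [c]" by (simp add: replicate_append_same)
    then show ?thesis using final_bent_step[OF p Suc.IH[OF True]] by simp
  next
    case False
    then consider "n = 0" "r = 1" | "n = 1" "r = 0" using Suc.prems by linarith
    then show ?thesis
    proof cases
      case 1
      have "strand_perm b c a" using p strand_perm_commute by blast
      then show ?thesis using final_abb[of b c a] 1 by (simp add: insert_commute)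
    next
      case 2
      then show ?thesis using final_abc[OF p] by simp
    qed
  qed
qed

text \<open>\<open>card A + card B\<close> never increases, so a pattern whose total is at most 2
  needs no further attention, and the remaining patterns can be followed letter by letter. From
  \<open>[a, b, a]\<close> every letter carries a token, so each extension falls to 2.\<close>

lemma final_classify:
  assumes "set ss \<subseteq> {1, 2, 3}"
  shows "card (fst (final ss)) + card (snd (final ss)) \<le> 2 \<or> ss = [] \<or>
    (\<exists>a b c. strand_perm a b c \<and> (ss = [a] \<or> (\<exists>m. ss = replicate (Suc (Suc m)) a) \<or> ss = [a, b] \<or>
       ss = [a, b, a] \<or> (\<exists>n r. n + r \<ge> 2 \<and> ss = bent n r a b c)))"
  using assms
proof (induction ss rule: rev_induct)
  case (snoc s ss)
  then have s: "s \<in> {1, 2, 3}" and ss: "set ss \<subseteq> {1, 2, 3}" by auto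
  let ?goal = "\<lambda>ss. \<exists>a b c. strand_perm a b c \<and> (ss = [a] \<or> (\<exists>m. ss = replicate (Suc (Suc m)) a) \<or> ss = [a, b] \<or>
       ss = [a, b, a] \<or> (\<exists>n r. n + r \<ge> 2 \<and> ss = bent n r a b c))"
  have sc: "s = a \<or> s = b \<or> s = c" if "strand_perm a b c" for a b c
    using s strand_permD(13)[OF that] by blast
  from snoc.IH[OF ss] consider (le) "card (fst (final ss)) + card (snd (final ss)) \<le> 2" | (Nil) "ss = []"
    | (one) a b c where "strand_perm a b c" "ss = [a]"
    | (rep) a b c m where "strand_perm a b c" "ss = replicate (Suc (Suc m)) a"
    | (two) a b c where "strand_perm a b c" "ss = [a, b]"
    | (aba) a b c where "strand_perm a b c" "ss = [a, b, a]"
    | (bent) a b c n r where "strand_perm a b c" "n + r \<ge> 2" "ss = bent n r a b c"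
    by blast
  then show ?case
  proof cases
    case le
    obtain A B where AB: "final ss = (A, B)" by fastforce
    have "state ss A B" using state_final[OF ss] AB by simp
    then have sub: "A \<subseteq> {1, 2, 3}" "B \<subseteq> {1, 2, 3}" unfolding state_def by blast+
    have fin: "finite A" "finite B" using sub finite_subset by (metis finite.emptyI finite_insert)+
    have "card (third s ` (A - {s})) \<le> card (A - {s})" by (rule card_image_le) (use fin in simp)
    moreover have "card (third s ` (B - {s}) \<union> (A \<inter> {s})) \<le> card (third s ` (B - {s})) + card (A \<inter> {s})"
      by (rule card_Un_le)
    moreover have "card (third s ` (B - {s})) \<le> card (B - {s})" by (rule card_image_le) (use fin in simp)
    moreover have "card (B - {s}) \<le> card B" by (rule card_mono) (use fin in auto)
    moreover have "card (A - {s}) + card (A \<inter> {s}) = card A"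
      using card_Un_disjoint[of "A - {s}" "A \<inter> {s}"] fin by (simp add: Un_Diff_Int Diff_Int_distrib2)
    ultimately have "card (fst (final (ss @ [s]))) + card (snd (final (ss @ [s]))) \<le> card A + card B"
      unfolding final_snoc AB by simp
    then show ?thesis using le AB by simp
  next
    case Nil
    obtain j k where "strand_perm s j k" using strand_perm_ex[OF s] by blast
    then have "?goal (ss @ [s])" using Nil by (intro exI conjI disjI1) auto
    then show ?thesis by blast
  next
    case one
    show ?thesis
    proof (cases "s = a")
      case True
      then have "ss @ [s] = replicate (Suc (Suc 0)) a" using one by simp
      then show ?thesis using one(1) by blast
    next
      case False
      then have "s = b \<or> s = c" using sc[OF one(1)] by blast
      then have "\<exists>d. strand_perm a s d" using one(1) strand_perm_commute(2)[OF one(1)] by blast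
      then obtain d where "strand_perm a s d" by blast
      moreover have "ss @ [s] = [a, s]" using one by simp
      ultimately show ?thesis by blast
    qed
  next
    case rep
    show ?thesis
    proof (cases "s = a")
      case True
      then have "ss @ [s] = replicate (Suc (Suc (Suc m))) a" using rep by (simp add: replicate_append_same)
      then show ?thesis using rep(1) by blast
    next
      case False
      then have "s = b \<or> s = c" using sc[OF rep(1)] by blast
      then have "\<exists>d. strand_perm a s d" using rep(1) strand_perm_commute(2)[OF rep(1)] by blast
      then obtain d where d: "strand_perm a s d" by blast
      have "ss @ [s] = bent (Suc (Suc m)) 0 a s d" "Suc (Suc m) + 0 \<ge> 2" using rep by simp_all
      then show ?thesis using d by blast
    qed
  next
    case two
    from sc[OF two(1)] show ?thesis
    proof (elim disjE)
      assume "s = a"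
      then have "ss @ [s] = [a, b, a]" using two by simp
      then show ?thesis using two(1) by blast
    next
      assume "s = b"
      \<comment> \<open>With the strands renamed, \<open>[a, b, b]\<close> is a bent pattern whose
        first block is empty.\<close>
      then have "ss @ [s] = bent 0 2 c a b" "(0::nat) + 2 \<ge> 2" using two by (simp_all add: numeral_2_eq_2)
      moreover have "strand_perm c a b" by (rule strand_perm_commute(3)[OF two(1)])
      ultimately show ?thesis by blast
    next
      assume "s = c"
      then have "ss @ [s] = bent 1 1 a b c" "(1::nat) + 1 \<ge> 2" using two by simp_all
      then show ?thesis using two(1) by blast
    qed
  next
    case aba
    have "card (fst (final (ss @ [s]))) + card (snd (final (ss @ [s]))) \<le> 2"
      unfolding final_snoc aba(2) final_aba[OF aba(1)]
      using sc[OF aba(1)] strand_permD(1-12)[OF aba(1)] by (elim disjE) (simp_all add: insert_Diff_if)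
    then show ?thesis by blast
  next
    case bent
    note f = final_bent[OF bent(1,2), folded bent(3)]
    show ?thesis
    proof (cases "s = c")
      case True
      then have "ss @ [s] = bent n (Suc r) a b c" "n + Suc r \<ge> 2" using bent by (simp_all add: replicate_append_same)
      then show ?thesis using bent(1) by blast
    next
      case False
      then have "s = a \<or> s = b" using sc[OF bent(1)] by blast
      then show ?thesis using final_bent_other[OF bent(1) f] by blast
    qed
  qed
qed simp

subsection \<open>The isomorphism with the extended prism\<close>

text \<open>Listing the triangle as \<open>s\<close>, \<open>j\<close>, \<open>k\<close> reveals an
  extension as the expansion of the vertex \<open>x s\<close>, so the uniqueness of expansions
  applies.\<close>

lemma ext_step_expand:
  assumes sjk: "{s, j, k} = {1, 2, 3 :: nat}" "distinct [s, j, k]"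
  shows "ext_step s (G, x, ou, n) =
    (expand G (x s) (ou s) (x j) (x k) (n + s) (n + j) (n + k), \<lambda>i. n + i,
     \<lambda>i. if i = s then ou s else x i, n + 3)"
proof -
  have comp: "{{n + i, x i} | i. i \<in> {1, 2, 3} \<and> i \<noteq> s} = {{n + j, x j}, {n + k, x k}}"
    unfolding sjk(1)[symmetric] using sjk(2) by auto
  have t: "{{n + 1, n + 2}, {n + 2, n + 3}, {n + 1, n + 3}} = {{n + s, n + j}, {n + j, n + k}, {n + s, n + k}}"
    by (rule perm_cases[OF sjk]) (simp_all add: insert_commute)
  have "(+) n ` {1, 2, 3} = (+) n ` {s, j, k}" by (simp only: sjk(1))
  then have v: "{n + 1, n + 2, n + 3} = {n + s, n + j, n + k}" by simp
  have "edges (fst (ext_step s (G, x, ou, n))) = edges (expand G (x s) (ou s) (x j) (x k) (n + s) (n + j) (n + k))"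
    unfolding ext_step_def expand_def Let_def prod.case fst_conv graph.select_convs comp t
    by (simp only: Un_insert_left Un_insert_right Un_empty_left Un_empty_right insert_commute)
  moreover have "verts (fst (ext_step s (G, x, ou, n))) = verts (expand G (x s) (ou s) (x j) (x k) (n + s) (n + j) (n + k))"
    unfolding ext_step_def expand_def Let_def prod.case fst_conv graph.select_convs v ..
  ultimately have "fst (ext_step s (G, x, ou, n)) = expand G (x s) (ou s) (x j) (x k) (n + s) (n + j) (n + k)" by simp
  moreover have "snd (ext_step s (G, x, ou, n)) = (\<lambda>i. n + i, \<lambda>i. if i = s then ou s else x i, n + 3)"
    unfolding ext_step_def Let_def prod.case snd_conv ..
  ultimately show ?thesis by (simp only: prod_eq_iff fst_conv snd_conv)
qed

text \<open>The invariant matches the moving labels with the cylinder: \<open>x\<close> are the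
  apexes and \<open>ou\<close> the ports. The bound by \<open>n\<close> makes \<open>n + 1\<close>,
  \<open>n + 2\<close>, \<open>n + 3\<close> fresh.\<close>

definition ext_iso :: "nat list \<Rightarrow> nat graph \<times> (nat \<Rightarrow> nat) \<times> (nat \<Rightarrow> nat) \<times> nat \<Rightarrow> bool" where
  "ext_iso ss st \<longleftrightarrow> (case st of (G, x, ou, n) \<Rightarrow> \<exists>f. isom f G (cyl ss) \<and>
     (\<forall>i\<in>{1, 2, 3}. x i \<in> verts G \<and> ou i \<in> verts G \<and> f (x i) = apex ss i \<and> f (ou i) = port ss i) \<and>
     (\<forall>v\<in>verts G. v \<le> n))"

lemma consec_Nil: "m \<le> 1 \<Longrightarrow> consec [] i l m \<longleftrightarrow> l < m"
  by (auto simp: consec_def)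

lemma ext_iso_init: "ext_iso [] prism_init"
proof -
  define G :: "nat graph" where "G = \<lparr>verts = {0, 1, 2, 3, 4, 5},
      edges = {{0, 1}, {1, 2}, {0, 2}, {3, 4}, {4, 5}, {3, 5}, {0, 3}, {1, 4}, {2, 5}}\<rparr>"
  \<comment> \<open>The labels are laid out in rows of three: 0, 1, 2 on level 0 and 3, 4, 5 on
    level 1.\<close>
  define f :: "nat \<Rightarrow> nat \<times> nat" where "f v = (v div 3, Suc (v mod 3))" for v
  have gG: "graph G"
    unfolding graph_def G_def graph.select_convs ball_simps
    by (intro conjI) (simp | (rule exI, rule exI, rule conjI, rule refl, simp))+
  have f: "f 0 = (0, 1)" "f 1 = (0, 2)" "f (Suc 0) = (0, 2)" "f 2 = (0, 3)" "f 3 = (1, 1)" "f (Suc (Suc (Suc 0))) = (1, 1)" "f 4 = (1, 2)" "f 5 = (1, 3)"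
    by (simp_all add: f_def)
  have V: "verts (cyl []) = {(0, 1), (0, 2), (0, 3), (1, 1), (1, 2), (1, 3)}"
  proof -
    have "(l, i) \<in> verts (cyl []) \<longleftrightarrow> (l = 0 \<or> l = 1) \<and> (i = 1 \<or> i = 2 \<or> i = 3)" for l i
      by (auto simp: cyl_verts cyl_vertex_def)
    then show ?thesis by (auto simp: set_eq_iff)
  qed
  have "isom f G (cyl [])"
  proof (rule isomI[OF gG graph_cyl])
    have "verts G = {0, 1, 2, 3, 4, 5}" by (simp add: G_def)
    then show "bij_betw f (verts G) (verts (cyl []))" unfolding V bij_betw_def inj_on_def by (simp add: f)
    fix u v assume "u \<in> verts G" "v \<in> verts G"
    then show "({u, v} \<in> edges G) = ({f u, f v} \<in> edges (cyl []))"
      unfolding cyl_edges G_def graph.select_convs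
      by (elim insertE emptyE; simp add: f cyl_adj_def cyl_vertex_def consec_Nil doubleton_eq_iff)
  qed
  then show ?thesis
    unfolding ext_iso_def prism_init_def prod.case G_def[symmetric]
    by (intro exI[of _ f] conjI) (simp_all add: f port_Nil G_def)
qed

lemma ext_iso_step:
  assumes st: "ext_iso ss st" and s: "s \<in> {1, 2, 3}"
  shows "ext_iso (ss @ [s]) (ext_step s st)"
proof -
  obtain G x ou n where st': "st = (G, x, ou, n)" by (metis prod_cases4)
  obtain f where f: "isom f G (cyl ss)"
    and xi: "\<And>i. i \<in> {1, 2, 3} \<Longrightarrow> x i \<in> verts G \<and> ou i \<in> verts G \<and> f (x i) = apex ss i \<and> f (ou i) = port ss i"
    and n: "\<And>v. v \<in> verts G \<Longrightarrow> v \<le> n"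
    using st unfolding ext_iso_def st' prod.case by blast
  obtain j k where sjk: "{s, j, k} = {1, 2, 3}" "distinct [s, j, k]" and "third s j = k" "third s k = j"
    by (rule strands[OF s])
  have m: "j \<in> {1, 2, 3}" "k \<in> {1, 2, 3}" using sjk(1) by blast+
  note d = isomD[OF f]
  note tc = tri_cyl_perm[OF sjk, of ss] and tc' = tri_cyl_perm[OF sjk, of "ss @ [s]"]
  note ne = tri_neq[OF tc]
  have nb: "nbrs G (x s) = {ou s, x j, x k}"
  proof -
    have "f ` nbrs G (x s) = f ` {ou s, x j, x k}"
      using isom_nbrs[OF f, of "x s"] xi[OF s] xi[OF m(1)] xi[OF m(2)] triD(3)[OF tc] by auto
    moreover have "nbrs G (x s) \<subseteq> verts G" using nbrs_sub[OF d(1)] by blast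
    moreover have "{ou s, x j, x k} \<subseteq> verts G" using xi[OF s] xi[OF m(1)] xi[OF m(2)] by blast
    ultimately show ?thesis using inj_on_image_eq_iff[OF d(4)] by blast
  qed
  have dist: "distinct [ou s, x j, x k]" "x j \<noteq> x s" "x k \<noteq> x s" "ou s \<noteq> x s"
    using ne xi[OF s] xi[OF m(1)] xi[OF m(2)] by auto
  have fresh: "n + i \<notin> verts G" if "i \<in> {1, 2, 3}" for i using n[of "n + i"] that by auto
  have dn: "distinct [n + s, n + j, n + k]" using sjk(2) by simp
  let ?H = "expand G (x s) (ou s) (x j) (x k) (n + s) (n + j) (n + k)"
  have xs: "x s \<in> verts G" using xi[OF s] by blast
  note e = expand_tri[OF d(1) xs nb dist(1) dn fresh[OF s] fresh[OF m(1)] fresh[OF m(2)]]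
  have T: "{apex (ss @ [s]) s, apex (ss @ [s]) j, apex (ss @ [s]) k} =
     {apex (ss @ [s]) 1, apex (ss @ [s]) 2, apex (ss @ [s]) 3}"
  proof -
    have "apex (ss @ [s]) ` {s, j, k} = apex (ss @ [s]) ` {1, 2, 3}" by (simp only: sjk(1))
    then show ?thesis by simp
  qed
  have c': "apex ss s \<notin> verts (cyl (ss @ [s])) - {apex (ss @ [s]) s, apex (ss @ [s]) j, apex (ss @ [s]) k}"
    by (simp add: cyl_verts cyl_vertex_snoc)
  have po: "port (ss @ [s]) s = port ss s" "port (ss @ [s]) j = apex ss j" "port (ss @ [s]) k = apex ss k"
    using sjk(2) by (auto simp: port_snoc)
  let ?f = "f(n + s := apex (ss @ [s]) s, n + j := apex (ss @ [s]) j, n + k := apex (ss @ [s]) k)"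
  have i: "isom ?f ?H (cyl (ss @ [s]))"
  proof (rule isom_expand[OF e(1) tc' e(2) c'])
    show "isom f (contract ?H {n + s, n + j, n + k} (x s))
       (contract (cyl (ss @ [s])) {apex (ss @ [s]) s, apex (ss @ [s]) j, apex (ss @ [s]) k} (apex ss s))"
      unfolding e(3) T contract_cyl[OF s] by (rule f)
    show "f (x s) = apex ss s" "f (ou s) = port (ss @ [s]) s" "f (x j) = port (ss @ [s]) j" "f (x k) = port (ss @ [s]) k"
      unfolding po using xi[OF s] xi[OF m(1)] xi[OF m(2)] by simp_all
  qed
  have VH: "verts ?H = (verts G - {x s}) \<union> {n + s, n + j, n + k}" by (simp add: expand_def)
  have old: "?f v = f v" if "v \<in> verts G" for v using fresh[OF s] fresh[OF m(1)] fresh[OF m(2)] that by auto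
  have new: "?f (n + i) = apex (ss @ [s]) i" if "i \<in> {s, j, k}" for i using that by auto
  have "\<forall>i\<in>{s, j, k}. n + i \<in> verts ?H \<and> (if i = s then ou s else x i) \<in> verts ?H \<and> ?f (n + i) = apex (ss @ [s]) i \<and>
      ?f (if i = s then ou s else x i) = port (ss @ [s]) i"
  proof
    fix i assume i: "i \<in> {s, j, k}"
    have "n + i \<in> verts ?H" using i unfolding VH by blast
    moreover have "(if i = s then ou s else x i) \<in> verts G - {x s} \<and> f (if i = s then ou s else x i) = port (ss @ [s]) i"
      using i po dist xi[OF s] xi[OF m(1)] xi[OF m(2)] sjk(2) by auto
    ultimately show "n + i \<in> verts ?H \<and> (if i = s then ou s else x i) \<in> verts ?H \<and> ?f (n + i) = apex (ss @ [s]) i \<and>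
      ?f (if i = s then ou s else x i) = port (ss @ [s]) i"
      using new[OF i] old[of "if i = s then ou s else x i"] unfolding VH by simp
  qed
  moreover have "\<forall>v\<in>verts ?H. v \<le> n + 3" unfolding VH using n s m by fastforce
  ultimately show ?thesis
    unfolding st' ext_step_expand[OF sjk] ext_iso_def prod.case sjk(1)[symmetric] using i by blast
qed

lemma isom_ext_prism:
  assumes "set ss \<subseteq> {1, 2, 3}"
  obtains f where "isom f (ext_prism ss) (cyl ss)"
proof -
  have "ext_iso ss (foldl (\<lambda>st s. ext_step s st) prism_init ss)"
    using assms
  proof (induction ss rule: rev_induct)
    case Nil show ?case using ext_iso_init by simp
  next
    case (snoc s ss) then show ?case using ext_iso_step[of ss _ s] by simp
  qed
  then show ?thesis using that unfolding ext_iso_def ext_prism_def by (auto split: prod.splits)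
qed

section \<open>The characterisation of the graphs with three lonely edges\<close>

lemma classU_3_isom:
  assumes "isom f G H" "cubic3 H" "num_lonely H = 3"
  shows "classU_k 3 G"
proof -
  have "isom (inv_into (verts G) f) H G" by (rule isom_inv[OF assms(1)])
  then show ?thesis using isom_cubic3 assms isom_num_lonely[OF assms(1)] by (auto simp: classU_k_iff)
qed

lemma classU_3_ext_prism:
  assumes i: "iso G (ext_prism ss)" and ss: "set ss \<subseteq> {1, 2, 3}"
    and c: "card (fst (final ss)) + card (snd (final ss)) = 3"
  shows "classU_k 3 G"
proof -
  obtain g where g: "isom g G (ext_prism ss)" using i iso_iff by blast
  obtain f where f: "isom f (ext_prism ss) (cyl ss)" by (rule isom_ext_prism[OF ss])
  have "num_lonely (cyl ss) = 3" using num_lonely_state[OF state_final[OF ss]] c by simp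
  then show ?thesis by (rule classU_3_isom[OF isom_trans[OF g f] cubic3_cyl[OF ss]])
qed

lemma iso_ext_prism_map:
  assumes f: "isom f G (cyl ss)" and ss: "set ss \<subseteq> {1, 2, 3}" and p: "bij_betw \<pi> {1, 2, 3} {1, 2, 3}"
  shows "iso G (ext_prism (map \<pi> ss))"
proof -
  have "\<pi> ` set ss \<subseteq> \<pi> ` {1, 2, 3}" using ss by (rule image_mono)
  also have "\<pi> ` {1, 2, 3} = {1, 2, 3}" using p by (rule bij_betw_imp_surj_on)
  finally have "set (map \<pi> ss) \<subseteq> {1, 2, 3}" by (simp only: set_map)
  then obtain g where "isom g (ext_prism (map \<pi> ss)) (cyl (map \<pi> ss))" by (rule isom_ext_prism)
  then have "isom (inv_into (verts (ext_prism (map \<pi> ss))) g) (cyl (map \<pi> ss)) (ext_prism (map \<pi> ss))"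
    by (rule isom_inv)
  from isom_trans[OF isom_trans[OF f isom_cyl_map[OF p ss]] this] show ?thesis unfolding iso_iff by blast
qed

theorem mainTheorem13:
  fixes G :: "'a graph"
  shows "classU_k 3 G \<longleftrightarrow>
    classW3 G \<or>
    (\<exists>k h. 3 \<le> k \<and> 1 \<le> h \<and> h \<le> k \<and>
       iso G (ext_prism (replicate (h - 1) 3 @ [2] @ replicate (k - h) 1)))"
proof
  assume U: "classU_k 3 G"
  then have G: "cubic3 G" and l3: "num_lonely G = 3" by (simp_all add: classU_k_iff)
  obtain e where e: "lonely G e" using U by (auto simp: classU_k_def classU_def)
  from lonely_structure[OF G e]
  show "classW3 G \<or> (\<exists>k h. 3 \<le> k \<and> 1 \<le> h \<and> h \<le> k \<and>
       iso G (ext_prism (replicate (h - 1) 3 @ [2] @ replicate (k - h) 1)))"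
  proof (elim disjE exE conjE)
    assume "card (verts G) = 4"
    then show ?thesis using num_lonely_four[OF G] l3 by simp
  next
    fix ss f assume ss: "set ss \<subseteq> {1, 2, 3}" and f: "isom f G (cyl ss)"
    have c3: "card (fst (final ss)) + card (snd (final ss)) = 3"
      using num_lonely_state[OF state_final[OF ss]] isom_num_lonely[OF f] l3 by simp
    then have "\<not> card (fst (final ss)) + card (snd (final ss)) \<le> 2" by simp
    then consider (Nil) "ss = []"
      | (one) a b c where "strand_perm a b c" "ss = [a]"
      | (rep) a b c m where "strand_perm a b c" "ss = replicate (Suc (Suc m)) a"
      | (two) a b c where "strand_perm a b c" "ss = [a, b]"
      | (aba) a b c where "strand_perm a b c" "ss = [a, b, a]"
      | (bent) a b c n r where "strand_perm a b c" "n + r \<ge> 2" "ss = bent n r a b c"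
      using final_classify[OF ss] by blast
    then show ?thesis
    proof cases
      case Nil
      then have "final ss = ({1, 2, 3}, {1, 2, 3})" by (simp add: final_def)
      then show ?thesis using c3 by simp
    next
      case one
      then show ?thesis using c3 strand_permD(7-12)[OF one(1)] unfolding one(2) final_one[OF one(1)] by simp
    next
      case rep
      have "final ss = ({b, c}, {b, c})" unfolding rep(2) by (rule final_replicate[OF rep(1)])
      then show ?thesis using c3 strand_permD(7-12)[OF rep(1)] by simp
    next
      case two
      then show ?thesis using c3 strand_permD(7-12)[OF two(1)] unfolding two(2) final_two[OF two(1)] by simp
    next
      case aba
      have ab: "a \<in> {1, 2, 3}" "b \<in> {1, 2, 3}" "a \<noteq> b"
        using strand_permD(7,13)[OF aba(1)] by blast+
      \<comment> \<open>Renaming the strands turns \<open>[a, b, a]\<close> into the exceptional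
        pattern.\<close>
      obtain \<pi> :: "nat \<Rightarrow> nat" where pi: "bij_betw \<pi> {1, 2, 3} {1, 2, 3}" "\<pi> a = 3" "\<pi> b = 1"
        using perm3[OF ab, of 3 1] by auto
      have "map \<pi> ss = [3, 1, 3]" using aba(2) pi by simp
      then have "iso G (ext_prism [3, 1, 3])" using iso_ext_prism_map[OF f ss pi(1)] by simp
      then show ?thesis unfolding classW3_def by blast
    next
      case bent
      note p = strand_permD[OF bent(1)]
      have ab: "a \<in> {1, 2, 3}" "b \<in> {1, 2, 3}" "a \<noteq> b" using p(7,13) by blast+
      obtain \<pi> :: "nat \<Rightarrow> nat" where pi: "bij_betw \<pi> {1, 2, 3} {1, 2, 3}" "\<pi> a = 3" "\<pi> b = 2" "\<pi> (6 - a - b) = 1"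
        using perm3[OF ab, of 3 2] by auto
      have "map \<pi> ss = replicate n 3 @ [2] @ replicate r 1"
        unfolding bent(3) using pi(2,3) pi(4)[folded p(14)] by simp
      \<comment> \<open>The parameters are \<open>h = n + 1\<close> and
        \<open>k = n + r + 1\<close>, so \<open>k >= 3\<close> is the bound
        \<open>n + r >= 2\<close>.\<close>
      then have "iso G (ext_prism (replicate (Suc n - 1) 3 @ [2] @ replicate ((n + r + 1) - Suc n) 1))"
        using iso_ext_prism_map[OF f ss pi(1)] by simp
      moreover have "3 \<le> n + r + 1" "1 \<le> Suc n" "Suc n \<le> n + r + 1" using bent(2) by simp_all
      ultimately show ?thesis by blast
    qed
  next
    assume "tdesc G"
    then show ?thesis using U unfolding classW3_def tdesc_iff by blast
  qed
next
  have perm: "strand_perm 3 2 1" "strand_perm 3 1 2" by (auto simp: strand_perm_def)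
  assume "classW3 G \<or> (\<exists>k h. 3 \<le> k \<and> 1 \<le> h \<and> h \<le> k \<and>
       iso G (ext_prism (replicate (h - 1) 3 @ [2] @ replicate (k - h) 1)))"
  then show "classU_k 3 G"
  proof (elim disjE exE conjE)
    assume "classW3 G"
    then consider "iso G tricorn" | "classU_k 3 G" | "iso G (ext_prism [3, 1, 3])" unfolding classW3_def by blast
    then show ?thesis
    proof cases
      case 1
      then show ?thesis unfolding iso_iff using classU_3_isom[OF _ cubic3_tricorn num_lonely_tricorn] by blast
    next
      case 3
      have "card (fst (final [3, 1, 3])) + card (snd (final [3, 1, 3])) = 3" unfolding final_aba[OF perm(2)] by simp
      with 3 show ?thesis by (intro classU_3_ext_prism[of G "[3, 1, 3]"]) simp_all
    qed
  next
    fix k h :: nat assume kh: "3 \<le> k" "1 \<le> h" "h \<le> k"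
      and i: "iso G (ext_prism (replicate (h - 1) 3 @ [2] @ replicate (k - h) 1))"
    \<comment> \<open>The two blocks have total length \<open>k - 1\<close>.\<close>
    have "(h - 1) + (k - h) \<ge> 2" using kh by simp
    from final_bent[OF perm(1) this]
    have "card (fst (final (replicate (h - 1) 3 @ [2] @ replicate (k - h) 1))) +
        card (snd (final (replicate (h - 1) 3 @ [2] @ replicate (k - h) 1))) = 3" by auto
    moreover have "set (replicate (h - 1) 3 @ [2] @ replicate (k - h) 1) \<subseteq> {1, 2, 3 :: nat}"
      by (auto simp: set_replicate_conv_if)
    ultimately show ?thesis using classU_3_ext_prism[OF i] by blast
  qed
qed

end
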